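(* Let $M_s^n$ be a connected pseudo-Riemannian manifold of dimension $n\ge 2$ and index $s$ with $0<s<n$, let $\psi\colon M_s^n\to\mathbb E^{n+d}_\nu$ be an isometric immersion into pseudo-Euclidean space, and let $k\ge 2$ be an integer. The following assertions are equivalent: (i) $M_s^n$ has contact of order $k$; (ii) $M_s^n$ has spacelike contact of order $k$; (iii) $M_s^n$ has timelike contact of order $k$. In particular, $\mathfrak c(M_s^n)=\mathfrak c_+(M_s^n)=\mathfrak c_-(M_s^n)$, as elements of $\mathbb N\cup\{\infty\}$.
   Context: $\mathbb E^{n+d}_\nu$ is the flat pseudo-Euclidean space of dimension $n+d$ and index $\nu$. Everything is smooth, and the induced metric on $M_s^n$ is non-degenerate of index $s$. Tangent vectors are identified with their images under $d\psi$, and curves in $M_s^n$ with their images under $\psi$. $T_p^\perp M_s^n$ denotes the normal space at $p$. Normal sections. For $p\in M_s^n$ and $u\in T_pM_s^n$ with $\langle u,u\rangle=\varepsilon\in\{1,-1\}$, let $\gamma_u$ be the geodesic of $M_s^n$ with $\gamma_u(0)=p$, $\gamma_u'(0)=u$. Let $E(p,u)=\psi(p)+(\mathbb R u\oplus T_p^\perp M_s^n)$. Locally, the component through $\psi(p)$ of $\psi(M_s^n)\cap E(p,u)$ (where $\psi$ is restricted to a small neighbourhood of $p$) is a regular non-degenerate curve; its unit-speed parametrization $\beta_u$ (i.e. $\langle\beta_u',\beta_u'\rangle=\varepsilon$) with $\beta_u(0)=p$, $\beta_u'(0)=u$ is the normal section at $(p,u)$. Contact. $\gamma_u$ and $\beta_u$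 have contact of order $k$ at $(p,u)$ if $\gamma_u^{(r)}(0)=\beta_u^{(r)}(0)$ for all $0\le r\le k$, derivatives being taken in the ambient affine space. Let $U_+M_s^n=\{u\in TM_s^n:\langle u,u\rangle=1\}$ and $U_-M_s^n=\{u\in TM_s^n:\langle u,u\rangle=-1\}$. The immersion has spacelike (resp. timelike) contact of order $k$ if $\gamma_u$ and $\beta_u$ have contact of order $k$ for every $u\in U_+M_s^n$ (resp. every $u\in U_-M_s^n$). It has contact of order $k$ if it has both spacelike and timelike contact of order $k$. The contact numbers $\mathfrak c_+(M_s^n)$, $\mathfrak c_-(M_s^n)$, $\mathfrak c(M_s^n)$ are the suprema of the $k\in\mathbb N$ for which $M_s^n$ has, respectively, spacelike contact, timelike contact, contact of order $k$ (value $\infty$ if the set is unbounded). *)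

theory Defs
  imports "HOL-Analysis.Analysis" "HOL-Library.Extended_Nat"
begin

section \<open>Smooth maps and iterated derivatives of curves\<close>

(* Intended for open S only. *)
primrec Ck_on :: "nat \<Rightarrow> ('a::euclidean_space \<Rightarrow> 'b::real_normed_vector) \<Rightarrow> 'a set \<Rightarrow> bool" where
  "Ck_on 0 = (\<lambda>f S. continuous_on S f)"
| "Ck_on (Suc k) = (\<lambda>f S. (\<forall>x\<in>S. f differentiable (at x)) \<and>
      (\<forall>v. Ck_on k (\<lambda>x. frechet_derivative f (at x) v) S))"

definition smooth_on :: "'a set \<Rightarrow> ('a::euclidean_space \<Rightarrow> 'b::real_normed_vector) \<Rightarrow> bool" where
  "smooth_on S f \<longleftrightarrow> (\<forall>k. Ck_on k f S)"

definition vderiv :: "(real \<Rightarrow> 'b::real_normed_vector) \<Rightarrow> real \<Rightarrow> 'b" where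
  "vderiv f = (\<lambda>t. vector_derivative f (at t))"

definition higher_vderiv :: "nat \<Rightarrow> (real \<Rightarrow> 'b::real_normed_vector) \<Rightarrow> real \<Rightarrow> 'b" where
  "higher_vderiv r f = (vderiv ^^ r) f"

section \<open>Scalar products\<close>

(* The scalar product of the pseudo-Euclidean space of dimension CARD('e) and index card N:
   the coordinates in N are the negative ones. *)
definition pseudo_inner :: "'e::finite set \<Rightarrow> real^'e \<Rightarrow> real^'e \<Rightarrow> real" where
  "pseudo_inner N x y = (\<Sum>i\<in>UNIV. (if i \<in> N then - 1 else 1) * (x $ i) * (y $ i))"

definition nondegenerate_form :: "(real^'n \<Rightarrow> real^'n \<Rightarrow> real) \<Rightarrow> bool" where
  "nondegenerate_form B \<longleftrightarrow> (\<forall>v. (\<forall>w. B v w = 0) \<longrightarrow> v = 0)"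

definition form_index :: "(real^'n \<Rightarrow> real^'n \<Rightarrow> real) \<Rightarrow> nat" where
  "form_index B = Max (dim ` {W. subspace W \<and> (\<forall>w\<in>W. w \<noteq> 0 \<longrightarrow> B w w < 0)})"

section \<open>Pseudo-Riemannian manifolds\<close>

(* A manifold is a whole Hausdorff, second countable type 'm with an atlas, which need not be
   maximal. A chart is a pair of its domain and its coordinate map; the values of the coordinate
   map outside the domain are irrelevant. *)
type_synonym ('m, 'n) chart = "'m set \<times> ('m \<Rightarrow> real^'n)"

abbreviation chart_dom :: "('m, 'n) chart \<Rightarrow> 'm set" where
  "chart_dom c \<equiv> fst c"

abbreviation coord :: "('m, 'n) chart \<Rightarrow> 'm \<Rightarrow> real^'n" where
  "coord c \<equiv> snd c"

abbreviation chart_ran :: "('m, 'n) chart \<Rightarrow> (real^'n) set" where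
  "chart_ran c \<equiv> coord c ` chart_dom c"

definition param :: "('m, 'n) chart \<Rightarrow> real^'n \<Rightarrow> 'm" where
  "param c = inv_into (chart_dom c) (coord c)"

definition smooth_atlas ::
    "('m::{t2_space, second_countable_topology}, 'n::finite) chart set \<Rightarrow> bool" where
  "smooth_atlas A \<longleftrightarrow>
     (\<Union>c\<in>A. chart_dom c) = UNIV \<and>
     (\<forall>c\<in>A. open (chart_dom c) \<and> open (chart_ran c) \<and>
             homeomorphism (chart_dom c) (chart_ran c) (coord c) (param c)) \<and>
     (\<forall>c\<in>A. \<forall>c'\<in>A. smooth_on (coord c ` (chart_dom c \<inter> chart_dom c')) (coord c' \<circ> param c))"

(* A metric is given by its component matrices: g c x is the matrix of the metric in the chart c
   at the point with coordinates x. *)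
type_synonym ('m, 'n) metric = "('m, 'n) chart \<Rightarrow> real^'n \<Rightarrow> real^'n^'n"

definition metric_form ::
    "('m, 'n::finite) metric \<Rightarrow> ('m, 'n) chart \<Rightarrow> real^'n \<Rightarrow> real^'n \<Rightarrow> real^'n \<Rightarrow> real" where
  "metric_form g c x v w = v \<bullet> (g c x *v w)"

definition pseudo_riemannian_metric ::
    "('m::{t2_space, second_countable_topology}, 'n::finite) chart set \<Rightarrow> nat
      \<Rightarrow> ('m, 'n) metric \<Rightarrow> bool" where
  "pseudo_riemannian_metric A s g \<longleftrightarrow>
     (\<forall>c\<in>A. smooth_on (chart_ran c) (g c)) \<and>
     (\<forall>c\<in>A. \<forall>x\<in>chart_ran c. transpose (g c x) = g c x \<and>
        nondegenerate_form (metric_form g c x) \<and> form_index (metric_form g c x) = s) \<and>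
     (\<forall>c\<in>A. \<forall>c'\<in>A. \<forall>p\<in>chart_dom c \<inter> chart_dom c'. \<forall>v w.
        metric_form g c (coord c p) v w =
        metric_form g c' (coord c' p)
          (frechet_derivative (coord c' \<circ> param c) (at (coord c p)) v)
          (frechet_derivative (coord c' \<circ> param c) (at (coord c p)) w))"

definition partial_deriv :: "'n \<Rightarrow> (real^'n::finite \<Rightarrow> real) \<Rightarrow> real^'n \<Rightarrow> real" where
  "partial_deriv i f x = frechet_derivative f (at x) (axis i 1)"

(* The Christoffel symbol with upper index k and lower indices i, j of the Levi-Civita connection. *)
definition christoffel :: "(real^'n::finite \<Rightarrow> real^'n^'n) \<Rightarrow> real^'n \<Rightarrow> 'n \<Rightarrow> 'n \<Rightarrow> 'n \<Rightarrow> real" where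
  "christoffel G x k i j = (\<Sum>l\<in>UNIV. matrix_inv (G x) $ k $ l *
     (partial_deriv i (\<lambda>y. G y $ j $ l) x + partial_deriv j (\<lambda>y. G y $ i $ l) x
       - partial_deriv l (\<lambda>y. G y $ i $ j) x)) / 2"

definition smooth_curve_on ::
    "('m::{t2_space, second_countable_topology}, 'n::finite) chart set \<Rightarrow> real set
      \<Rightarrow> (real \<Rightarrow> 'm) \<Rightarrow> bool" where
  "smooth_curve_on A J \<gamma> \<longleftrightarrow> continuous_on J \<gamma> \<and>
     (\<forall>c\<in>A. smooth_on {t\<in>J. \<gamma> t \<in> chart_dom c} (coord c \<circ> \<gamma>))"

definition geodesic_on ::
    "('m::{t2_space, second_countable_topology}, 'n::finite) chart set \<Rightarrow> ('m, 'n) metric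
      \<Rightarrow> real set \<Rightarrow> (real \<Rightarrow> 'm) \<Rightarrow> bool" where
  "geodesic_on A g J \<gamma> \<longleftrightarrow> smooth_curve_on A J \<gamma> \<and>
     (\<forall>c\<in>A. \<forall>t\<in>J. \<gamma> t \<in> chart_dom c \<longrightarrow>
        (\<forall>k. higher_vderiv 2 (coord c \<circ> \<gamma>) t $ k +
          (\<Sum>i\<in>UNIV. \<Sum>j\<in>UNIV. christoffel (g c) (coord c (\<gamma> t)) k i j *
             (vderiv (coord c \<circ> \<gamma>) t $ i) * (vderiv (coord c \<circ> \<gamma>) t $ j)) = 0))"

section \<open>Isometric immersions\<close>

definition dpsi ::
    "('m \<Rightarrow> real^'e) \<Rightarrow> ('m, 'n::finite) chart \<Rightarrow> 'm \<Rightarrow> real^'n \<Rightarrow> real^'e::finite" where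
  "dpsi \<psi> c p = frechet_derivative (\<psi> \<circ> param c) (at (coord c p))"

definition isometric_immersion ::
    "'e::finite set \<Rightarrow> ('m::{t2_space, second_countable_topology}, 'n::finite) chart set
      \<Rightarrow> ('m, 'n) metric \<Rightarrow> ('m \<Rightarrow> real^'e) \<Rightarrow> bool" where
  "isometric_immersion N A g \<psi> \<longleftrightarrow>
     (\<forall>c\<in>A. smooth_on (chart_ran c) (\<psi> \<circ> param c)) \<and>
     (\<forall>c\<in>A. \<forall>p\<in>chart_dom c. inj (dpsi \<psi> c p)) \<and>
     (\<forall>c\<in>A. \<forall>p\<in>chart_dom c. \<forall>v w.
        pseudo_inner N (dpsi \<psi> c p v) (dpsi \<psi> c p w) = metric_form g c (coord c p) v w)"

(* The image of the tangent space under the differential. It is indexed by the point p of the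
   manifold rather than by its image, since the immersion may have self-intersections. *)
definition tangent_space ::
    "('m, 'n::finite) chart set \<Rightarrow> ('m \<Rightarrow> real^'e::finite) \<Rightarrow> 'm \<Rightarrow> (real^'e) set" where
  "tangent_space A \<psi> p = {u. \<exists>c\<in>A. p \<in> chart_dom c \<and> u \<in> range (dpsi \<psi> c p)}"

definition normal_space ::
    "'e::finite set \<Rightarrow> ('m, 'n::finite) chart set \<Rightarrow> ('m \<Rightarrow> real^'e) \<Rightarrow> 'm \<Rightarrow> (real^'e) set" where
  "normal_space N A \<psi> p = {w. \<forall>u\<in>tangent_space A \<psi> p. pseudo_inner N w u = 0}"

definition unit_bundle ::
    "'e::finite set \<Rightarrow> ('m, 'n::finite) chart set \<Rightarrow> ('m \<Rightarrow> real^'e) \<Rightarrow> real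
      \<Rightarrow> ('m \<times> (real^'e)) set" where
  "unit_bundle N A \<psi> \<epsilon> = {(p, u). u \<in> tangent_space A \<psi> p \<and> pseudo_inner N u u = \<epsilon>}"

section \<open>Geodesics and normal sections with given initial vector\<close>

(* Tangent vectors being identified with their images, the initial velocity of a curve in the
   manifold is the initial velocity of its image. *)
definition initial_curve ::
    "('m \<Rightarrow> real^'e::finite) \<Rightarrow> 'm \<Rightarrow> real^'e \<Rightarrow> real set \<Rightarrow> (real \<Rightarrow> 'm) \<Rightarrow> bool" where
  "initial_curve \<psi> p u J \<gamma> \<longleftrightarrow> open J \<and> is_interval J \<and> 0 \<in> J \<and>
     \<gamma> 0 = p \<and> ((\<psi> \<circ> \<gamma>) has_vector_derivative u) (at 0)"

definition section_space ::
    "'e::finite set \<Rightarrow> ('m, 'n::finite) chart set \<Rightarrow> ('m \<Rightarrow> real^'e) \<Rightarrow> 'm \<Rightarrow> real^'e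
      \<Rightarrow> (real^'e) set" where
  "section_space N A \<psi> p u = {\<psi> p + (a *\<^sub>R u + w) | a w. w \<in> normal_space N A \<psi> p}"

(* W is the small neighbourhood of p to which the immersion is restricted. *)
definition normal_section_on ::
    "'e::finite set \<Rightarrow> ('m::{t2_space, second_countable_topology}, 'n::finite) chart set
      \<Rightarrow> ('m \<Rightarrow> real^'e) \<Rightarrow> 'm \<Rightarrow> real^'e \<Rightarrow> real set \<Rightarrow> (real \<Rightarrow> 'm) \<Rightarrow> bool" where
  "normal_section_on N A \<psi> p u J \<beta> \<longleftrightarrow>
     initial_curve \<psi> p u J \<beta> \<and> smooth_curve_on A J \<beta> \<and>
     (\<forall>t\<in>J. pseudo_inner N (vderiv (\<psi> \<circ> \<beta>) t) (vderiv (\<psi> \<circ> \<beta>) t) = pseudo_inner N u u) \<and>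
     (\<exists>W. open W \<and> p \<in> W \<and> \<beta> ` J \<subseteq> W \<and> (\<exists>h. homeomorphism W (\<psi> ` W) \<psi> h) \<and>
        (\<psi> \<circ> \<beta>) ` J = connected_component_set (\<psi> ` W \<inter> section_space N A \<psi> p u) (\<psi> p))"

(* The following two curves are determined by (p, u) only as germs at 0, which is all that the
   derivatives at 0 depend on; SOME picks representatives. *)
definition geodesic_from ::
    "('m::{t2_space, second_countable_topology}, 'n::finite) chart set \<Rightarrow> ('m, 'n) metric
      \<Rightarrow> ('m \<Rightarrow> real^'e::finite) \<Rightarrow> 'm \<Rightarrow> real^'e \<Rightarrow> real \<Rightarrow> 'm" where
  "geodesic_from A g \<psi> p u = (SOME \<gamma>. \<exists>J. initial_curve \<psi> p u J \<gamma> \<and> geodesic_on A g J \<gamma>)"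

definition normal_section ::
    "'e::finite set \<Rightarrow> ('m::{t2_space, second_countable_topology}, 'n::finite) chart set
      \<Rightarrow> ('m \<Rightarrow> real^'e) \<Rightarrow> 'm \<Rightarrow> real^'e \<Rightarrow> real \<Rightarrow> 'm" where
  "normal_section N A \<psi> p u = (SOME \<beta>. \<exists>J. normal_section_on N A \<psi> p u J \<beta>)"

section \<open>Contact\<close>

definition contact_at ::
    "'e::finite set \<Rightarrow> ('m::{t2_space, second_countable_topology}, 'n::finite) chart set
      \<Rightarrow> ('m, 'n) metric \<Rightarrow> ('m \<Rightarrow> real^'e) \<Rightarrow> nat \<Rightarrow> 'm \<Rightarrow> real^'e \<Rightarrow> bool" where
  "contact_at N A g \<psi> k p u \<longleftrightarrow> (\<forall>r\<le>k.
     higher_vderiv r (\<psi> \<circ> geodesic_from A g \<psi> p u) 0 =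
     higher_vderiv r (\<psi> \<circ> normal_section N A \<psi> p u) 0)"

definition spacelike_contact ::
    "'e::finite set \<Rightarrow> ('m::{t2_space, second_countable_topology}, 'n::finite) chart set
      \<Rightarrow> ('m, 'n) metric \<Rightarrow> ('m \<Rightarrow> real^'e) \<Rightarrow> nat \<Rightarrow> bool" where
  "spacelike_contact N A g \<psi> k \<longleftrightarrow> (\<forall>(p, u)\<in>unit_bundle N A \<psi> 1. contact_at N A g \<psi> k p u)"

definition timelike_contact ::
    "'e::finite set \<Rightarrow> ('m::{t2_space, second_countable_topology}, 'n::finite) chart set
      \<Rightarrow> ('m, 'n) metric \<Rightarrow> ('m \<Rightarrow> real^'e) \<Rightarrow> nat \<Rightarrow> bool" where
  "timelike_contact N A g \<psi> k \<longleftrightarrow> (\<forall>(p, u)\<in>unit_bundle N A \<psi> (- 1). contact_at N A g \<psi> k p u)"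

definition contact ::
    "'e::finite set \<Rightarrow> ('m::{t2_space, second_countable_topology}, 'n::finite) chart set
      \<Rightarrow> ('m, 'n) metric \<Rightarrow> ('m \<Rightarrow> real^'e) \<Rightarrow> nat \<Rightarrow> bool" where
  "contact N A g \<psi> k \<longleftrightarrow> spacelike_contact N A g \<psi> k \<and> timelike_contact N A g \<psi> k"

definition contact_number ::
    "'e::finite set \<Rightarrow> ('m::{t2_space, second_countable_topology}, 'n::finite) chart set
      \<Rightarrow> ('m, 'n) metric \<Rightarrow> ('m \<Rightarrow> real^'e) \<Rightarrow> enat" where
  "contact_number N A g \<psi> = Sup {enat k | k. contact N A g \<psi> k}"

definition spacelike_contact_number ::
    "'e::finite set \<Rightarrow> ('m::{t2_space, second_countable_topology}, 'n::finite) chart set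
      \<Rightarrow> ('m, 'n) metric \<Rightarrow> ('m \<Rightarrow> real^'e) \<Rightarrow> enat" where
  "spacelike_contact_number N A g \<psi> = Sup {enat k | k. spacelike_contact N A g \<psi> k}"

definition timelike_contact_number ::
    "'e::finite set \<Rightarrow> ('m::{t2_space, second_countable_topology}, 'n::finite) chart set
      \<Rightarrow> ('m, 'n) metric \<Rightarrow> ('m \<Rightarrow> real^'e) \<Rightarrow> enat" where
  "timelike_contact_number N A g \<psi> = Sup {enat k | k. timelike_contact N A g \<psi> k}"

end

theory Submission
  imports Defs
begin

text \<open>In a chart around a point both curves solve a second order equation \<open>x'' = H(x, x')\<close>. For the
  geodesic, \<open>H\<close> is given by the Christoffel symbols. The normal section projects to a line in the
  tangent space, so its acceleration is known up to a multiple of the velocity, and constant speed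
  determines that multiple, at the price of one division by the squared length of the initial
  vector. Hence the difference of the derivatives of order \<open>r\<close> at the point is a rational function
  of the initial vector, homogeneous of degree \<open>r\<close>, with a power of the metric form as denominator.
  If it vanishes on all unit vectors of one causal character, then by homogeneity it vanishes on an
  open cone, hence its numerator vanishes identically. The metric being indefinite, both cones are
  nonempty, and the two kinds of contact are equivalent.\<close>

subsection \<open>Calculus of smooth maps\<close>

text \<open>The division by the squared length threatens the polynomial calculus, because that
  length is quadratic in the velocity. Along a unit speed curve, however, it is the constant
  \<epsilon>, so its inverse is carried through all differentiations as a constant parameter. Only
  at the end is the parameter replaced by 1 / Q(y), at a single point x, where clearing denominators
  leaves a polynomial in y. Both causal characters thus share one formula. Geodesic and normal
  section are picked by \<open>SOME\<close>, so both must be shown to exist. The normal section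
  needs the inverse function theorem besides Picard-Lindelof, since its definition asks for a whole
  connected component of the intersection. All derivatives at 0 follow from the equation and the
  initial position and velocity, hence are the same for every representative. The section space is
  fixed at p while the curve moves. The equation of the section is therefore written by pairing the
  moving frame with the fixed frame of the tangent space at p.\<close>

lemma Ck_on_cong:
  assumes "open S" "\<And>x. x \<in> S \<Longrightarrow> f x = g x" "Ck_on k f S"
  shows "Ck_on k g S"
  using assms(2,3)
proof (induction k arbitrary: f g)
  case 0
  then show ?case by (auto simp: continuous_on_cong[of S S f g])
next
  case (Suc k)
  have D: "(g has_derivative frechet_derivative f (at x)) (at x)" if "x \<in> S" for x
  proof -
    have "f differentiable (at x)" using Suc.prems that by simp
    then have "(f has_derivative frechet_derivative f (at x)) (at x)"
      by (simp add: frechet_derivative_works)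
    then show ?thesis
      by (rule has_derivative_transform_within_open[OF _ assms(1) that]) (use Suc.prems in auto)
  qed
  have E: "frechet_derivative f (at x) = frechet_derivative g (at x)" if "x \<in> S" for x
    using frechet_derivative_at[OF D[OF that]] .
  have "Ck_on k (\<lambda>x. frechet_derivative g (at x) v) S" for v
    by (rule Suc.IH[of "\<lambda>x. frechet_derivative f (at x) v"]) (use E Suc.prems in auto)
  with D show ?case by (auto simp: differentiable_def)
qed

text \<open>\<open>Ck_on\<close> speaks about the derivative that \<open>frechet_derivative\<close>
  picks. By uniqueness any explicit derivative may replace it on an open set, and most closure
  properties below start from this rule.\<close>

lemma Ck_on_SucI:
  assumes "open S" "\<And>x. x \<in> S \<Longrightarrow> (f has_derivative f' x) (at x)"
    and "\<And>v. Ck_on k (\<lambda>x. f' x v) S"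
  shows "Ck_on (Suc k) f S"
proof -
  have "Ck_on k (\<lambda>x. frechet_derivative f (at x) v) S" for v
    by (rule Ck_on_cong[OF assms(1) _ assms(3)[of v]]) (use frechet_derivative_at[OF assms(2)] in auto)
  with assms(2) show ?thesis by (auto simp: differentiable_def)
qed

lemma Ck_on_has_derivative:
  assumes "Ck_on (Suc k) f S" "x \<in> S"
  shows "(f has_derivative frechet_derivative f (at x)) (at x)"
  using assms by (simp add: frechet_derivative_works)

lemma Ck_on_SucD: "Ck_on (Suc k) f S \<Longrightarrow> Ck_on k f S"
proof (induction k arbitrary: f)
  case 0
  then show ?case
    by (auto intro!: continuous_at_imp_continuous_on differentiable_imp_continuous_within)
next
  case (Suc k)
  then show ?case by (metis Ck_on.simps(2))
qed

lemma Ck_on_subset: "Ck_on k f S \<Longrightarrow> T \<subseteq> S \<Longrightarrow> Ck_on k f T"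
  by (induction k arbitrary: f) (auto intro: continuous_on_subset)

lemma Ck_on_imp_continuous_on: "Ck_on k f S \<Longrightarrow> continuous_on S f"
  by (induction k) (use Ck_on_SucD in auto)


lemma Ck_on_const: "open S \<Longrightarrow> Ck_on k (\<lambda>x. c) S"
proof (induction k arbitrary: c)
  case (Suc k)
  then show ?case
    by (intro Ck_on_SucI[where f' = "\<lambda>x v. 0"]) (auto intro!: derivative_eq_intros)
qed auto

lemma Ck_on_linear:
  assumes "open S" "bounded_linear f"
  shows "Ck_on k f S"
proof (cases k)
  case 0
  then show ?thesis using assms by (simp add: linear_continuous_on)
next
  case (Suc j)
  then show ?thesis
    using Ck_on_SucI[OF assms(1) bounded_linear_imp_has_derivative[OF assms(2)] Ck_on_const[OF assms(1)]]
    by simp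
qed

lemma Ck_on_add:
  assumes "open S" "Ck_on k f S" "Ck_on k g S"
  shows "Ck_on k (\<lambda>x. f x + g x) S"
  using assms(2,3)
proof (induction k arbitrary: f g)
  case (Suc k)
  show ?case
    by (rule Ck_on_SucI[OF assms(1) has_derivative_add[OF Ck_on_has_derivative[OF Suc.prems(1)]
          Ck_on_has_derivative[OF Suc.prems(2)]]]) (use Suc in auto)
qed (auto intro: continuous_intros)

text \<open>The product rule returns two terms of the same shape, with one argument differentiated,
  so the induction runs over arbitrary \<open>f\<close> and \<open>g\<close>.\<close>

lemma Ck_on_bilinear:
  assumes "open S" "bounded_bilinear h" "Ck_on k f S" "Ck_on k g S"
  shows "Ck_on k (\<lambda>x. h (f x) (g x)) S"
  using assms(3,4)
proof (induction k arbitrary: f g)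
  case 0
  then show ?case using bounded_bilinear.continuous_on[OF assms(2)] by auto
next
  case (Suc k)
  show ?case
  proof (rule Ck_on_SucI[OF assms(1) bounded_bilinear.FDERIV[OF assms(2)
          Ck_on_has_derivative[OF Suc.prems(1)] Ck_on_has_derivative[OF Suc.prems(2)]]])
    show "Ck_on k (\<lambda>x. h (f x) (frechet_derivative g (at x) v) + h (frechet_derivative f (at x) v) (g x)) S"
      for v
      by (intro Ck_on_add Suc.IH assms(1)) (use Suc.prems Ck_on_SucD in auto)
  qed
qed

lemma Ck_on_sum:
  assumes "open S" "\<And>i. i \<in> I \<Longrightarrow> Ck_on k (f i) S"
  shows "Ck_on k (\<lambda>x. \<Sum>i\<in>I. f i x) S"
  using assms(2)
  by (induction I rule: infinite_finite_induct) (auto intro!: Ck_on_const Ck_on_add assms(1))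

lemma linear_eq_sum_Basis:
  fixes L :: "'a::euclidean_space \<Rightarrow> 'b::real_vector"
  assumes "linear L"
  shows "L v = (\<Sum>b\<in>Basis. (v \<bullet> b) *\<^sub>R L b)"
  using linear_sum[OF assms, of "\<lambda>b. (v \<bullet> b) *\<^sub>R b" Basis] linear_scale[OF assms]
  by (simp add: euclidean_representation)

text \<open>The chain rule gives \<open>g' (f x) (f' x v)\<close>, whose direction moves with
  \<open>x\<close>, so the induction hypothesis does not fit. Expanded in the basis it becomes a sum
  of scalars times \<open>g' (f x) b\<close> with \<open>b\<close> fixed, and each of these is a
  composition.\<close>

lemma Ck_on_compose:
  fixes f :: "'a::euclidean_space \<Rightarrow> 'b::euclidean_space"
  assumes "open S" "open T" "f ` S \<subseteq> T" "Ck_on k f S" "Ck_on k g T"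
  shows "Ck_on k (\<lambda>x. g (f x)) S"
  using assms(4,5)
proof (induction k arbitrary: g)
  case 0
  then show ?case using assms(3) by (auto intro: continuous_on_compose2)
next
  case (Suc k)
  define g' where "g' = (\<lambda>y. frechet_derivative g (at y))"
  define f' where "f' = (\<lambda>x. frechet_derivative f (at x))"
  have g': "(g has_derivative g' (f x)) (at (f x))" if "x \<in> S" for x
    unfolding g'_def by (rule Ck_on_has_derivative[OF Suc.prems(2)]) (use assms(3) that in auto)
  have f': "(f has_derivative f' x) (at x)" if "x \<in> S" for x
    unfolding f'_def by (rule Ck_on_has_derivative[OF Suc.prems(1) that])
  show ?case
  proof (rule Ck_on_SucI[OF assms(1)])
    show "((\<lambda>x. g (f x)) has_derivative (\<lambda>v. \<Sum>b\<in>Basis. (f' x v \<bullet> b) *\<^sub>R g' (f x) b)) (at x)"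
      if "x \<in> S" for x
      using has_derivative_compose[OF f'[OF that] g'[OF that]]
      by (subst (asm) linear_eq_sum_Basis[OF has_derivative_linear[OF g'[OF that]]])
    show "Ck_on k (\<lambda>x. \<Sum>b\<in>Basis. (f' x v \<bullet> b) *\<^sub>R g' (f x) b) S" for v
    proof (intro Ck_on_sum assms(1) Ck_on_bilinear[OF _ bounded_bilinear_scaleR])
      fix b :: 'b
      show "Ck_on k (\<lambda>x. f' x v \<bullet> b) S"
        by (intro Ck_on_bilinear[OF assms(1) bounded_bilinear_inner] Ck_on_const assms(1))
          (use Suc.prems in \<open>auto simp: f'_def\<close>)
      show "Ck_on k (\<lambda>x. g' (f x) b) S"
        by (rule Suc.IH) (use Suc.prems Ck_on_SucD in \<open>auto simp: g'_def\<close>)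
    qed
  qed
qed

text \<open>The derivative is a polynomial in the function itself, so the induction feeds on its own
  hypothesis. For \<open>sqrt\<close> below, the derivative is \<open>inverse\<close> after
  \<open>sqrt\<close>, up to a constant.\<close>

lemma Ck_on_inverse: "Ck_on k (inverse :: real \<Rightarrow> real) (- {0})"
proof (induction k)
  case 0
  then show ?case by (auto intro!: continuous_intros)
next
  case (Suc k)
  have o: "open (- {0::real})" by auto
  show ?case
  proof (rule Ck_on_SucI[OF o])
    show "(inverse has_derivative (\<lambda>v. (inverse x * inverse x) * (- v))) (at x)" if "x \<in> - {0}" for x :: real
      using that by (auto intro!: derivative_eq_intros)
    show "Ck_on k (\<lambda>x. inverse x * inverse x * - v) (- {0})" for v :: real
      by (intro Ck_on_bilinear[OF o bounded_bilinear_mult] Suc Ck_on_const o)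
  qed
qed

lemma Ck_on_sqrt: "Ck_on k sqrt {0<..}"
proof (induction k)
  case 0
  then show ?case by (auto intro!: continuous_intros)
next
  case (Suc k)
  have o: "open {0::real<..}" by (rule open_greaterThan)
  show ?case
  proof (rule Ck_on_SucI[OF o])
    show "(sqrt has_derivative (\<lambda>v. inverse (sqrt x) * (v / 2))) (at x)" if "x \<in> {0<..}" for x :: real
    proof -
      have "(sqrt has_derivative (*) (inverse (sqrt x) / 2)) (at x)"
        using DERIV_real_sqrt[of x] that by (simp add: has_field_derivative_def)
      moreover have "(*) (inverse (sqrt x) / 2) = (\<lambda>v. inverse (sqrt x) * (v / 2))"
        by (simp add: fun_eq_iff)
      ultimately show ?thesis by simp
    qed
    show "Ck_on k (\<lambda>x. inverse (sqrt x) * (v / 2)) {0<..}" for v :: real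
    proof (rule Ck_on_bilinear[OF o bounded_bilinear_mult])
      show "Ck_on k (\<lambda>x. inverse (sqrt x)) {0<..}"
        by (rule Ck_on_compose[OF o _ _ Suc Ck_on_inverse]) auto
    qed (rule Ck_on_const[OF o])
  qed
qed

section \<open>Closure properties of smooth maps\<close>

lemma smooth_on_cong:
  assumes "open S" "\<And>x. x \<in> S \<Longrightarrow> f x = g x" "smooth_on S f"
  shows "smooth_on S g"
  using Ck_on_cong[OF assms(1,2)] assms(3) by (auto simp: smooth_on_def)

lemma smooth_on_subset: "smooth_on S f \<Longrightarrow> T \<subseteq> S \<Longrightarrow> smooth_on T f"
  by (auto simp: smooth_on_def intro: Ck_on_subset)


lemma smooth_on_has_derivative:
  "smooth_on S f \<Longrightarrow> x \<in> S \<Longrightarrow> (f has_derivative frechet_derivative f (at x)) (at x)"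
  unfolding smooth_on_def by (blast intro: Ck_on_has_derivative)

lemma smooth_on_imp_continuous_on: "smooth_on S f \<Longrightarrow> continuous_on S f"
  using Ck_on_imp_continuous_on unfolding smooth_on_def by blast

lemma smooth_on_frechet_derivative:
  "smooth_on S f \<Longrightarrow> smooth_on S (\<lambda>x. frechet_derivative f (at x) v)"
  unfolding smooth_on_def by (metis Ck_on.simps(2))

lemma smooth_on_const: "open S \<Longrightarrow> smooth_on S (\<lambda>x. c)"
  by (simp add: smooth_on_def Ck_on_const)

lemma smooth_on_linear: "open S \<Longrightarrow> bounded_linear f \<Longrightarrow> smooth_on S f"
  by (simp add: smooth_on_def Ck_on_linear)

lemma smooth_on_add:
  "open S \<Longrightarrow> smooth_on S f \<Longrightarrow> smooth_on S g \<Longrightarrow> smooth_on S (\<lambda>x. f x + g x)"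
  by (simp add: smooth_on_def Ck_on_add)

lemma smooth_on_sum:
  "open S \<Longrightarrow> (\<And>i. i \<in> I \<Longrightarrow> smooth_on S (f i)) \<Longrightarrow> smooth_on S (\<lambda>x. \<Sum>i\<in>I. f i x)"
  by (simp add: smooth_on_def Ck_on_sum)

lemma smooth_on_bilinear:
  "open S \<Longrightarrow> bounded_bilinear h \<Longrightarrow> smooth_on S f \<Longrightarrow> smooth_on S g
    \<Longrightarrow> smooth_on S (\<lambda>x. h (f x) (g x))"
  by (simp add: smooth_on_def Ck_on_bilinear)

lemma smooth_on_compose:
  fixes f :: "'a::euclidean_space \<Rightarrow> 'b::euclidean_space"
  shows "open S \<Longrightarrow> open T \<Longrightarrow> f ` S \<subseteq> T \<Longrightarrow> smooth_on S f \<Longrightarrow> smooth_on T g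
    \<Longrightarrow> smooth_on S (\<lambda>x. g (f x))"
  unfolding smooth_on_def by (blast intro: Ck_on_compose)

lemma smooth_on_linear_compose:
  fixes f :: "'a::euclidean_space \<Rightarrow> 'b::euclidean_space"
  shows "open S \<Longrightarrow> bounded_linear L \<Longrightarrow> smooth_on S f \<Longrightarrow> smooth_on S (\<lambda>x. L (f x))"
  by (rule smooth_on_compose[where T = UNIV]) (auto intro: smooth_on_linear)

lemmas smooth_on_mult = smooth_on_bilinear[OF _ bounded_bilinear_mult]
  and smooth_on_scaleR = smooth_on_bilinear[OF _ bounded_bilinear_scaleR]

lemma smooth_on_minus:
  fixes f :: "'a::euclidean_space \<Rightarrow> 'b::real_normed_vector"
  assumes "open S" "smooth_on S f"
  shows "smooth_on S (\<lambda>x. - f x)"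
  using smooth_on_scaleR[OF assms(1) smooth_on_const[OF assms(1), of "-1"] assms(2)] by simp

lemma smooth_on_diff:
  "open S \<Longrightarrow> smooth_on S f \<Longrightarrow> smooth_on S g \<Longrightarrow> smooth_on S (\<lambda>x. f x - g x)"
  using smooth_on_add[of S f "\<lambda>x. - g x"] smooth_on_minus[of S g] by simp

lemma smooth_on_prod:
  fixes f :: "'i \<Rightarrow> 'a::euclidean_space \<Rightarrow> real"
  shows "open S \<Longrightarrow> (\<And>i. i \<in> I \<Longrightarrow> smooth_on S (f i)) \<Longrightarrow> smooth_on S (\<lambda>x. \<Prod>i\<in>I. f i x)"
  by (induction I rule: infinite_finite_induct) (auto intro!: smooth_on_const smooth_on_mult)

lemma smooth_on_divide:
  fixes f g :: "'a::euclidean_space \<Rightarrow> real"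
  assumes "open S" "smooth_on S f" "smooth_on S g" "\<And>x. x \<in> S \<Longrightarrow> g x \<noteq> 0"
  shows "smooth_on S (\<lambda>x. f x / g x)"
proof -
  have *: "smooth_on (- {0::real}) inverse" by (simp add: smooth_on_def Ck_on_inverse)
  have "smooth_on S (\<lambda>x. inverse (g x))"
    by (rule smooth_on_compose[OF assms(1) _ _ assms(3) *]) (use assms(4) in auto)
  then show ?thesis
    unfolding divide_inverse by (rule smooth_on_mult[OF assms(1,2)])
qed

lemma smooth_on_sqrt:
  assumes "open S" "smooth_on S f" "\<And>x. x \<in> S \<Longrightarrow> f x > 0"
  shows "smooth_on S (\<lambda>x. sqrt (f x))"
proof -
  have *: "smooth_on {0<..} sqrt" by (simp add: smooth_on_def Ck_on_sqrt)
  show ?thesis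
    by (rule smooth_on_compose[OF assms(1) _ _ assms(2) *]) (use assms(3) in auto)
qed

lemma smooth_on_vec_nth:
  fixes f :: "'a::euclidean_space \<Rightarrow> 'b::euclidean_space^'n"
  shows "open S \<Longrightarrow> smooth_on S f \<Longrightarrow> smooth_on S (\<lambda>x. f x $ i)"
  by (rule smooth_on_linear_compose[OF _ bounded_linear_vec_nth])

lemma smooth_on_vec_lambda:
  fixes f :: "'a::euclidean_space \<Rightarrow> 'n::finite \<Rightarrow> real"
  assumes "open S" "\<And>i. smooth_on S (\<lambda>x. f x i)"
  shows "smooth_on S (\<lambda>x. \<chi> i. f x i)"
proof -
  have "smooth_on S (\<lambda>x. \<Sum>i\<in>UNIV. f x i *\<^sub>R (axis i 1 :: real^'n))"
    by (intro smooth_on_sum smooth_on_scaleR smooth_on_const assms)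
  moreover have "(\<Sum>i\<in>UNIV. f x i *\<^sub>R (axis i 1 :: real^'n)) = (\<chi> i. f x i)" for x
    using basis_expansion[of "\<chi> i. f x i"] by (simp add: scalar_mult_eq_scaleR)
  ultimately show ?thesis by (simp only:)
qed

section \<open>Determinants and inverse matrices\<close>

lemma smooth_on_det:
  fixes A :: "'a::euclidean_space \<Rightarrow> real^'n^'n"
  assumes "open S" "\<And>i j. smooth_on S (\<lambda>x. A x $ i $ j)"
  shows "smooth_on S (\<lambda>x. det (A x))"
  unfolding det_def by (intro smooth_on_sum smooth_on_mult smooth_on_prod smooth_on_const assms)

lemma matrix_inv_inverse:
  fixes M :: "real^'n^'n"
  assumes "det M \<noteq> 0"
  shows "M ** matrix_inv M = mat 1" "matrix_inv M ** M = mat 1"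
proof -
  have "\<exists>M'. M ** M' = mat 1 \<and> M' ** M = mat 1"
    using assms by (simp add: invertible_det_nz[symmetric] invertible_def)
  from someI_ex[OF this] show "M ** matrix_inv M = mat 1" "matrix_inv M ** M = mat 1"
    by (simp_all add: matrix_inv_def)
qed

lemma matrix_inv_mult_cramer:
  fixes M :: "real^'n^'n"
  assumes "det M \<noteq> 0"
  shows "matrix_inv M *v b = (\<chi> k. det (\<chi> i j. if j = k then b $ i else M $ i $ j) / det M)"
proof -
  have "M *v (matrix_inv M *v b) = b"
    using assms by (simp add: matrix_vector_mul_assoc matrix_inv_inverse)
  then show ?thesis using cramer[OF assms] by blast
qed

text \<open>By Cramer's rule the solution of a linear system consists of quotients of determinants,
  which are smooth in the data. The entries of the inverse matrix follow by solving for the columns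
  of the identity.\<close>

lemma smooth_on_solve:
  fixes A :: "'a::euclidean_space \<Rightarrow> real^'n^'n" and b :: "'a \<Rightarrow> real^'n"
  assumes "open S" "\<And>i j. smooth_on S (\<lambda>x. A x $ i $ j)" "\<And>i. smooth_on S (\<lambda>x. b x $ i)"
    "\<And>x. x \<in> S \<Longrightarrow> det (A x) \<noteq> 0"
  shows "smooth_on S (\<lambda>x. matrix_inv (A x) *v b x)"
proof (rule smooth_on_cong[OF assms(1)])
  show "(\<chi> k. det (\<chi> i j. if j = k then b x $ i else A x $ i $ j) / det (A x)) = matrix_inv (A x) *v b x"
    if "x \<in> S" for x
    using matrix_inv_mult_cramer[OF assms(4)[OF that]] by simp
  show "smooth_on S (\<lambda>x. \<chi> k. det (\<chi> i j. if j = k then b x $ i else A x $ i $ j) / det (A x))"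
  proof (intro smooth_on_vec_lambda smooth_on_divide smooth_on_det assms)
    fix k i j
    show "smooth_on S (\<lambda>x. (\<chi> i j. if j = k then b x $ i else A x $ i $ j) $ i $ j)"
      by (cases "j = k") (use assms in auto)
  qed
qed

lemma smooth_on_matrix_inv:
  fixes A :: "'a::euclidean_space \<Rightarrow> real^'n^'n"
  assumes "open S" "\<And>i j. smooth_on S (\<lambda>x. A x $ i $ j)" "\<And>x. x \<in> S \<Longrightarrow> det (A x) \<noteq> 0"
  shows "smooth_on S (\<lambda>x. matrix_inv (A x) $ i $ j)"
proof -
  have "smooth_on S (\<lambda>x. (matrix_inv (A x) *v axis j 1) $ i)"
    by (intro smooth_on_vec_nth smooth_on_solve smooth_on_const assms)
  then show ?thesis by (simp add: matrix_vector_mul_component inner_axis)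
qed

subsection \<open>Symmetry of second derivatives and ordinary differential equations\<close>

text \<open>This gives the symmetry used for the Christoffel symbols. The difference of
  \<open>f\<close> along a segment in direction \<open>w\<close> is an integral of
  \<open>D f w\<close>. Moving the segment in direction \<open>v\<close>, differentiating under the
  integral, and then shrinking the segment to a point exchanges the two derivatives.\<close>

lemma frechet_derivative_commute:
  fixes f :: "'a::euclidean_space \<Rightarrow> 'b::banach"
  assumes "open S" "smooth_on S f" "x \<in> S"
  shows "frechet_derivative (\<lambda>y. frechet_derivative f (at y) w) (at x) v =
         frechet_derivative (\<lambda>y. frechet_derivative f (at y) v) (at x) w"
proof -
  define D where "D g u y = frechet_derivative g (at y) u" for g :: "'a \<Rightarrow> 'b" and u y
  have sm: "smooth_on S (D g u)" if "smooth_on S g" for g u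
    using smooth_on_frechet_derivative[OF that] by (simp add: D_def[abs_def])
  have der: "((\<lambda>t. g (a + t *\<^sub>R u)) has_vector_derivative D g u (a + t *\<^sub>R u)) (at t within T)"
    if "smooth_on S g" "a + t *\<^sub>R u \<in> S" for g a u t T
  proof -
    have 1: "((\<lambda>t. a + t *\<^sub>R u) has_vector_derivative u) (at t within T)"
      by (auto intro!: derivative_eq_intros)
    have 2: "(g has_derivative frechet_derivative g (at (a + t *\<^sub>R u)))
        (at (a + t *\<^sub>R u) within (\<lambda>t. a + t *\<^sub>R u) ` T)"
      using smooth_on_has_derivative[OF that] by (rule has_derivative_at_withinI)
    show ?thesis
      using vector_derivative_diff_chain_within[OF 1 2] by (simp add: o_def D_def)
  qed
  obtain e where e: "e > 0" "ball x e \<subseteq> S" using assms open_contains_ball by blast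
  \<comment> \<open>The summand 1 keeps the denominator positive when both directions vanish and
    makes the final bound by \<open>e\<close> strict.\<close>
  define \<delta> where "\<delta> = e / (norm v + norm w + 1)"
  have den: "norm v + norm w + 1 > 0" by (smt (verit) norm_ge_zero)
  have \<delta>: "\<delta> > 0" unfolding \<delta>_def using e den by simp
  have inS: "x + s *\<^sub>R v + t *\<^sub>R w \<in> S" if "\<bar>s\<bar> \<le> \<delta>" "\<bar>t\<bar> \<le> \<delta>" for s t
  proof -
    have "norm (s *\<^sub>R v + t *\<^sub>R w) \<le> \<bar>s\<bar> * norm v + \<bar>t\<bar> * norm w"
      by (rule norm_triangle_le) simp
    also have "\<dots> \<le> \<delta> * norm v + \<delta> * norm w"
      by (intro add_mono mult_right_mono that) auto
    also have "\<dots> < \<delta> * (norm v + norm w + 1)" using \<delta> by (simp add: algebra_simps)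
    also have "\<dots> = e" unfolding \<delta>_def using den by simp
    finally have "dist (x + s *\<^sub>R v + t *\<^sub>R w) x < e" by (simp add: dist_norm add.assoc)
    then show ?thesis using e by (auto simp: dist_commute)
  qed
  have key: "D f v (x + t *\<^sub>R w) - D f v x = integral {0..t} (\<lambda>r. D (D f w) v (x + r *\<^sub>R w))"
    if t: "0 \<le> t" "t \<le> \<delta>" for t
  proof -
    have L: "((\<lambda>s. integral (cbox 0 t) (\<lambda>r. D f w (x + s *\<^sub>R v + r *\<^sub>R w))) has_vector_derivative
       integral (cbox 0 t) (\<lambda>r. D (D f w) v (x + 0 *\<^sub>R v + r *\<^sub>R w))) (at 0 within {-\<delta>..\<delta>})"
    proof (rule leibniz_rule_vector_derivative)
      fix s r assume *: "s \<in> {-\<delta>..\<delta>}" "r \<in> cbox 0 t"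
      then have "x + s *\<^sub>R v + r *\<^sub>R w \<in> S" using t by (intro inS) auto
      then show "((\<lambda>s. D f w (x + s *\<^sub>R v + r *\<^sub>R w)) has_vector_derivative
          D (D f w) v (x + s *\<^sub>R v + r *\<^sub>R w)) (at s within {-\<delta>..\<delta>})"
        using der[OF sm[OF assms(2)], where a = "x + r *\<^sub>R w" and t = s and u = v and T = "{-\<delta>..\<delta>}"] by (simp add: ac_simps)
    next
      fix s assume *: "s \<in> {-\<delta>..\<delta>}"
      have "continuous_on (cbox 0 t) (\<lambda>r. D f w (x + s *\<^sub>R v + r *\<^sub>R w))"
        by (rule continuous_on_compose2[OF smooth_on_imp_continuous_on[OF sm[OF assms(2)]]])
          (use * t in \<open>auto intro!: continuous_intros inS\<close>)
      then show "(\<lambda>r. D f w (x + s *\<^sub>R v + r *\<^sub>R w)) integrable_on cbox 0 t"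
        by (rule integrable_continuous)
    next
      show "continuous_on ({-\<delta>..\<delta>} \<times> cbox 0 t) (\<lambda>(s, r). D (D f w) v (x + s *\<^sub>R v + r *\<^sub>R w))"
        unfolding split_beta
        by (rule continuous_on_compose2[OF smooth_on_imp_continuous_on[OF sm[OF sm[OF assms(2)]]]])
          (use t in \<open>auto intro!: continuous_intros inS\<close>)
    qed (use \<delta> in auto)
    have ftc: "integral (cbox 0 t) (\<lambda>r. D f w (x + s *\<^sub>R v + r *\<^sub>R w)) =
        f (x + s *\<^sub>R v + t *\<^sub>R w) - f (x + s *\<^sub>R v)" if s: "s \<in> {-\<delta>..\<delta>}" for s
    proof -
      have "((\<lambda>r. D f w (x + s *\<^sub>R v + r *\<^sub>R w)) has_integral
        (f (x + s *\<^sub>R v + t *\<^sub>R w) - f (x + s *\<^sub>R v + 0 *\<^sub>R w))) {0..t}"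
        by (rule fundamental_theorem_of_calculus[OF t(1)])
          (rule der[OF assms(2)], rule inS, use s t in auto)
      then show ?thesis by (simp add: integral_unique)
    qed
    have "((\<lambda>s. f (x + s *\<^sub>R v + t *\<^sub>R w) - f (x + s *\<^sub>R v)) has_vector_derivative
       integral (cbox 0 t) (\<lambda>r. D (D f w) v (x + r *\<^sub>R w))) (at 0 within {-\<delta>..\<delta>})"
      using has_vector_derivative_transform[OF _ ftc[symmetric] L] \<delta> by simp
    moreover have "((\<lambda>s. f (x + s *\<^sub>R v + t *\<^sub>R w) - f (x + s *\<^sub>R v)) has_vector_derivative
       (D f v (x + t *\<^sub>R w) - D f v x)) (at 0 within {-\<delta>..\<delta>})"
    proof (rule has_vector_derivative_diff)
      show "((\<lambda>s. f (x + s *\<^sub>R v + t *\<^sub>R w)) has_vector_derivative D f v (x + t *\<^sub>R w)) (at 0 within {-\<delta>..\<delta>})"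
        using der[OF assms(2), where a = "x + t *\<^sub>R w" and t = 0 and u = v and T = "{-\<delta>..\<delta>}"] inS[of 0 t] t \<delta> by (simp add: ac_simps)
      show "((\<lambda>s. f (x + s *\<^sub>R v)) has_vector_derivative D f v x) (at 0 within {-\<delta>..\<delta>})"
        using der[OF assms(2), where a = x and t = 0 and u = v and T = "{-\<delta>..\<delta>}"] assms(3) by simp
    qed
    moreover have nontriv: "at 0 within {-\<delta>..\<delta>} \<noteq> bot"
      using \<delta> by (simp add: at_within_Icc_at)
    ultimately show ?thesis
      by (auto intro: vector_derivative_unique_within[OF nontriv])
  qed
  \<comment> \<open>Both sides of \<open>key\<close> are now differentiated at t = 0, from the
    right, since \<open>key\<close> holds for t between 0 and \<delta>.\<close>
  have "((\<lambda>t. D f v (x + t *\<^sub>R w) - D f v x) has_vector_derivative D (D f v) w x) (at 0 within {0..\<delta>})"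
    using has_vector_derivative_diff[OF der[OF sm[OF assms(2)], where a = x and t = 0 and u = w and T = "{0..\<delta>}"]
        has_vector_derivative_const[of "D f v x"]] assms(3) by simp
  moreover have "((\<lambda>t. integral {0..t} (\<lambda>r. D (D f w) v (x + r *\<^sub>R w))) has_vector_derivative
      D (D f w) v (x + 0 *\<^sub>R w)) (at 0 within {0..\<delta>})"
  proof (rule integral_has_vector_derivative)
    show "continuous_on {0..\<delta>} (\<lambda>r. D (D f w) v (x + r *\<^sub>R w))"
      by (rule continuous_on_compose2[OF smooth_on_imp_continuous_on[OF sm[OF sm[OF assms(2)]]]])
        (use inS[of 0] \<delta> in \<open>auto intro!: continuous_intros\<close>)
  qed (use \<delta> in auto)
  then have "((\<lambda>t. D f v (x + t *\<^sub>R w) - D f v x) has_vector_derivative D (D f w) v x) (at 0 within {0..\<delta>})"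
    using has_vector_derivative_transform[of 0 "{0..\<delta>}" "\<lambda>t. D f v (x + t *\<^sub>R w) - D f v x"] key \<delta>
    by simp
  ultimately have "D (D f v) w x = D (D f w) v x"
    by (intro vector_derivative_unique_within[of 0 "{0..\<delta>}"])
      (use \<delta> in \<open>auto simp: at_within_Icc_at_right\<close>)
  then show ?thesis by (simp add: D_def[abs_def])
qed

section \<open>The Picard-Lindelof theorem\<close>

lemma Ck_on_1_lipschitz_cball:
  fixes f :: "'a::euclidean_space \<Rightarrow> 'b::real_normed_vector"
  assumes "Ck_on 1 f S" "cball a r \<subseteq> S"
  obtains L where "L \<ge> 0" "\<And>x y. x \<in> cball a r \<Longrightarrow> y \<in> cball a r \<Longrightarrow> norm (f x - f y) \<le> L * norm (x - y)"
proof -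
  define D where "D x = frechet_derivative f (at x)" for x
  have D: "(f has_derivative D x) (at x)" if "x \<in> S" for x
    using Ck_on_has_derivative[of 0 f S x] assms(1) that by (simp add: D_def)
  have "\<exists>M. \<forall>x\<in>cball a r. norm (D x b) \<le> M" for b
  proof -
    have "continuous_on S (\<lambda>x. D x b)" using assms(1) by (simp add: D_def)
    then have "continuous_on (cball a r) (\<lambda>x. D x b)"
      using assms(2) continuous_on_subset by blast
    then have "bounded ((\<lambda>x. D x b) ` cball a r)"
      by (intro compact_imp_bounded compact_continuous_image) auto
    then show ?thesis by (auto simp: bounded_iff)
  qed
  then obtain M where M: "norm (D x b) \<le> M b" if "x \<in> cball a r" for x b by metis
  \<comment> \<open>Continuity of the derivative is known for each fixed direction, so its operator
    norm is bounded through the basis vectors.\<close>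
  define L where "L = (\<Sum>b\<in>Basis. \<bar>M b\<bar>)"
  have on: "onorm (D x) \<le> L" if "x \<in> cball a r" for x
  proof (rule onorm_bound)
    show "0 \<le> L" by (simp add: L_def sum_nonneg)
    fix v
    have lin: "linear (D x)" using D has_derivative_linear that assms(2) by blast
    have "norm (D x v) \<le> (\<Sum>b\<in>Basis. norm ((v \<bullet> b) *\<^sub>R D x b))"
      by (subst linear_eq_sum_Basis[OF lin]) (rule norm_sum)
    also have "\<dots> \<le> (\<Sum>b\<in>Basis. norm v * \<bar>M b\<bar>)"
    proof (rule sum_mono)
      fix b :: 'a assume b: "b \<in> Basis"
      have "norm (D x b) \<le> \<bar>M b\<bar>" using M[OF that, of b] by linarith
      then show "norm ((v \<bullet> b) *\<^sub>R D x b) \<le> norm v * \<bar>M b\<bar>"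
        by (simp add: Basis_le_norm b mult_mono)
    qed
    also have "\<dots> = L * norm v" by (simp add: L_def sum_distrib_left mult.commute)
    finally show "norm (D x v) \<le> L * norm v" .
  qed
  have "norm (f x - f y) \<le> L * norm (x - y)" if "x \<in> cball a r" "y \<in> cball a r" for x y
    by (rule differentiable_bound[OF convex_cball _ on that])
      (use D assms(2) has_derivative_at_withinI in blast)
  moreover have "L \<ge> 0" by (simp add: L_def sum_nonneg)
  ultimately show ?thesis using that by blast
qed

text \<open>Bootstrapping: if \<open>z\<close> is of class k, then so is \<open>f (z t)\<close>, and
  this is the derivative of \<open>z\<close>.\<close>

lemma smooth_on_ode_solution:
  fixes z :: "real \<Rightarrow> 'a::euclidean_space"
  assumes "open I" "open S" "smooth_on S f"
    and z: "\<And>t. t \<in> I \<Longrightarrow> z t \<in> S" "\<And>t. t \<in> I \<Longrightarrow> (z has_vector_derivative f (z t)) (at t)"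
  shows "smooth_on I z"
  unfolding smooth_on_def
proof
  fix k show "Ck_on k z I"
  proof (induction k)
    case 0
    then show ?case
      by (auto intro!: continuous_at_imp_continuous_on has_vector_derivative_continuous[OF z(2)])
  next
    case (Suc k)
    have "Ck_on k (\<lambda>t. f (z t)) I"
      by (rule Ck_on_compose[OF assms(1,2) _ Suc]) (use z assms(3) in \<open>auto simp: smooth_on_def\<close>)
    then show ?case
      using z(2) unfolding has_vector_derivative_def
      by (intro Ck_on_SucI[where f' = "\<lambda>t h. h *\<^sub>R f (z t)"] assms(1)
          Ck_on_bilinear[OF _ bounded_bilinear_scaleR] Ck_on_const)
  qed
qed

lemma picard_lindelof:
  fixes f :: "'a::euclidean_space \<Rightarrow> 'a"
  assumes "open S" "Ck_on 1 f S" "z0 \<in> S"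
  obtains \<delta> z where "\<delta> > 0" "z 0 = z0" "\<And>t. t \<in> {-\<delta><..<\<delta>} \<Longrightarrow> z t \<in> S"
    "\<And>t. t \<in> {-\<delta><..<\<delta>} \<Longrightarrow> (z has_vector_derivative f (z t)) (at t)"
proof -
  obtain r where r: "r > 0" "cball z0 r \<subseteq> S" using assms open_contains_cball by blast
  obtain L where L: "L \<ge> 0"
    "\<And>x y. x \<in> cball z0 r \<Longrightarrow> y \<in> cball z0 r \<Longrightarrow> norm (f x - f y) \<le> L * norm (x - y)"
    using Ck_on_1_lipschitz_cball[OF assms(2) r(2)] by blast
  have cont: "continuous_on (cball z0 r) f"
    using Ck_on_imp_continuous_on[OF assms(2)] r(2) continuous_on_subset by blast
  then have "bounded (f ` cball z0 r)" by (intro compact_imp_bounded compact_continuous_image) auto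
  then obtain M where M: "M > 0" "\<And>x. x \<in> cball z0 r \<Longrightarrow> norm (f x) \<le> M"
    by (auto simp: bounded_pos)
  \<comment> \<open>The factor 4 comes from two integrals, each over an interval of length at most 2
    \<delta>. The first bound keeps the Picard operator inside the ball, the second makes it a
    contraction with constant 1/2.\<close>
  define \<delta> where "\<delta> = min (r / (4 * M)) (1 / (8 * (L + 1)))"
  have \<delta>: "\<delta> > 0" "4 * \<delta> * M \<le> r" "4 * \<delta> * L \<le> 1/2"
  proof -
    show "\<delta> > 0" using r M L by (simp add: \<delta>_def)
    have "\<delta> \<le> r / (4 * M)" by (simp add: \<delta>_def)
    then show "4 * \<delta> * M \<le> r" using M by (simp add: field_simps)
    have "\<delta> \<le> 1 / (8 * (L + 1))" by (simp add: \<delta>_def)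
    then have "8 * (\<delta> * (L + 1)) \<le> 1" using L by (simp add: field_simps)
    then show "4 * \<delta> * L \<le> 1/2" using \<open>\<delta> > 0\<close> by (simp add: algebra_simps)
  qed
  define X where "X = {\<phi> :: real \<Rightarrow>\<^sub>C 'a. \<forall>t. apply_bcontfun \<phi> t \<in> cball z0 r}"
  \<comment> \<open>The functions in \<open>X\<close> live on the whole line, so time is clamped to
    the interval and the operator again returns a bounded continuous function on the line.\<close>
  define c where "c t = max (-\<delta>) (min \<delta> t)" for t :: real
  have c: "c t \<in> {-\<delta>..\<delta>}" for t using \<delta>(1) by (auto simp: c_def)
  \<comment> \<open>An integral over \<open>{0..t}\<close> would be 0 for negative t. The integral
    therefore starts at -\<delta>, and \<open>T\<close> subtracts its value at 0.\<close>
  define I where "I \<phi> t = integral {-\<delta>..t} (\<lambda>s. f (\<phi> s))" for \<phi> :: "real \<Rightarrow> 'a" and t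
  define T where "T \<phi> t = z0 + I \<phi> (c t) - I \<phi> 0" for \<phi> t
  have contf: "continuous_on A (\<lambda>s. f (apply_bcontfun \<phi> s))" if "\<phi> \<in> X" for \<phi> A
    by (rule continuous_on_compose2[OF cont]) (use that in \<open>auto simp: X_def\<close>)
  have int: "(\<lambda>s. f (apply_bcontfun \<phi> s)) integrable_on {-\<delta>..t}" if "\<phi> \<in> X" for \<phi> t
    by (rule integrable_continuous_real[OF contf[OF that]])
  have I_bound: "norm (I \<phi> t) \<le> 2 * \<delta> * M" if "\<phi> \<in> X" "t \<in> {-\<delta>..\<delta>}" for \<phi> t
  proof -
    have "norm (I \<phi> t) \<le> M * (t - (-\<delta>))"
      unfolding I_def by (rule integral_bound) (use that contf M in \<open>auto simp: X_def\<close>)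
    also have "\<dots> \<le> M * (2 * \<delta>)" using that M by (intro mult_left_mono) auto
    finally show ?thesis by (simp add: mult.commute mult.left_commute)
  qed
  have TX: "T \<phi> t \<in> cball z0 r" if "\<phi> \<in> X" for \<phi> t
  proof -
    have "norm (I \<phi> (c t) - I \<phi> 0) \<le> 2 * \<delta> * M + 2 * \<delta> * M"
      using I_bound[OF that] c \<delta>(1) by (intro norm_triangle_le_diff add_mono) auto
    moreover have "dist z0 (T \<phi> t) = norm (I \<phi> (c t) - I \<phi> 0)"
      unfolding T_def dist_norm by (metis (no_types, lifting) add_diff_cancel_left' add_diff_eq norm_minus_commute)
    ultimately show ?thesis using \<delta>(2) by (simp add: algebra_simps)
  qed
  have "continuous_on UNIV (T \<phi>)" if "\<phi> \<in> X" for \<phi>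
  proof -
    have "continuous_on {-\<delta>..\<delta>} (I \<phi>)"
      unfolding I_def by (rule indefinite_integral_continuous_1[OF int[OF that]])
    then have "continuous_on UNIV (\<lambda>t. I \<phi> (c t))"
      by (rule continuous_on_compose2) (use c in \<open>auto simp: c_def intro!: continuous_intros\<close>)
    then show ?thesis unfolding T_def[abs_def] by (intro continuous_intros)
  qed
  moreover have "bounded (range (T \<phi>))" if "\<phi> \<in> X" for \<phi>
    using TX[OF that] by (meson bounded_cball bounded_subset image_subset_iff)
  moreover define B where "B \<phi> = Bcontfun (T (apply_bcontfun \<phi>))" for \<phi> :: "real \<Rightarrow>\<^sub>C 'a"
  ultimately have bc: "apply_bcontfun (B \<phi>) = T (apply_bcontfun \<phi>)" if "\<phi> \<in> X" for \<phi>
    using that by (auto intro!: Bcontfun_inverse simp: bcontfun_def B_def)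
  have "\<exists>!\<phi>\<in>X. B \<phi> = \<phi>"
  proof (rule Banach_fix[where c = "1/2"])
    have "X = PiC UNIV (\<lambda>_. cball z0 r)" by (auto simp: X_def mem_PiC_iff Pi_iff)
    then show "complete X"
      by (simp add: complete_eq_closed closed_PiC)
    show "X \<noteq> {}"
      using r(1) by (auto simp: X_def intro!: exI[of _ "const_bcontfun z0"])
    show "B ` X \<subseteq> X"
      using TX bc by (auto simp: X_def)
    fix \<phi> \<theta> assume X: "\<phi> \<in> X" "\<theta> \<in> X"
    have d: "norm (I \<phi> t - I \<theta> t) \<le> 2 * \<delta> * L * dist \<phi> \<theta>" if "t \<in> {-\<delta>..\<delta>}" for t
    proof -
      have "I \<phi> t - I \<theta> t = integral {-\<delta>..t} (\<lambda>s. f (\<phi> s) - f (\<theta> s))"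
        unfolding I_def using int X by (simp add: integral_diff)
      also have "norm \<dots> \<le> L * dist \<phi> \<theta> * (t - (-\<delta>))"
      proof (rule integral_bound)
        show "continuous_on {-\<delta>..t} (\<lambda>s. f (\<phi> s) - f (\<theta> s))"
          by (intro continuous_on_diff contf X)
        fix s
        have "norm (f (\<phi> s) - f (\<theta> s)) \<le> L * norm (\<phi> s - \<theta> s)"
          using X by (intro L) (auto simp: X_def)
        also have "\<dots> \<le> L * dist \<phi> \<theta>"
          using dist_bounded[of \<phi> s \<theta>] L(1) by (intro mult_left_mono) (auto simp: dist_norm)
        finally show "norm (f (\<phi> s) - f (\<theta> s)) \<le> L * dist \<phi> \<theta>" .
      qed (use that in auto)
      also have "\<dots> \<le> L * dist \<phi> \<theta> * (2 * \<delta>)"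
        using that L(1) by (intro mult_left_mono) auto
      finally show ?thesis by (simp add: mult.commute mult.left_commute)
    qed
    show "dist (B \<phi>) (B \<theta>) \<le> 1 / 2 * dist \<phi> \<theta>"
    proof (rule dist_bound)
      fix t
      have "dist (T \<phi> t) (T \<theta> t) = norm ((I \<phi> (c t) - I \<theta> (c t)) - (I \<phi> 0 - I \<theta> 0))"
        by (simp add: T_def dist_norm algebra_simps)
      also have "\<dots> \<le> 2 * \<delta> * L * dist \<phi> \<theta> + 2 * \<delta> * L * dist \<phi> \<theta>"
        by (intro norm_triangle_le_diff add_mono d c) (use \<delta>(1) in auto)
      also have "\<dots> = (4 * \<delta> * L) * dist \<phi> \<theta>" by (simp add: algebra_simps)
      also have "\<dots> \<le> 1 / 2 * dist \<phi> \<theta>" by (intro mult_right_mono \<delta>) auto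
      finally show "dist (apply_bcontfun (B \<phi>) t) (apply_bcontfun (B \<theta>) t)
          \<le> 1 / 2 * dist \<phi> \<theta>"
        by (simp add: bc X)
    qed
  qed auto
  then obtain \<phi> where \<phi>: "\<phi> \<in> X" "B \<phi> = \<phi>" by blast
  have eq: "apply_bcontfun \<phi> t = T \<phi> t" for t using bc[OF \<phi>(1)] \<phi>(2) by metis
  show ?thesis
  proof
    show "\<delta> > 0" by fact
    show "\<phi> 0 = z0" using \<delta>(1) by (simp add: eq T_def c_def)
    fix t assume t: "t \<in> {-\<delta><..<\<delta>}"
    show "\<phi> t \<in> S" using \<phi>(1) r(2) by (auto simp: X_def)
    have "((\<lambda>t. z0 + I \<phi> t - I \<phi> 0) has_vector_derivative f (\<phi> t)) (at t within {-\<delta>..\<delta>})"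
      unfolding I_def
      by (auto intro!: derivative_eq_intros integral_has_vector_derivative contf \<phi>)
        (use t in auto)
    moreover have "at t within {-\<delta>..\<delta>} = at t"
      using t by (intro at_within_interior) auto
    ultimately have "((\<lambda>t. z0 + I \<phi> t - I \<phi> 0) has_vector_derivative f (\<phi> t)) (at t)"
      by simp
    then show "(\<phi> has_vector_derivative f (\<phi> t)) (at t)"
      by (rule has_vector_derivative_transform_within_open[OF _ open_greaterThanLessThan t])
        (auto simp: eq T_def c_def)
  qed
qed

lemma smooth_ode_exists:
  fixes f :: "'a::euclidean_space \<Rightarrow> 'a"
  assumes "open S" "smooth_on S f" "z0 \<in> S"
  obtains \<delta> z where "\<delta> > 0" "z 0 = z0" "\<And>t. t \<in> {-\<delta><..<\<delta>} \<Longrightarrow> z t \<in> S"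
    "\<And>t. t \<in> {-\<delta><..<\<delta>} \<Longrightarrow> (z has_vector_derivative f (z t)) (at t)"
    "smooth_on {-\<delta><..<\<delta>} z"
proof -
  have "Ck_on 1 f S" using assms(2) unfolding smooth_on_def by blast
  then obtain \<delta> z where *: "\<delta> > 0" "z 0 = z0" "\<And>t. t \<in> {-\<delta><..<\<delta>} \<Longrightarrow> z t \<in> S"
    "\<And>t. t \<in> {-\<delta><..<\<delta>} \<Longrightarrow> (z has_vector_derivative f (z t)) (at t)"
    using picard_lindelof[OF assms(1) _ assms(3)] by blast
  show ?thesis
    by (rule that[OF * smooth_on_ode_solution[OF _ assms(1,2) *(3,4)]]) auto
qed

subsection \<open>Derivatives along solutions of second order equations\<close>

lemma linear_eq_sum_axis:
  fixes L :: "real^'n \<Rightarrow> 'b::real_vector"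
  assumes "linear L"
  shows "L v = (\<Sum>i\<in>UNIV. v $ i *\<^sub>R L (axis i 1))"
proof -
  have "v = (\<Sum>i\<in>UNIV. v $ i *\<^sub>R axis i 1)"
    using basis_expansion[of v] by (simp add: scalar_mult_eq_scaleR)
  then have "L v = L (\<Sum>i\<in>UNIV. v $ i *\<^sub>R axis i 1)" by simp
  then show ?thesis by (simp add: linear_sum[OF assms] linear_scale[OF assms])
qed

lemma has_vector_derivative_vec_lambda:
  fixes f :: "real \<Rightarrow> 'n::finite \<Rightarrow> real"
  assumes "\<And>i. ((\<lambda>t. f t i) has_vector_derivative f' i) F"
  shows "((\<lambda>t. \<chi> i. f t i) has_vector_derivative (\<chi> i. f' i)) F"
proof -
  have *: "(\<Sum>i\<in>UNIV. g i *\<^sub>R (axis i 1 :: real^'n)) = (\<chi> i. g i)" for g :: "'n \<Rightarrow> real"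
    using basis_expansion[of "\<chi> i. g i"] by (simp add: scalar_mult_eq_scaleR)
  have "((\<lambda>t. \<Sum>i\<in>UNIV. f t i *\<^sub>R (axis i 1 :: real^'n)) has_vector_derivative
      (\<Sum>i\<in>UNIV. f' i *\<^sub>R axis i 1)) F"
    unfolding has_vector_derivative_def
    by (rule has_derivative_eq_rhs[OF has_derivative_sum[OF has_derivative_scaleR_left[OF
          assms[unfolded has_vector_derivative_def]]]])
      (simp add: scaleR_sum_right fun_eq_iff)
  then show ?thesis by (simp only: *)
qed

text \<open>In \<open>h c x y\<close> the arguments stand for a parameter, a position and a velocity. The grading is
  the one that makes \<open>h\<close> homogeneous under reparametrization, where \<open>c\<close> is the inverse of the
  squared length of \<open>y\<close>.\<close>

inductive fibre_poly ::
    "(real^'n::finite) set \<Rightarrow> int \<Rightarrow> (real \<Rightarrow> real^'n \<Rightarrow> real^'n \<Rightarrow> real) \<Rightarrow> bool" for S where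
  base: "smooth_on S a \<Longrightarrow> fibre_poly S 0 (\<lambda>c x y. a x)"
| velocity: "fibre_poly S 1 (\<lambda>c x y. y $ i)"
| parameter: "fibre_poly S (- 2) (\<lambda>c x y. c)"
| add: "fibre_poly S d f \<Longrightarrow> fibre_poly S d g \<Longrightarrow> fibre_poly S d (\<lambda>c x y. f c x y + g c x y)"
| mult: "fibre_poly S d f \<Longrightarrow> fibre_poly S d' g
    \<Longrightarrow> fibre_poly S (d + d') (\<lambda>c x y. f c x y * g c x y)"

lemma fibre_poly_mult_base:
  "smooth_on S a \<Longrightarrow> fibre_poly S d f \<Longrightarrow> fibre_poly S d (\<lambda>c x y. a x * f c x y)"
  using fibre_poly.mult[OF fibre_poly.base] by fastforce

lemma fibre_poly_minus:
  assumes "open S" "fibre_poly S d f"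
  shows "fibre_poly S d (\<lambda>c x y. - f c x y)"
  using fibre_poly_mult_base[OF smooth_on_const[OF assms(1), of "-1"] assms(2)] by simp

lemma fibre_poly_diff:
  "open S \<Longrightarrow> fibre_poly S d f \<Longrightarrow> fibre_poly S d g \<Longrightarrow> fibre_poly S d (\<lambda>c x y. f c x y - g c x y)"
  using fibre_poly.add[of S d f "\<lambda>c x y. - g c x y"] fibre_poly_minus[of S d g] by simp

lemma fibre_poly_sum:
  assumes "finite I" "I \<noteq> {}" "\<And>i. i \<in> I \<Longrightarrow> fibre_poly S d (f i)"
  shows "fibre_poly S d (\<lambda>c x y. \<Sum>i\<in>I. f i c x y)"
  using assms by (induction I rule: finite_ne_induct) (auto intro: fibre_poly.add)


text \<open>The equation x'' = H(c, x, x') with the velocity \<open>y\<close> as a second unknown.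
  The parameter \<open>c\<close> is one number for the whole curve, so it differentiates to
  0.\<close>

definition solves_second_order ::
    "(real^'n::finite) set \<Rightarrow> ('n \<Rightarrow> real \<Rightarrow> real^'n \<Rightarrow> real^'n \<Rightarrow> real) \<Rightarrow> real
      \<Rightarrow> (real \<Rightarrow> real^'n) \<Rightarrow> (real \<Rightarrow> real^'n) \<Rightarrow> real set \<Rightarrow> bool" where
  "solves_second_order S H c x y I \<longleftrightarrow> open I \<and> (\<forall>t\<in>I. x t \<in> S \<and>
     (x has_vector_derivative y t) (at t) \<and>
     (y has_vector_derivative (\<chi> k. H k c (x t) (y t))) (at t))"

text \<open>The total derivative along solutions stays in the class and raises the weight by one: a
  coefficient yields its partial derivatives times velocities, and a velocity is replaced by
  \<open>H\<close>, of weight 2. Since \<open>h'\<close> is chosen before the curve, it depends on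
  the equation alone.\<close>

lemma fibre_poly_derivative:
  fixes H :: "'n::finite \<Rightarrow> real \<Rightarrow> real^'n \<Rightarrow> real^'n \<Rightarrow> real"
  assumes "open S" "\<And>k. fibre_poly S 2 (H k)" "fibre_poly S d h"
  shows "\<exists>h'. fibre_poly S (d + 1) h' \<and> (\<forall>c x y I t. solves_second_order S H c x y I \<longrightarrow> t \<in> I \<longrightarrow>
      ((\<lambda>t. h c (x t) (y t)) has_vector_derivative h' c (x t) (y t)) (at t))"
  using assms(3)
proof induction
  case (base a)
  define h' where "h' c x y = (\<Sum>i\<in>UNIV. frechet_derivative a (at x) (axis i 1) * (y $ i))"
    for c :: real and x y :: "real^'n"
  have "fibre_poly S 1 h'"
    unfolding h'_def[abs_def]
    by (intro fibre_poly_sum fibre_poly_mult_base fibre_poly.velocity smooth_on_frechet_derivative base) auto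
  moreover have "((\<lambda>t. a (x t)) has_vector_derivative h' c (x t) (y t)) (at t)"
    if "solves_second_order S H c x y I" "t \<in> I" for c x y I t
  proof -
    have x: "x t \<in> S" "(x has_vector_derivative y t) (at t)"
      using that by (auto simp: solves_second_order_def)
    note a = smooth_on_has_derivative[OF base x(1)]
    have "h' c (x t) (y t) = frechet_derivative a (at (x t)) (y t)"
      by (subst linear_eq_sum_axis[OF has_derivative_linear[OF a]]) (simp add: h'_def mult.commute)
    then show ?thesis
      using vector_derivative_diff_chain_within[OF x(2), of a "frechet_derivative a (at (x t))"]
        has_derivative_at_withinI[OF a] by (simp add: o_def)
  qed
  ultimately show ?case by (intro exI[of _ h']) auto
next
  case (velocity i)
  have "((\<lambda>t. y t $ i) has_vector_derivative H i c (x t) (y t)) (at t)"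
    if "solves_second_order S H c x y I" "t \<in> I" for c x y I t
    using bounded_linear.has_vector_derivative[OF bounded_linear_vec_nth[of i],
        of y "\<chi> k. H k c (x t) (y t)" "at t"] that
    by (auto simp: solves_second_order_def)
  with assms(2)[of i] show ?case by (intro exI[of _ "H i"]) auto
next
  case parameter
  \<comment> \<open>The derivative is 0 but has to be recognized with weight -1, so it is written as
    0 times the product of the parameter (weight -2) and a velocity (weight 1).\<close>
  have "fibre_poly S (-1) (\<lambda>c x y. 0)"
    using fibre_poly_mult_base[OF smooth_on_const[OF assms(1), of 0]
        fibre_poly.mult[OF fibre_poly.parameter fibre_poly.velocity]] by simp
  then show ?case by (intro exI[of _ "\<lambda>c x y. 0"]) auto
next
  case (add d f g)
  from add.IH(1) obtain f' where f': "fibre_poly S (d + 1) f'"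
    "\<And>c x y I t. solves_second_order S H c x y I \<Longrightarrow> t \<in> I \<Longrightarrow>
      ((\<lambda>t. f c (x t) (y t)) has_vector_derivative f' c (x t) (y t)) (at t)"
    by blast
  from add.IH(2) obtain g' where g': "fibre_poly S (d + 1) g'"
    "\<And>c x y I t. solves_second_order S H c x y I \<Longrightarrow> t \<in> I \<Longrightarrow>
      ((\<lambda>t. g c (x t) (y t)) has_vector_derivative g' c (x t) (y t)) (at t)"
    by blast
  show ?case
    by (rule exI[of _ "\<lambda>c x y. f' c x y + g' c x y"])
      (intro conjI allI impI fibre_poly.add has_vector_derivative_add f' g')
next
  case (mult d f d' g)
  from mult.IH(1) obtain f' where f': "fibre_poly S (d + 1) f'"
    "\<And>c x y I t. solves_second_order S H c x y I \<Longrightarrow> t \<in> I \<Longrightarrow>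
      ((\<lambda>t. f c (x t) (y t)) has_vector_derivative f' c (x t) (y t)) (at t)"
    by blast
  from mult.IH(2) obtain g' where g': "fibre_poly S (d' + 1) g'"
    "\<And>c x y I t. solves_second_order S H c x y I \<Longrightarrow> t \<in> I \<Longrightarrow>
      ((\<lambda>t. g c (x t) (y t)) has_vector_derivative g' c (x t) (y t)) (at t)"
    by blast
  have "fibre_poly S (d + d' + 1) (\<lambda>c x y. f c x y * g' c x y + f' c x y * g c x y)"
    using fibre_poly.mult[OF mult.hyps(1) g'(1)] fibre_poly.mult[OF f'(1) mult.hyps(2)]
    by (intro fibre_poly.add) (simp_all add: algebra_simps)
  then show ?case
    by (intro exI[of _ "\<lambda>c x y. f c x y * g' c x y + f' c x y * g c x y"])
      (intro conjI allI impI has_vector_derivative_mult f' g')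
qed

text \<open>Iterating the total derivative gives one formula for the r-th derivative of
  \<open>F\<close> along every solution, in terms of the position and velocity at that time. The
  components of \<open>F\<close> have weight 0, and each differentiation adds 1.\<close>

lemma fibre_poly_higher_vderiv:
  fixes H :: "'n::finite \<Rightarrow> real \<Rightarrow> real^'n \<Rightarrow> real^'n \<Rightarrow> real" and F :: "real^'n \<Rightarrow> real^'e::finite"
  assumes "open S" "\<And>k. fibre_poly S 2 (H k)" "smooth_on S F"
  shows "\<exists>h. (\<forall>i. fibre_poly S (int r) (h i)) \<and>
     (\<forall>c x y I t. solves_second_order S H c x y I \<longrightarrow> t \<in> I \<longrightarrow>
        higher_vderiv r (\<lambda>t. F (x t)) t = (\<chi> i. h i c (x t) (y t)))"
proof (induction r)
  case 0
  have "fibre_poly S 0 (\<lambda>c x y. F x $ i)" for i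
    by (rule fibre_poly.base[OF smooth_on_vec_nth[OF assms(1,3)]])
  then show ?case by (intro exI[of _ "\<lambda>i c x y. F x $ i"]) (auto simp: higher_vderiv_def)
next
  case (Suc r)
  then obtain h where h: "\<And>i. fibre_poly S (int r) (h i)"
    "\<And>c x y I t. solves_second_order S H c x y I \<Longrightarrow> t \<in> I \<Longrightarrow>
        higher_vderiv r (\<lambda>t. F (x t)) t = (\<chi> i. h i c (x t) (y t))" by blast
  have "\<forall>i. \<exists>h'. fibre_poly S (int r + 1) h' \<and> (\<forall>c x y I t. solves_second_order S H c x y I \<longrightarrow> t \<in> I \<longrightarrow>
      ((\<lambda>t. h i c (x t) (y t)) has_vector_derivative h' c (x t) (y t)) (at t))"
    using fibre_poly_derivative[of S H, OF assms(1,2) h(1)] by blast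
  then obtain h' where h': "\<And>i. fibre_poly S (int r + 1) (h' i)"
    "\<And>i c x y I t. solves_second_order S H c x y I \<Longrightarrow> t \<in> I \<Longrightarrow>
      ((\<lambda>t. h i c (x t) (y t)) has_vector_derivative h' i c (x t) (y t)) (at t)" by metis
  have "higher_vderiv (Suc r) (\<lambda>t. F (x t)) t = (\<chi> i. h' i c (x t) (y t))"
    if sol: "solves_second_order S H c x y I" and t: "t \<in> I" for c x y I t
  proof -
    have "((\<lambda>t. \<chi> i. h i c (x t) (y t)) has_vector_derivative (\<chi> i. h' i c (x t) (y t))) (at t)"
      by (intro has_vector_derivative_vec_lambda h'(2)[OF sol t])
    moreover have "open I" using sol by (simp add: solves_second_order_def)
    ultimately have "(higher_vderiv r (\<lambda>t. F (x t)) has_vector_derivative (\<chi> i. h' i c (x t) (y t))) (at t)"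
      by (rule has_vector_derivative_transform_within_open[OF _ _ t]) (simp add: h(2)[OF sol])
    then show ?thesis by (simp add: higher_vderiv_def vderiv_def vector_derivative_at)
  qed
  with h'(1) show ?case by (intro exI[of _ h']) (auto simp: add.commute)
qed

section \<open>Homogeneity and vanishing of rational functions on a tangent space\<close>

lemma fibre_poly_homogeneous:
  assumes "fibre_poly S d h" "l \<noteq> 0"
  shows "h (c / l\<^sup>2) x (l *\<^sub>R y) = l powi d * h c x y"
  using assms(1)
proof induction
  case parameter
  then show ?case by (simp add: power_int_minus field_simps)
next
  case (mult d f d' g)
  then show ?case using assms(2) by (simp add: power_int_add)
qed (auto simp: algebra_simps)

text \<open>With \<open>x\<close> fixed the coefficients are numbers, so the substituted parameter 1
  / \<open>Q y\<close> is the only obstacle to being polynomial in \<open>y\<close>, and each factor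
  of it costs one power of \<open>Q y\<close>.\<close>

lemma fibre_poly_clear_denominator:
  assumes "fibre_poly S d h" "real_polynomial_function Q"
  shows "\<exists>m P. real_polynomial_function P \<and> (\<forall>y. Q y \<noteq> 0 \<longrightarrow> h (1 / Q y) x y * Q y ^ m = P y)"
  using assms(1)
proof induction
  case (base a)
  then show ?case by (intro exI[of _ 0] exI[of _ "\<lambda>y. a x"]) auto
next
  case (velocity i)
  have "real_polynomial_function (\<lambda>y. y $ i)" by (intro real_polynomial_function.intros(1) bounded_linear_vec_nth)
  then show ?case by (intro exI[of _ 0] exI[of _ "\<lambda>y. y $ i"]) auto
next
  case parameter
  then show ?case by (intro exI[of _ 1] exI[of _ "\<lambda>y. 1"]) auto
next
  case (add d f g)
  then obtain m P n R where *: "real_polynomial_function P" "real_polynomial_function R"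
    "\<And>y. Q y \<noteq> 0 \<Longrightarrow> f (1 / Q y) x y * Q y ^ m = P y" "\<And>y. Q y \<noteq> 0 \<Longrightarrow> g (1 / Q y) x y * Q y ^ n = R y"
    by blast
  have "real_polynomial_function (\<lambda>y. P y * Q y ^ n + R y * Q y ^ m)"
    using * assms(2) by (intro real_polynomial_function.intros(3) real_polynomial_function.intros(4)
        real_polynomial_function_power) auto
  moreover have "(f (1 / Q y) x y + g (1 / Q y) x y) * Q y ^ (m + n) = P y * Q y ^ n + R y * Q y ^ m"
    if "Q y \<noteq> 0" for y
    using *(3,4)[OF that, symmetric] by (simp add: power_add algebra_simps)
  ultimately show ?case by blast
next
  case (mult d f d' g)
  then obtain m P n R where *: "real_polynomial_function P" "real_polynomial_function R"
    "\<And>y. Q y \<noteq> 0 \<Longrightarrow> f (1 / Q y) x y * Q y ^ m = P y" "\<And>y. Q y \<noteq> 0 \<Longrightarrow> g (1 / Q y) x y * Q y ^ n = R y"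
    by blast
  have "real_polynomial_function (\<lambda>y. P y * R y)"
    using * by (intro real_polynomial_function.intros(4)) auto
  moreover have "f (1 / Q y) x y * g (1 / Q y) x y * Q y ^ (m + n) = P y * R y"
    if "Q y \<noteq> 0" for y
    using *(3,4)[OF that, symmetric] by (simp add: power_add algebra_simps)
  ultimately show ?case by blast
qed

text \<open>On the line from \<open>a\<close> to \<open>b\<close> the polynomial has one variable
  and vanishes near parameter 0. With infinitely many roots it vanishes identically, also at
  parameter 1, which is \<open>b\<close>.\<close>

lemma real_polynomial_function_eq_0:
  fixes P :: "'a::real_normed_vector \<Rightarrow> real"
  assumes "real_polynomial_function P" "open W" "a \<in> W" "\<And>y. y \<in> W \<Longrightarrow> P y = 0"
  shows "P b = 0"
proof -
  define L where "L t = a + t *\<^sub>R (b - a)" for t :: real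
  have "polynomial_function L"
    unfolding L_def[abs_def] polynomial_function_def
  proof (intro allI impI)
    fix f :: "'a \<Rightarrow> real" assume f: "bounded_linear f"
    have "f \<circ> (\<lambda>t. a + t *\<^sub>R (b - a)) = (\<lambda>t. f a + t * f (b - a))"
      using bounded_linear.linear[OF f] by (auto simp: linear_add linear_scale)
    moreover have "real_polynomial_function (\<lambda>t::real. f a + t * f (b - a))"
      by (intro real_polynomial_function.intros bounded_linear_mult_left)
    ultimately show "real_polynomial_function (f \<circ> (\<lambda>t. a + t *\<^sub>R (b - a)))" by simp
  qed
  then have "real_polynomial_function (P \<circ> L)"
    using assms(1) by (rule real_polynomial_function_compose)
  then obtain c n where cn: "P \<circ> L = (\<lambda>t. \<Sum>i\<le>n. c i * t ^ i)"
    using real_polynomial_function_imp_sum by blast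
  have "open (L -` W)"
    using assms(2) by (rule open_vimage) (auto simp: L_def[abs_def] intro!: continuous_intros)
  moreover have "0 \<in> L -` W" using assms(3) by (simp add: L_def)
  ultimately have "infinite (L -` W)" using finite_imp_not_open by blast
  moreover have "L -` W \<subseteq> {t. (\<Sum>i\<le>n. c i * t ^ i) = 0}"
    using assms(4) by (auto simp: cn[symmetric] fun_eq_iff simp flip: fun_cong[OF cn])
  ultimately have "infinite {t. (\<Sum>i\<le>n. c i * t ^ i) = 0}" using finite_subset by blast
  then have "\<forall>i\<le>n. c i = 0" using polyfun_finite_roots[of c n] by blast
  then have "(P \<circ> L) 1 = 0" unfolding cn by simp
  then show ?thesis by (simp add: L_def)
qed

text \<open>Homogeneity extends the vanishing from the unit vectors to an open cone, and after clearing
  the denominators the polynomial vanishes identically.\<close>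

lemma fibre_poly_vanishing_transfer:
  assumes "fibre_poly S d h" and Q: "\<And>y. Q y = y \<bullet> (G *v y)"
    and \<epsilon>: "\<epsilon> \<in> {1, -1}" and v0: "\<epsilon> * Q v0 > 0"
    and zero: "\<And>y. Q y = \<epsilon> \<Longrightarrow> h \<epsilon> x y = 0"
    and "Q y \<noteq> 0"
  shows "h (1 / Q y) x y = 0"
proof -
  have "bounded_linear (\<lambda>y. y $ i)" for i by (rule bounded_linear_vec_nth)
  then have "real_polynomial_function Q"
    unfolding Q[abs_def] inner_vec_def matrix_vector_mult_def
    by (simp, intro real_polynomial_function_sum real_polynomial_function.intros(2,4)
        real_polynomial_function.intros(1)) auto
  then obtain m P where P: "real_polynomial_function P" "\<And>y. Q y \<noteq> 0 \<Longrightarrow> h (1 / Q y) x y * Q y ^ m = P y"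
    using fibre_poly_clear_denominator[OF assms(1)] by blast
  have \<epsilon>2: "\<epsilon> * \<epsilon> = 1" using \<epsilon> by auto
  have scale: "Q (l *\<^sub>R y) = l\<^sup>2 * Q y" for l y
    by (simp add: Q matrix_vector_mult_scaleR power2_eq_square)
  have "P y = 0" if "\<epsilon> * Q y > 0" for y
  proof -
    \<comment> \<open>Dividing \<open>y\<close> by \<open>l\<close> gives a unit vector of the given
      causal character, where the hypothesis applies with parameter \<epsilon>. Scaling back divides
      the parameter by the square of \<open>l\<close>, and the result is 1 /
      \<open>Q y\<close>.\<close>
    define l where "l = sqrt (\<epsilon> * Q y)"
    have l: "l > 0" "l\<^sup>2 = \<epsilon> * Q y" using that by (auto simp: l_def)
    have "Q ((1 / l) *\<^sub>R y) = \<epsilon>"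
    proof -
      have "Q ((1 / l) *\<^sub>R y) = Q y / (\<epsilon> * Q y)" by (simp add: scale power_divide l(2))
      then show ?thesis using that \<epsilon> by auto
    qed
    then have "h (\<epsilon> / l\<^sup>2) x (l *\<^sub>R ((1 / l) *\<^sub>R y)) = 0"
      using fibre_poly_homogeneous[OF assms(1), of l \<epsilon> x "(1 / l) *\<^sub>R y"] l zero by simp
    moreover have "\<epsilon> / l\<^sup>2 = 1 / Q y" using \<epsilon> l(2) that by auto
    ultimately have "h (1 / Q y) x y = 0" using l by simp
    moreover have "Q y \<noteq> 0" using that by auto
    ultimately show ?thesis using P(2)[of y] by simp
  qed
  moreover have "open {y. \<epsilon> * Q y > 0}"
    unfolding Q by (intro open_Collect_less continuous_intros)
  ultimately have "P y = 0"
    using real_polynomial_function_eq_0[OF P(1), of "{y. \<epsilon> * Q y > 0}" v0] v0 by simp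
  with P(2)[OF assms(6)] assms(6) show ?thesis by simp
qed

text \<open>A subspace that realizes the index contains a negative vector. Without a positive vector
  the form would be negative semidefinite, by nondegeneracy even definite, and the index would be
  the full dimension.\<close>

lemma indefinite_form:
  fixes G :: "real^'n^'n"
  assumes sym: "transpose G = G"
    and nd: "nondegenerate_form (\<lambda>v w. v \<bullet> (G *v w))"
    and idx: "form_index (\<lambda>v w. v \<bullet> (G *v w)) = s" "0 < s" "s < CARD('n)"
  shows "\<exists>v. v \<bullet> (G *v v) > 0" "\<exists>v. v \<bullet> (G *v v) < 0"
proof -
  define D where "D = dim ` {W. subspace W \<and> (\<forall>w\<in>W. w \<noteq> 0 \<longrightarrow> w \<bullet> (G *v w) < 0)}"
  have "D \<subseteq> {..CARD('n)}"
  proof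
    fix k assume "k \<in> D"
    then obtain W :: "(real^'n) set" where "k = dim W" by (auto simp: D_def)
    then show "k \<in> {..CARD('n)}" using dim_subset_UNIV_cart[of W] by simp
  qed
  then have fin: "finite D" using finite_subset by blast
  have "dim {0::real^'n} \<in> D"
    unfolding D_def by (rule imageI) (simp add: subspace_single_0)
  then have ne: "D \<noteq> {}" by blast
  have s: "s = Max D" using idx(1) by (simp add: form_index_def D_def)
  from Max_in[OF fin ne] obtain W where W: "s = dim W" "subspace W"
    "\<forall>w\<in>W. w \<noteq> 0 \<longrightarrow> w \<bullet> (G *v w) < 0" by (auto simp: s D_def)
  have "W \<noteq> {0}" using W(1) idx(2) by auto
  moreover have "0 \<in> W" using W(2) subspace_0 by blast
  ultimately obtain w where "w \<in> W" "w \<noteq> 0" by blast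
  with W(3) show "\<exists>v. v \<bullet> (G *v v) < 0" by blast
  show "\<exists>v. v \<bullet> (G *v v) > 0"
  proof (rule ccontr)
    assume "\<not> ?thesis"
    then have nonpos: "v \<bullet> (G *v v) \<le> 0" for v by (meson not_le)
    have symm: "w \<bullet> (G *v v) = v \<bullet> (G *v w)" for v w
      by (metis dot_lmul_matrix inner_commute sym transpose_matrix_vector)
    have "v \<bullet> (G *v v) < 0" if "v \<noteq> 0" for v
    proof (rule ccontr)
      assume "\<not> v \<bullet> (G *v v) < 0"
      with nonpos[of v] have v: "v \<bullet> (G *v v) = 0" by simp
      have "v \<bullet> (G *v w) = 0" for w
      proof (rule ccontr)
        assume b: "v \<bullet> (G *v w) \<noteq> 0"
        define a where "a = v \<bullet> (G *v w)"
        define q where "q = w \<bullet> (G *v w)"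
        \<comment> \<open>As \<open>v\<close> is isotropic, the form at
          \<open>w + k *\<^sub>R v\<close> is affine in \<open>k\<close>. This \<open>k\<close>
          gives it the value 1, against semidefiniteness.\<close>
        define k where "k = (1 - q) / (2 * a)"
        have "(w + k *\<^sub>R v) \<bullet> (G *v (w + k *\<^sub>R v)) = q + 2 * k * a"
          by (simp add: a_def q_def matrix_vector_right_distrib matrix_vector_mult_scaleR inner_add
              v symm[of w v] algebra_simps)
        also have "\<dots> = 1" using b by (simp add: k_def a_def[symmetric] field_simps)
        finally show False using nonpos[of "w + k *\<^sub>R v"] by simp
      qed
      with nd that show False by (auto simp: nondegenerate_form_def)
    qed
    then have "dim (UNIV :: (real^'n) set) \<in> D"
      unfolding D_def by (intro imageI) simp
    then have "CARD('n) \<le> s" using Max_ge[OF fin] by (simp add: s)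
    with idx(3) show False by simp
  qed
qed

subsection \<open>Scalar products\<close>

lemma bounded_bilinear_pseudo_inner: "bounded_bilinear (pseudo_inner N)"
proof -
  have "bilinear (pseudo_inner N)"
    unfolding bilinear_def pseudo_inner_def[abs_def]
    by (auto intro!: linearI simp: algebra_simps sum.distrib sum_distrib_left)
  then show ?thesis using bilinear_conv_bounded_bilinear by blast
qed

lemma pseudo_inner_commute: "pseudo_inner N x y = pseudo_inner N y x"
  by (simp add: pseudo_inner_def mult.commute mult.left_commute)


interpretation pseudo_inner: bounded_bilinear "pseudo_inner N" for N
  by (rule bounded_bilinear_pseudo_inner)

lemmas smooth_on_pseudo_inner = smooth_on_bilinear[OF _ bounded_bilinear_pseudo_inner]

lemma nondegenerate_imp_det_nz:
  fixes G :: "real^'n^'n"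
  assumes "nondegenerate_form (\<lambda>v w. v \<bullet> (G *v w))" "transpose G = G"
  shows "det G \<noteq> 0"
proof -
  have "v = 0" if "G *v v = 0" for v
  proof -
    have "v \<bullet> (G *v w) = 0" for w
      by (metis assms(2) dot_lmul_matrix inner_zero_left that transpose_matrix_vector)
    then show ?thesis using assms(1) by (auto simp: nondegenerate_form_def)
  qed
  then have "\<exists>B. B ** G = mat 1" using matrix_left_invertible_ker[of G] by blast
  then show ?thesis using invertible_det_nz invertible_left_inverse by blast
qed

subsection \<open>Derivatives along curves\<close>

lemma vderiv_eqI: "(f has_vector_derivative f') (at t) \<Longrightarrow> vderiv f t = f'"
  by (simp add: vderiv_def vector_derivative_at)

lemma vderiv_cong_open:
  assumes "open I" "\<And>t. t \<in> I \<Longrightarrow> f t = g t" "t \<in> I"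
  shows "vderiv f t = vderiv g t"
  unfolding vderiv_def
  by (rule vector_derivative_cong_eq)
    (use assms in \<open>auto simp: eventually_nhds intro!: exI[of _ I]\<close>)

lemma higher_vderiv_cong_open:
  assumes "open I" "\<And>t. t \<in> I \<Longrightarrow> f t = g t" "t \<in> I"
  shows "higher_vderiv r f t = higher_vderiv r g t"
  using assms(3)
proof (induction r arbitrary: t)
  case 0
  then show ?case by (simp add: higher_vderiv_def assms(2))
next
  case (Suc r)
  then show ?case
    using vderiv_cong_open[OF assms(1), of "higher_vderiv r f" "higher_vderiv r g"]
    by (simp add: higher_vderiv_def)
qed

lemma higher_vderiv_2: "higher_vderiv 2 f = vderiv (vderiv f)"
  by (simp add: higher_vderiv_def eval_nat_numeral)

lemma smooth_on_vderiv:
  fixes f :: "real \<Rightarrow> 'b::real_normed_vector"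
  assumes "open I" "smooth_on I f"
  shows "t \<in> I \<Longrightarrow> (f has_vector_derivative vderiv f t) (at t)" and "smooth_on I (vderiv f)"
proof -
  have d: "(f has_vector_derivative frechet_derivative f (at t) 1) (at t)" if "t \<in> I" for t
  proof -
    note f = smooth_on_has_derivative[OF assms(2) that]
    have "frechet_derivative f (at t) h = h *\<^sub>R frechet_derivative f (at t) 1" for h
      using linear_scale[OF has_derivative_linear[OF f], of h 1] by simp
    then have "frechet_derivative f (at t) = (\<lambda>h. h *\<^sub>R frechet_derivative f (at t) 1)" by (rule ext)
    then show ?thesis using f unfolding has_vector_derivative_def by simp
  qed
  then show "t \<in> I \<Longrightarrow> (f has_vector_derivative vderiv f t) (at t)"
    by (metis vderiv_eqI)
  show "smooth_on I (vderiv f)"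
    by (rule smooth_on_cong[OF assms(1) _ smooth_on_frechet_derivative[OF assms(2), of 1]])
      (simp add: vderiv_eqI[OF d])
qed

definition part :: "'n::finite \<Rightarrow> (real^'n \<Rightarrow> 'b::real_normed_vector) \<Rightarrow> real^'n \<Rightarrow> 'b" where
  "part i F x = frechet_derivative F (at x) (axis i 1)"

text \<open>The differential of \<open>F\<close> at \<open>x\<close>; \<open>diff2\<close> is the
  second differential evaluated at (w, w). The explicit sums display the smooth dependence on
  \<open>x\<close> and the polynomial dependence on \<open>w\<close>, which
  \<open>frechet_derivative\<close> hides.\<close>

definition diff1 :: "(real^'n::finite \<Rightarrow> 'b::real_normed_vector) \<Rightarrow> real^'n \<Rightarrow> real^'n \<Rightarrow> 'b" where
  "diff1 F x w = (\<Sum>i\<in>UNIV. w $ i *\<^sub>R part i F x)"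

definition diff2 :: "(real^'n::finite \<Rightarrow> 'b::real_normed_vector) \<Rightarrow> real^'n \<Rightarrow> real^'n \<Rightarrow> 'b" where
  "diff2 F x w = (\<Sum>i\<in>UNIV. w $ i *\<^sub>R (\<Sum>j\<in>UNIV. w $ j *\<^sub>R part j (part i F) x))"

lemma smooth_on_part: "smooth_on S F \<Longrightarrow> smooth_on S (part i F)"
  unfolding part_def[abs_def] by (rule smooth_on_frechet_derivative)

lemma frechet_derivative_eq_diff1:
  "smooth_on S F \<Longrightarrow> x \<in> S \<Longrightarrow> frechet_derivative F (at x) w = diff1 F x w"
  using linear_eq_sum_axis[OF has_derivative_linear[OF smooth_on_has_derivative]]
  unfolding diff1_def part_def by blast

lemma smooth_on_has_diff1:
  assumes "smooth_on S F" "x \<in> S"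
  shows "(F has_derivative diff1 F x) (at x)"
proof -
  have "frechet_derivative F (at x) = diff1 F x"
    using frechet_derivative_eq_diff1[OF assms] by blast
  then show ?thesis using smooth_on_has_derivative[OF assms] by simp
qed

lemma linear_diff1: "linear (diff1 F x)"
  unfolding diff1_def[abs_def]
  by (rule linearI) (simp_all add: scaleR_add_left sum.distrib scaleR_sum_right)

lemma diff1_diff: "diff1 F x (v - w) = diff1 F x v - diff1 F x w"
  and diff1_scaleR: "diff1 F x (r *\<^sub>R v) = r *\<^sub>R diff1 F x v"
  and diff1_axis: "diff1 F x (axis i 1) = part i F x"
proof -
  show "diff1 F x (v - w) = diff1 F x v - diff1 F x w" by (rule linear_diff[OF linear_diff1])
  show "diff1 F x (r *\<^sub>R v) = r *\<^sub>R diff1 F x v" by (rule linear_scale[OF linear_diff1])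
  have "diff1 F x (axis i 1) = (\<Sum>j\<in>UNIV. if j = i then part j F x else 0)"
    unfolding diff1_def by (rule sum.cong) (auto simp: axis_def)
  then show "diff1 F x (axis i 1) = part i F x" by simp
qed

lemma smooth_on_diff1:
  "open S \<Longrightarrow> smooth_on S F \<Longrightarrow> smooth_on S f \<Longrightarrow> smooth_on S (\<lambda>x. diff1 F x (f x))"
  unfolding diff1_def by (intro smooth_on_sum smooth_on_scaleR smooth_on_vec_nth smooth_on_part)

lemma has_vector_derivative_compose_diff1:
  assumes "smooth_on S F" "x t \<in> S" "(x has_vector_derivative y) (at t)"
  shows "((\<lambda>t. F (x t)) has_vector_derivative diff1 F (x t) y) (at t)"
  using vector_derivative_diff_chain_within[OF assms(3), of F "diff1 F (x t)"]
    has_derivative_at_withinI[OF smooth_on_has_diff1[OF assms(1,2)]] by (simp add: o_def)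

text \<open>The left side is the velocity of \<open>F\<close> along the curve, so this is the second
  derivative of a composite: the second differential plus the differential of the coordinate
  acceleration \<open>a\<close>.\<close>

lemma has_vector_derivative_diff1:
  assumes "smooth_on S F" "x t \<in> S" "(x has_vector_derivative y t) (at t)"
    "(y has_vector_derivative a) (at t)"
  shows "((\<lambda>t. diff1 F (x t) (y t)) has_vector_derivative diff2 F (x t) (y t) + diff1 F (x t) a) (at t)"
proof -
  have "((\<lambda>t. y t $ i *\<^sub>R part i F (x t)) has_vector_derivative
      y t $ i *\<^sub>R diff1 (part i F) (x t) (y t) + a $ i *\<^sub>R part i F (x t)) (at t)" for i
  proof (rule has_vector_derivative_scaleR)
    show "((\<lambda>t. part i F (x t)) has_vector_derivative diff1 (part i F) (x t) (y t)) (at t)"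
      by (rule has_vector_derivative_compose_diff1[OF smooth_on_part[OF assms(1)] assms(2,3)])
    show "((\<lambda>t. y t $ i) has_real_derivative a $ i) (at t)"
      using bounded_linear.has_vector_derivative[OF bounded_linear_vec_nth assms(4)]
      by (simp add: has_real_derivative_iff_has_vector_derivative)
  qed
  then have "((\<lambda>t. \<Sum>i\<in>UNIV. y t $ i *\<^sub>R part i F (x t)) has_vector_derivative
      (\<Sum>i\<in>UNIV. y t $ i *\<^sub>R diff1 (part i F) (x t) (y t) + a $ i *\<^sub>R part i F (x t))) (at t)"
    by (intro has_vector_derivative_sum)
  then show ?thesis by (simp add: diff1_def diff2_def sum.distrib)
qed

lemma vderiv_compose:
  assumes "smooth_on S F" "open S" "open I" "smooth_on I x" "\<And>t. t \<in> I \<Longrightarrow> x t \<in> S" "t \<in> I"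
  shows "vderiv (\<lambda>t. F (x t)) t = diff1 F (x t) (vderiv x t)"
    and "vderiv (vderiv (\<lambda>t. F (x t))) t =
      diff2 F (x t) (vderiv x t) + diff1 F (x t) (vderiv (vderiv x) t)"
proof -
  note x = smooth_on_vderiv[OF assms(3,4)] and y = smooth_on_vderiv(1)[OF assms(3) smooth_on_vderiv(2)[OF assms(3,4)]]
  have 1: "vderiv (\<lambda>t. F (x t)) t = diff1 F (x t) (vderiv x t)" if "t \<in> I" for t
    by (rule vderiv_eqI[OF has_vector_derivative_compose_diff1[OF assms(1) assms(5)[OF that] x(1)[OF that]]])
  then show "vderiv (\<lambda>t. F (x t)) t = diff1 F (x t) (vderiv x t)" using assms(6) .
  have "vderiv (vderiv (\<lambda>t. F (x t))) t = vderiv (\<lambda>t. diff1 F (x t) (vderiv x t)) t"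
    by (rule vderiv_cong_open[OF assms(3) 1 assms(6)])
  also have "\<dots> = diff2 F (x t) (vderiv x t) + diff1 F (x t) (vderiv (vderiv x) t)"
    by (rule vderiv_eqI[OF has_vector_derivative_diff1[OF assms(1) assms(5)[OF assms(6)]
            x(1)[OF assms(6)] y[OF assms(6)]]])
  finally show "vderiv (vderiv (\<lambda>t. F (x t))) t =
      diff2 F (x t) (vderiv x t) + diff1 F (x t) (vderiv (vderiv x) t)" .
qed

subsection \<open>The Gauss formula in coordinates\<close>

text \<open>The product rule turns the three derivatives of the Gram matrix into six terms. Symmetry
  of the second partial derivatives cancels four of them and makes the remaining two equal, which
  absorbs the factor 1/2.\<close>

lemma christoffel_pseudo_inner:
  fixes F :: "real^'n::finite \<Rightarrow> real^'e::finite"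
  assumes S: "open S" "smooth_on S F" "x \<in> S"
    and G: "\<And>z i j. z \<in> S \<Longrightarrow> G z $ i $ j = pseudo_inner N (part i F z) (part j F z)"
  shows "christoffel G x k i j =
    (\<Sum>l\<in>UNIV. matrix_inv (G x) $ k $ l * pseudo_inner N (part j (part i F) x) (part l F x))"
proof -
  define H where "H i j = part j (part i F) x" for i j
  have H: "H i j = H j i" for i j
    unfolding H_def part_def[abs_def] by (rule frechet_derivative_commute[OF S])
  have pd: "partial_deriv i (\<lambda>z. G z $ j $ l) x =
      pseudo_inner N (part j F x) (H l i) + pseudo_inner N (H j i) (part l F x)" for i j l
  proof -
    have "((\<lambda>z. pseudo_inner N (part j F z) (part l F z)) has_derivative
        (\<lambda>h. pseudo_inner N (part j F x) (diff1 (part l F) x h) +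
             pseudo_inner N (diff1 (part j F) x h) (part l F x))) (at x)"
      by (rule pseudo_inner.FDERIV[OF smooth_on_has_diff1 smooth_on_has_diff1])
        (rule smooth_on_part S)+
    then have "((\<lambda>z. G z $ j $ l) has_derivative
        (\<lambda>h. pseudo_inner N (part j F x) (diff1 (part l F) x h) +
             pseudo_inner N (diff1 (part j F) x h) (part l F x))) (at x)"
      by (rule has_derivative_transform_within_open[OF _ S(1,3)]) (simp add: G)
    from frechet_derivative_at[OF this, symmetric] show ?thesis
      by (simp add: partial_deriv_def diff1_axis H_def)
  qed
  have "partial_deriv i (\<lambda>z. G z $ j $ l) x + partial_deriv j (\<lambda>z. G z $ i $ l) x
      - partial_deriv l (\<lambda>z. G z $ i $ j) x = 2 * pseudo_inner N (H i j) (part l F x)" for l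
    unfolding pd using H[of l i] H[of l j] H[of i j]
    by (simp add: pseudo_inner_commute[of N "part j F x"] pseudo_inner_commute[of N "part i F x"])
  then show ?thesis
    unfolding christoffel_def H_def by (simp add: sum_divide_distrib)
qed

text \<open>Multiplication by the Gram matrix removes its inverse from the geodesic equation. Entry
  l then is the product of the ambient acceleration with the l-th partial derivative of
  \<open>F\<close>, so the equation says that this acceleration is normal.\<close>

lemma geodesic_equation_iff:
  fixes F :: "real^'n::finite \<Rightarrow> real^'e::finite"
  assumes S: "open S" "smooth_on S F" "x \<in> S"
    and G: "\<And>z i j. z \<in> S \<Longrightarrow> G z $ i $ j = pseudo_inner N (part i F z) (part j F z)"
    and det: "det (G x) \<noteq> 0"
  shows "(\<forall>k. a $ k + (\<Sum>i\<in>UNIV. \<Sum>j\<in>UNIV. christoffel G x k i j * (y $ i) * (y $ j)) = 0) \<longleftrightarrow>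
    (\<forall>w. pseudo_inner N (diff2 F x y + diff1 F x a) (diff1 F x w) = 0)"
proof -
  define r where "r = (\<chi> l. pseudo_inner N (diff2 F x y) (part l F x))"
  have r: "r $ l = (\<Sum>i\<in>UNIV. \<Sum>j\<in>UNIV. y $ i * y $ j * pseudo_inner N (part j (part i F) x) (part l F x))" for l
    by (simp add: r_def diff2_def pseudo_inner.sum_left pseudo_inner.scaleR_left sum_distrib_left
        scaleR_sum_right mult.assoc)
  have chr: "christoffel G x k i j =
    (\<Sum>l\<in>UNIV. matrix_inv (G x) $ k $ l * pseudo_inner N (part j (part i F) x) (part l F x))" for k i j
    by (rule christoffel_pseudo_inner[OF S]) (rule G)
  have "(\<Sum>i\<in>UNIV. \<Sum>j\<in>UNIV. christoffel G x k i j * (y $ i) * (y $ j)) = (matrix_inv (G x) *v r) $ k" for k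
  proof -
    have "(\<Sum>i\<in>UNIV. \<Sum>j\<in>UNIV. christoffel G x k i j * (y $ i) * (y $ j)) =
      (\<Sum>i\<in>UNIV. \<Sum>j\<in>UNIV. \<Sum>l\<in>UNIV. matrix_inv (G x) $ k $ l * (y $ i * y $ j *
         pseudo_inner N (part j (part i F) x) (part l F x)))"
      unfolding chr sum_distrib_right by (simp add: mult_ac)
    also have "\<dots> = (\<Sum>i\<in>UNIV. \<Sum>l\<in>UNIV. \<Sum>j\<in>UNIV. matrix_inv (G x) $ k $ l * (y $ i * y $ j *
         pseudo_inner N (part j (part i F) x) (part l F x)))"
      by (intro sum.cong refl sum.swap)
    also have "\<dots> = (\<Sum>l\<in>UNIV. \<Sum>i\<in>UNIV. \<Sum>j\<in>UNIV. matrix_inv (G x) $ k $ l * (y $ i * y $ j *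
         pseudo_inner N (part j (part i F) x) (part l F x)))"
      by (rule sum.swap)
    also have "\<dots> = (matrix_inv (G x) *v r) $ k"
      by (simp add: matrix_vector_mult_def r sum_distrib_left)
    finally show ?thesis .
  qed
  then have "(\<forall>k. a $ k + (\<Sum>i\<in>UNIV. \<Sum>j\<in>UNIV. christoffel G x k i j * (y $ i) * (y $ j)) = 0)
      \<longleftrightarrow> a + matrix_inv (G x) *v r = 0"
    by (simp add: vec_eq_iff)
  also have "\<dots> \<longleftrightarrow> G x *v a + r = 0"
  proof
    assume "a + matrix_inv (G x) *v r = 0"
    then have "G x *v (a + matrix_inv (G x) *v r) = 0" by simp
    then show "G x *v a + r = 0"
      by (simp add: matrix_vector_right_distrib matrix_vector_mul_assoc matrix_inv_inverse[OF det])
  next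
    assume "G x *v a + r = 0"
    then have "matrix_inv (G x) *v (G x *v a + r) = 0" by simp
    then show "a + matrix_inv (G x) *v r = 0"
      by (simp add: matrix_vector_right_distrib matrix_vector_mul_assoc matrix_inv_inverse[OF det])
  qed
  also have "\<dots> \<longleftrightarrow> (\<forall>l. pseudo_inner N (diff2 F x y + diff1 F x a) (part l F x) = 0)"
  proof -
    have "(G x *v a) $ l = pseudo_inner N (diff1 F x a) (part l F x)" for l
      by (simp add: matrix_vector_mult_def G[OF S(3)] diff1_def pseudo_inner.sum_left
          pseudo_inner.scaleR_left mult.commute pseudo_inner_commute[of N "part l F x"])
    then show ?thesis by (simp add: vec_eq_iff r_def pseudo_inner.add_left add.commute)
  qed
  also have "\<dots> \<longleftrightarrow> (\<forall>w. pseudo_inner N (diff2 F x y + diff1 F x a) (diff1 F x w) = 0)"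
  proof
    assume "\<forall>l. pseudo_inner N (diff2 F x y + diff1 F x a) (part l F x) = 0"
    then show "\<forall>w. pseudo_inner N (diff2 F x y + diff1 F x a) (diff1 F x w) = 0"
      by (simp add: diff1_def[of F x "w" for w] pseudo_inner.sum_right pseudo_inner.scaleR_right)
  next
    assume "\<forall>w. pseudo_inner N (diff2 F x y + diff1 F x a) (diff1 F x w) = 0"
    then show "\<forall>l. pseudo_inner N (diff2 F x y + diff1 F x a) (part l F x) = 0"
      by (metis diff1_axis)
  qed
  finally show ?thesis .
qed

subsection \<open>Geodesics of immersed manifolds\<close>

lemma smooth_on_Pair:
  fixes f :: "'a::euclidean_space \<Rightarrow> 'b::euclidean_space" and g :: "'a \<Rightarrow> 'c::euclidean_space"
  assumes "open S" "smooth_on S f" "smooth_on S g"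
  shows "smooth_on S (\<lambda>x. (f x, g x))"
proof -
  have "bounded_linear (\<lambda>b::'b. (b, 0::'c))" "bounded_linear (\<lambda>c::'c. (0::'b, c))"
    by (auto intro!: bounded_linear_Pair bounded_linear_ident bounded_linear_zero)
  then have "smooth_on S (\<lambda>x. (f x, 0::'c) + (0::'b, g x))"
    by (intro smooth_on_add assms(1) smooth_on_linear_compose[where L = "\<lambda>b. (b, 0)"]
        smooth_on_linear_compose[where L = "\<lambda>c. (0, c)"] assms)
  then show ?thesis by simp
qed

section \<open>Immersions in charts\<close>

locale immersed_manifold =
  fixes A :: "('m::{t2_space, second_countable_topology}, 'n::finite) chart set"
    and s :: nat
    and g :: "('m, 'n) metric"
    and N :: "'e::finite set"
    and \<psi> :: "'m \<Rightarrow> real^'e"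
  assumes atlas: "smooth_atlas A"
    and metric: "pseudo_riemannian_metric A s g"
    and immersion: "isometric_immersion N A g \<psi>"
begin

lemma chart:
  assumes "c \<in> A"
  shows open_dom: "open (chart_dom c)" and open_ran: "open (chart_ran c)"
    and chart_homeo: "homeomorphism (chart_dom c) (chart_ran c) (coord c) (param c)"
  using atlas assms by (auto simp: smooth_atlas_def)

lemma param_coord: "c \<in> A \<Longrightarrow> p \<in> chart_dom c \<Longrightarrow> param c (coord c p) = p"
  by (rule homeomorphism_apply1[OF chart_homeo])

lemma coord_param: "c \<in> A \<Longrightarrow> x \<in> chart_ran c \<Longrightarrow> coord c (param c x) = x"
  by (rule homeomorphism_apply2[OF chart_homeo])

lemma param_in_dom: "c \<in> A \<Longrightarrow> x \<in> chart_ran c \<Longrightarrow> param c x \<in> chart_dom c"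
  using homeomorphism_image2[OF chart_homeo] by blast

lemma smooth_immersion: "c \<in> A \<Longrightarrow> smooth_on (chart_ran c) (\<psi> \<circ> param c)"
  using immersion by (auto simp: isometric_immersion_def)

lemma open_overlap:
  assumes "c \<in> A" "c' \<in> A"
  shows "open (coord c ` (chart_dom c \<inter> chart_dom c'))"
proof -
  have "openin (top_of_set (chart_ran c)) (coord c ` (chart_dom c \<inter> chart_dom c'))"
    by (rule homeomorphism_imp_open_map[OF chart_homeo[OF assms(1)]
          openin_open_Int[OF open_dom[OF assms(2)]]])
  then show ?thesis using openin_open_eq open_ran[OF assms(1)] by blast
qed

lemma smooth_transition:
  "c \<in> A \<Longrightarrow> c' \<in> A \<Longrightarrow> smooth_on (coord c ` (chart_dom c \<inter> chart_dom c')) (coord c' \<circ> param c)"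
  using atlas by (auto simp: smooth_atlas_def)

lemma dpsi_eq_diff1:
  "c \<in> A \<Longrightarrow> p \<in> chart_dom c \<Longrightarrow> dpsi \<psi> c p v = diff1 (\<psi> \<circ> param c) (coord c p) v"
  unfolding dpsi_def by (rule frechet_derivative_eq_diff1[OF smooth_immersion]) auto

lemma dpsi_inj: "c \<in> A \<Longrightarrow> p \<in> chart_dom c \<Longrightarrow> inj (dpsi \<psi> c p)"
  using immersion by (auto simp: isometric_immersion_def)

text \<open>Two local expressions of the immersion differ by the transition map, so the chain rule
  factors one differential through the other. Hence a single chart at \<open>p\<close> already
  computes the tangent space, which is defined as a union over all charts.\<close>

lemma range_dpsi_subset:
  assumes "c \<in> A" "c' \<in> A" "p \<in> chart_dom c" "p \<in> chart_dom c'"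
  shows "range (dpsi \<psi> c p) \<subseteq> range (dpsi \<psi> c' p)"
proof -
  define T where "T = coord c' \<circ> param c"
  define O' where "O' = coord c ` (chart_dom c \<inter> chart_dom c')"
  have p: "coord c p \<in> O'" using assms by (auto simp: O'_def)
  have Tp: "T (coord c p) = coord c' p" using assms by (simp add: T_def param_coord)
  have T: "(T has_derivative frechet_derivative T (at (coord c p))) (at (coord c p))"
    using smooth_on_has_derivative[OF smooth_transition[OF assms(1,2)]] p by (simp add: T_def O'_def)
  have "((\<psi> \<circ> param c') has_derivative dpsi \<psi> c' p) (at (T (coord c p)))"
    unfolding Tp dpsi_def by (rule smooth_on_has_derivative[OF smooth_immersion[OF assms(2)]])
      (use assms in auto)
  from has_derivative_compose[OF T this]
  have "((\<lambda>x. (\<psi> \<circ> param c') (T x)) has_derivative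
      (\<lambda>v. dpsi \<psi> c' p (frechet_derivative T (at (coord c p)) v))) (at (coord c p))" .
  then have "((\<psi> \<circ> param c) has_derivative
      (\<lambda>v. dpsi \<psi> c' p (frechet_derivative T (at (coord c p)) v))) (at (coord c p))"
    by (rule has_derivative_transform_within_open[OF _ open_overlap[OF assms(1,2)]])
      (use p assms in \<open>auto simp: O'_def T_def param_coord\<close>)
  from frechet_derivative_at[OF this]
  have "dpsi \<psi> c p v = dpsi \<psi> c' p (frechet_derivative T (at (coord c p)) v)" for v
    unfolding dpsi_def by metis
  then show ?thesis by auto
qed

lemma tangent_space_eq:
  assumes "c \<in> A" "p \<in> chart_dom c"
  shows "tangent_space A \<psi> p = range (diff1 (\<psi> \<circ> param c) (coord c p))"
proof -
  have "dpsi \<psi> c p = diff1 (\<psi> \<circ> param c) (coord c p)" using dpsi_eq_diff1[OF assms] by blast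
  moreover have "tangent_space A \<psi> p = range (dpsi \<psi> c p)"
    unfolding tangent_space_def using range_dpsi_subset[OF _ assms(1) _ assms(2)] assms by blast
  ultimately show ?thesis by simp
qed

lemma normal_space_iff:
  assumes "c \<in> A" "p \<in> chart_dom c"
  shows "w \<in> normal_space N A \<psi> p \<longleftrightarrow>
    (\<forall>v. pseudo_inner N w (diff1 (\<psi> \<circ> param c) (coord c p) v) = 0)"
  using tangent_space_eq[OF assms] by (auto simp: normal_space_def)

lemma inner_diff1:
  assumes "c \<in> A" "x \<in> chart_ran c"
  shows "pseudo_inner N (diff1 (\<psi> \<circ> param c) x v) (diff1 (\<psi> \<circ> param c) x w) = v \<bullet> (g c x *v w)"
proof -
  obtain p where p: "p \<in> chart_dom c" "x = coord c p" using assms(2) by auto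
  have "pseudo_inner N (dpsi \<psi> c p v) (dpsi \<psi> c p w) = metric_form g c (coord c p) v w"
    using immersion assms(1) p(1) unfolding isometric_immersion_def by blast
  then show ?thesis
    by (simp add: dpsi_eq_diff1[OF assms(1) p(1)] metric_form_def p(2))
qed

lemma metric_component:
  assumes "c \<in> A" "x \<in> chart_ran c"
  shows "g c x $ i $ j = pseudo_inner N (part i (\<psi> \<circ> param c) x) (part j (\<psi> \<circ> param c) x)"
  using inner_diff1[OF assms, of "axis i 1" "axis j 1"]
  by (simp add: diff1_axis inner_axis' matrix_vector_mul_component inner_axis)

lemma metric_nondegenerate:
  assumes "c \<in> A" "x \<in> chart_ran c"
  shows "nondegenerate_form (\<lambda>v w. v \<bullet> (g c x *v w))" "transpose (g c x) = g c x"
    "form_index (\<lambda>v w. v \<bullet> (g c x *v w)) = s"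
  using metric assms unfolding pseudo_riemannian_metric_def metric_form_def[abs_def] by blast+

lemma det_metric: "c \<in> A \<Longrightarrow> x \<in> chart_ran c \<Longrightarrow> det (g c x) \<noteq> 0"
  using nondegenerate_imp_det_nz metric_nondegenerate by blast

lemma smooth_metric_component: "c \<in> A \<Longrightarrow> smooth_on (chart_ran c) (\<lambda>x. g c x $ i $ j)"
  using metric open_ran by (intro smooth_on_vec_nth) (auto simp: pseudo_riemannian_metric_def)

lemma smooth_christoffel:
  assumes "c \<in> A"
  shows "smooth_on (chart_ran c) (\<lambda>x. christoffel (g c) x k i j)"
  unfolding christoffel_def partial_deriv_def
  using assms open_ran[OF assms]
  by (intro smooth_on_divide smooth_on_sum smooth_on_mult smooth_on_diff smooth_on_add
      smooth_on_frechet_derivative smooth_on_matrix_inv smooth_metric_component det_metric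
      smooth_on_const) auto

section \<open>Curves in charts\<close>

lemma smooth_curve_coord:
  assumes "smooth_curve_on A J \<gamma>" "open J" "c \<in> A"
  shows "open {t \<in> J. \<gamma> t \<in> chart_dom c}"
    and "smooth_on {t \<in> J. \<gamma> t \<in> chart_dom c} (coord c \<circ> \<gamma>)"
proof -
  have "continuous_on J \<gamma>" using assms(1) by (simp add: smooth_curve_on_def)
  then have "open (J \<inter> \<gamma> -` chart_dom c)"
    using assms(2) open_dom[OF assms(3)] continuous_on_open_vimage by (metis Int_commute)
  then show "open {t \<in> J. \<gamma> t \<in> chart_dom c}" by (simp add: vimage_def Collect_conj_eq)
  show "smooth_on {t \<in> J. \<gamma> t \<in> chart_dom c} (coord c \<circ> \<gamma>)"
    using assms(1,3) by (simp add: smooth_curve_on_def)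
qed

text \<open>Smoothness is demanded in every chart of the atlas. In another chart the curve is the
  transition map after \<open>x\<close>, on the open set of times spent there.\<close>

lemma smooth_curve_param:
  assumes "c \<in> A" "open J" "smooth_on J x" "x ` J \<subseteq> chart_ran c"
  shows "smooth_curve_on A J (param c \<circ> x)"
  unfolding smooth_curve_on_def
proof (intro conjI ballI)
  have "continuous_on (chart_ran c) (param c)" using chart_homeo[OF assms(1)] by (simp add: homeomorphism_def)
  then show cont: "continuous_on J (param c \<circ> x)"
    using smooth_on_imp_continuous_on[OF assms(3)] assms(4)
    by (metis continuous_on_compose continuous_on_subset)
  fix c' assume c': "c' \<in> A"
  define I where "I = {t \<in> J. (param c \<circ> x) t \<in> chart_dom c'}"
  have "open (J \<inter> (param c \<circ> x) -` chart_dom c')"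
    using cont assms(2) open_dom[OF c'] continuous_on_open_vimage by (metis Int_commute)
  then have I: "open I" by (simp add: I_def vimage_def Collect_conj_eq)
  have "smooth_on I (\<lambda>t. (coord c' \<circ> param c) (x t))"
  proof (rule smooth_on_compose[OF I open_overlap[OF assms(1) c'] _ _ smooth_transition[OF assms(1) c']])
    show "x ` I \<subseteq> coord c ` (chart_dom c \<inter> chart_dom c')"
    proof
      fix y assume "y \<in> x ` I"
      then obtain t where t: "t \<in> J" "param c (x t) \<in> chart_dom c'" "y = x t" by (auto simp: I_def)
      have y: "x t \<in> chart_ran c" using assms(4) t by blast
      have "y = coord c (param c (x t))" using coord_param[OF assms(1) y] t(3) by simp
      then show "y \<in> coord c ` (chart_dom c \<inter> chart_dom c')"
        using param_in_dom[OF assms(1) y] t(2) by blast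
    qed
    show "smooth_on I x" by (rule smooth_on_subset[OF assms(3)]) (auto simp: I_def)
  qed
  then show "smooth_on {t \<in> J. (param c \<circ> x) t \<in> chart_dom c'} (coord c' \<circ> (param c \<circ> x))"
    by (simp add: I_def o_def)
qed

text \<open>The curve agrees with \<open>F\<close> after \<open>x\<close> while it stays in the
  chart domain. That set of times is open, which is enough for derivatives of every order.\<close>

lemma curve_in_chart:
  assumes "smooth_curve_on A J \<gamma>" "open J" "c \<in> A" "t \<in> J" "\<gamma> t \<in> chart_dom c"
  defines "x \<equiv> coord c \<circ> \<gamma>" and "F \<equiv> \<psi> \<circ> param c"
  shows "vderiv (\<psi> \<circ> \<gamma>) t = diff1 F (x t) (vderiv x t)"
    and "vderiv (vderiv (\<psi> \<circ> \<gamma>)) t = diff2 F (x t) (vderiv x t) + diff1 F (x t) (vderiv (vderiv x) t)"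
    and "higher_vderiv r (\<psi> \<circ> \<gamma>) t = higher_vderiv r (\<lambda>t. F (x t)) t"
proof -
  define I where "I = {t \<in> J. \<gamma> t \<in> chart_dom c}"
  have I: "open I" "smooth_on I x" "t \<in> I"
    using smooth_curve_coord[OF assms(1-3)] assms(4,5) by (auto simp: I_def x_def)
  have ran: "x t \<in> chart_ran c" if "t \<in> I" for t using that by (auto simp: I_def x_def)
  have eq: "(\<psi> \<circ> \<gamma>) t = F (x t)" if "t \<in> I" for t
    using that param_coord[OF assms(3)] by (simp add: I_def x_def F_def)
  show h: "higher_vderiv r (\<psi> \<circ> \<gamma>) t = higher_vderiv r (\<lambda>t. F (x t)) t" for r
    by (rule higher_vderiv_cong_open[OF I(1) eq I(3)])
  have F: "smooth_on (chart_ran c) F" unfolding F_def by (rule smooth_immersion[OF assms(3)])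
  note v = vderiv_compose[OF F open_ran[OF assms(3)] I(1,2) ran I(3)]
  show "vderiv (\<psi> \<circ> \<gamma>) t = diff1 F (x t) (vderiv x t)"
    using h[of 1] v(1) by (simp add: higher_vderiv_def)
  show "vderiv (vderiv (\<psi> \<circ> \<gamma>)) t = diff2 F (x t) (vderiv x t) + diff1 F (x t) (vderiv (vderiv x) t)"
    using h[of 2] v(2) by (simp add: higher_vderiv_2)
qed

text \<open>The right side names no chart. An equation checked in one chart therefore holds in all
  of them, as \<open>geodesic_on\<close> demands.\<close>

lemma geodesic_iff_normal:
  assumes "smooth_curve_on A J \<gamma>" "open J" "c \<in> A" "t \<in> J" "\<gamma> t \<in> chart_dom c"
  shows "(\<forall>k. higher_vderiv 2 (coord c \<circ> \<gamma>) t $ k +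
          (\<Sum>i\<in>UNIV. \<Sum>j\<in>UNIV. christoffel (g c) (coord c (\<gamma> t)) k i j *
             (vderiv (coord c \<circ> \<gamma>) t $ i) * (vderiv (coord c \<circ> \<gamma>) t $ j)) = 0)
     \<longleftrightarrow> vderiv (vderiv (\<psi> \<circ> \<gamma>)) t \<in> normal_space N A \<psi> (\<gamma> t)"
proof -
  have ran: "coord c (\<gamma> t) \<in> chart_ran c" using assms(5) by auto
  have eq: "(coord c \<circ> \<gamma>) t = coord c (\<gamma> t)" by simp
  show ?thesis
    unfolding higher_vderiv_2 normal_space_iff[OF assms(3,5)] curve_in_chart(2)[OF assms] eq
    by (rule geodesic_equation_iff[OF open_ran[OF assms(3)] smooth_immersion[OF assms(3)] ran
          metric_component[OF assms(3)] det_metric[OF assms(3) ran]])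
qed

text \<open>The initial velocity is prescribed in the ambient space, and injectivity of the
  differential recovers its coordinates.\<close>

lemma initial_velocity:
  assumes "initial_curve \<psi> p u J \<gamma>" "smooth_curve_on A J \<gamma>" "c \<in> A" "p \<in> chart_dom c"
    and "u = dpsi \<psi> c p v"
  shows "vderiv (coord c \<circ> \<gamma>) 0 = v"
proof -
  have J: "open J" "0 \<in> J" "\<gamma> 0 = p" "vderiv (\<psi> \<circ> \<gamma>) 0 = u"
    using assms(1) by (auto simp: initial_curve_def vderiv_eqI)
  then have "u = diff1 (\<psi> \<circ> param c) (coord c p) (vderiv (coord c \<circ> \<gamma>) 0)"
    using curve_in_chart(1)[OF assms(2) J(1) assms(3) J(2)] assms(4) by simp
  then have "dpsi \<psi> c p v = dpsi \<psi> c p (vderiv (coord c \<circ> \<gamma>) 0)"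
    using assms(5) dpsi_eq_diff1[OF assms(3,4)] by simp
  then show ?thesis using dpsi_inj[OF assms(3,4)] by (simp add: inj_eq)
qed

lemma initial_curve_param:
  assumes "c \<in> A" "p \<in> chart_dom c" "u = dpsi \<psi> c p v"
    and "open J" "is_interval J" "0 \<in> J" "x 0 = coord c p" "(x has_vector_derivative v) (at 0)"
  shows "initial_curve \<psi> p u J (param c \<circ> x)"
proof -
  have "((\<lambda>t. (\<psi> \<circ> param c) (x t)) has_vector_derivative diff1 (\<psi> \<circ> param c) (x 0) v) (at 0)"
    by (rule has_vector_derivative_compose_diff1[OF smooth_immersion[OF assms(1)] _ assms(8)])
      (use assms in auto)
  then show ?thesis
    using assms by (simp add: initial_curve_def param_coord dpsi_eq_diff1 o_def)
qed

section \<open>Existence and equation of geodesics\<close>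

lemma geodesic_exists:
  assumes "c \<in> A" "p \<in> chart_dom c" "u = dpsi \<psi> c p v"
  shows "\<exists>\<gamma> J. initial_curve \<psi> p u J \<gamma> \<and> geodesic_on A g J \<gamma>"
proof -
  define S where "S = chart_ran c \<times> (UNIV :: (real^'n) set)"
  define E where "E x y = (\<chi> k. - (\<Sum>i\<in>UNIV. \<Sum>j\<in>UNIV. christoffel (g c) x k i j * (y $ i) * (y $ j)))"
    for x y :: "real^'n"
  define f where "f z = (snd z, E (fst z) (snd z))" for z :: "(real^'n) \<times> (real^'n)"
  have S: "open S" unfolding S_def by (intro open_Times open_ran assms) auto
  have fst: "smooth_on S fst" and snd: "smooth_on S snd"
    using S bounded_linear_fst bounded_linear_snd smooth_on_linear by blast+
  have chr: "smooth_on S (\<lambda>z. christoffel (g c) (fst z) k i j)" for k i j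
    by (rule smooth_on_compose[OF S open_ran[OF assms(1)] _ fst smooth_christoffel[OF assms(1)]])
      (auto simp: S_def)
  have "smooth_on S f"
    unfolding f_def[abs_def] E_def
    by (intro smooth_on_Pair smooth_on_vec_lambda smooth_on_minus smooth_on_sum smooth_on_mult
        smooth_on_vec_nth S snd chr)
  moreover have "(coord c p, v) \<in> S" using assms by (auto simp: S_def)
  ultimately obtain \<delta> z where \<delta>: "\<delta> > 0" and z0: "z 0 = (coord c p, v)"
    and zS: "\<And>t. t \<in> {-\<delta><..<\<delta>} \<Longrightarrow> z t \<in> S"
    and z': "\<And>t. t \<in> {-\<delta><..<\<delta>} \<Longrightarrow> (z has_vector_derivative f (z t)) (at t)"
    and zsm: "smooth_on {-\<delta><..<\<delta>} z"
    using smooth_ode_exists[OF S] by metis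
  define J where "J = {-\<delta><..<\<delta>}"
  define x y where "x = (\<lambda>t. fst (z t))" and "y = (\<lambda>t. snd (z t))"
  have J: "open J" "is_interval J" "0 \<in> J" using \<delta> by (auto simp: J_def is_interval_convex_1)
  have x': "(x has_vector_derivative y t) (at t)" if "t \<in> J" for t
    using bounded_linear.has_vector_derivative[OF bounded_linear_fst z'] that
    by (simp add: x_def y_def f_def J_def)
  have y': "(y has_vector_derivative E (x t) (y t)) (at t)" if "t \<in> J" for t
    using bounded_linear.has_vector_derivative[OF bounded_linear_snd z'] that
    by (simp add: x_def y_def f_def J_def)
  have xsm: "smooth_on J x"
    unfolding x_def by (rule smooth_on_linear_compose[OF J(1) bounded_linear_fst]) (use zsm J_def in auto)
  have xr: "x t \<in> chart_ran c" if "t \<in> J" for t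
    using zS that by (auto simp: x_def J_def S_def mem_Times_iff)
  define \<gamma> where "\<gamma> = param c \<circ> x"
  have sc: "smooth_curve_on A J \<gamma>"
    unfolding \<gamma>_def by (rule smooth_curve_param[OF assms(1) J(1) xsm]) (use xr in auto)
  have \<gamma>x: "coord c (\<gamma> t) = x t" "\<gamma> t \<in> chart_dom c" if "t \<in> J" for t
    using xr[OF that] coord_param[OF assms(1)] param_in_dom[OF assms(1)] by (auto simp: \<gamma>_def)
  have v1: "vderiv (coord c \<circ> \<gamma>) t = y t" if "t \<in> J" for t
    using vderiv_cong_open[OF J(1), of "coord c \<circ> \<gamma>" x t] \<gamma>x vderiv_eqI[OF x'] that by simp
  have v2: "vderiv (vderiv (coord c \<circ> \<gamma>)) t = E (x t) (y t)" if "t \<in> J" for t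
    using vderiv_cong_open[OF J(1), of "vderiv (coord c \<circ> \<gamma>)" y t] v1 vderiv_eqI[OF y'] that by simp
  have norm: "vderiv (vderiv (\<psi> \<circ> \<gamma>)) t \<in> normal_space N A \<psi> (\<gamma> t)" if "t \<in> J" for t
    unfolding geodesic_iff_normal[OF sc J(1) assms(1) that \<gamma>x(2)[OF that], symmetric]
    by (simp add: higher_vderiv_2 v1 v2 \<gamma>x that E_def)
  have "geodesic_on A g J \<gamma>"
    unfolding geodesic_on_def using sc geodesic_iff_normal[OF sc J(1)] norm by blast
  moreover have "initial_curve \<psi> p u J \<gamma>"
    unfolding \<gamma>_def by (rule initial_curve_param[OF assms J])
      (use x'[OF J(3)] z0 in \<open>auto simp: x_def y_def\<close>)
  ultimately show ?thesis by blast
qed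

lemma geodesic_from:
  assumes "c \<in> A" "p \<in> chart_dom c" "u = dpsi \<psi> c p v"
  obtains J where "initial_curve \<psi> p u J (geodesic_from A g \<psi> p u)"
    "geodesic_on A g J (geodesic_from A g \<psi> p u)"
  using someI_ex[OF geodesic_exists[OF assms]] unfolding geodesic_from_def by blast

text \<open>The parameter \<open>b\<close> and the open set \<open>U\<close> are left free so that
  geodesic and normal section can later be compared over the same domain and at the same parameter
  value.\<close>

lemma geodesic_second_order:
  assumes "geodesic_on A g J \<gamma>" "initial_curve \<psi> p u J \<gamma>" "c \<in> A" "p \<in> chart_dom c"
    and "u = dpsi \<psi> c p v" "open U" "coord c p \<in> U"
  shows "\<exists>I x y. 0 \<in> I \<and> x 0 = coord c p \<and> y 0 = v \<and>
    (\<forall>r. higher_vderiv r (\<psi> \<circ> \<gamma>) 0 = higher_vderiv r (\<lambda>t. (\<psi> \<circ> param c) (x t)) 0) \<and>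
    solves_second_order U (\<lambda>k b x y. - (\<Sum>i\<in>UNIV. \<Sum>j\<in>UNIV. christoffel (g c) x k i j * (y $ i * y $ j))) b x y I"
proof -
  have sc: "smooth_curve_on A J \<gamma>" using assms(1) by (simp add: geodesic_on_def)
  have J: "open J" "0 \<in> J" "\<gamma> 0 = p" using assms(2) by (auto simp: initial_curve_def)
  define x where "x = coord c \<circ> \<gamma>"
  define I0 where "I0 = {t \<in> J. \<gamma> t \<in> chart_dom c}"
  have I0: "open I0" "smooth_on I0 x"
    using smooth_curve_coord[OF sc J(1) assms(3)] by (auto simp: I0_def x_def)
  define I where "I = I0 \<inter> x -` U"
  have I: "open I" unfolding I_def
    using continuous_on_open_vimage[OF I0(1)] smooth_on_imp_continuous_on[OF I0(2)] assms(6)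
    by (metis Int_commute)
  have xsm: "smooth_on I x" by (rule smooth_on_subset[OF I0(2)]) (auto simp: I_def)
  have 0: "0 \<in> I" using J assms(4,7) by (auto simp: I_def I0_def x_def)
  note x' = smooth_on_vderiv[OF I xsm]
  have "vderiv (vderiv x) t = (\<chi> k. - (\<Sum>i\<in>UNIV. \<Sum>j\<in>UNIV. christoffel (g c) (x t) k i j *
      (vderiv x t $ i * vderiv x t $ j)))" if "t \<in> I" for t
  proof -
    have "t \<in> J" "\<gamma> t \<in> chart_dom c" using that by (auto simp: I_def I0_def)
    then have "higher_vderiv 2 x t $ k + (\<Sum>i\<in>UNIV. \<Sum>j\<in>UNIV. christoffel (g c) (x t) k i j *
      (vderiv x t $ i) * (vderiv x t $ j)) = 0" for k
      using assms(1,3) unfolding geodesic_on_def x_def by fastforce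
    then show ?thesis
      by (simp add: vec_eq_iff higher_vderiv_2 eq_neg_iff_add_eq_0 mult.assoc)
  qed
  then have "solves_second_order U (\<lambda>k b x y. - (\<Sum>i\<in>UNIV. \<Sum>j\<in>UNIV. christoffel (g c) x k i j *
      (y $ i * y $ j))) b x (vderiv x) I"
    using I x'(1) smooth_on_vderiv(1)[OF I x'(2)] by (auto simp: solves_second_order_def I_def)
  moreover have "higher_vderiv r (\<psi> \<circ> \<gamma>) 0 = higher_vderiv r (\<lambda>t. (\<psi> \<circ> param c) (x t)) 0" for r
    using curve_in_chart(3)[OF sc J(1) assms(3) J(2)] J(3) assms(4) by (simp add: x_def)
  moreover have "vderiv x 0 = v"
    unfolding x_def by (rule initial_velocity[OF assms(2) sc assms(3-5)])
  moreover have "x 0 = coord c p" using J(3) by (simp add: x_def)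
  ultimately show ?thesis using 0 by blast
qed

end

subsection \<open>Normal sections\<close>

lemma fibre_poly_part:
  assumes "open S" "smooth_on S F" "\<And>k. fibre_poly S d (\<lambda>b x y. w b x y $ k)"
  shows "fibre_poly S d (\<lambda>b x y. diff1 F x (w b x y) $ m)"
proof -
  have "smooth_on S (\<lambda>x. part k F x $ m)" for k
    by (rule smooth_on_vec_nth[OF assms(1) smooth_on_part[OF assms(2)]])
  then have "fibre_poly S d (\<lambda>b x y. \<Sum>k\<in>UNIV. part k F x $ m * w b x y $ k)"
    by (intro fibre_poly_sum fibre_poly_mult_base assms) auto
  then show ?thesis by (simp add: diff1_def mult.commute)
qed

lemma fibre_poly_velocity2: "fibre_poly S 2 (\<lambda>b x y. y $ i * y $ j)"
  using fibre_poly.mult[OF fibre_poly.velocity fibre_poly.velocity] by fastforce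

lemma fibre_poly_diff2:
  assumes "open S" "smooth_on S F"
  shows "fibre_poly S 2 (\<lambda>b x y. diff2 F x y $ m)"
proof -
  have "smooth_on S (\<lambda>x. part j (part i F) x $ m)" for i j
    by (intro smooth_on_vec_nth assms smooth_on_part)
  then have "fibre_poly S 2 (\<lambda>b x y. \<Sum>i\<in>UNIV. \<Sum>j\<in>UNIV. part j (part i F) x $ m * (y $ i * y $ j))"
    by (intro fibre_poly_sum fibre_poly_mult_base fibre_poly_velocity2) auto
  then show ?thesis by (simp add: diff2_def sum_distrib_left mult_ac)
qed

section \<open>The equation of the normal section at a point\<close>

locale immersed_point = immersed_manifold A s g N \<psi>
  for A :: "('m::{t2_space, second_countable_topology}, 'n::finite) chart set"
    and s g and N :: "'e::finite set" and \<psi> +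
  fixes c :: "('m, 'n) chart" and p :: 'm
  assumes c: "c \<in> A" and p: "p \<in> chart_dom c"
begin

definition F :: "real^'n \<Rightarrow> real^'e" where
  "F = \<psi> \<circ> param c"

definition x0 :: "real^'n" where
  "x0 = coord c p"

text \<open>The orthogonal projection to the tangent space at \<open>p\<close> in covariant
  components, that is, products with the coordinate frame at \<open>x0\<close>. Its kernel is the
  normal space.\<close>

definition tangential :: "real^'e \<Rightarrow> real^'n" where
  "tangential w = (\<chi> l. pseudo_inner N w (part l F x0))"

text \<open>The Jacobian matrix of \<open>tangential (F x - F x0)\<close>. It pairs the moving frame
  at \<open>x\<close> with the fixed frame at \<open>x0\<close>; at \<open>x0\<close> it is the
  metric, hence invertible nearby.\<close>

definition J\<^sub>T :: "real^'n \<Rightarrow> real^'n^'n" where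
  "J\<^sub>T x = (\<chi> l j. pseudo_inner N (part j F x) (part l F x0))"

definition U :: "(real^'n) set" where
  "U = {x \<in> chart_ran c. det (J\<^sub>T x) \<noteq> 0}"

text \<open>Over \<open>U\<close>, a curve with coordinate acceleration \<open>- K x y\<close> has
  no acceleration tangential to the fixed tangent space at \<open>p\<close>.\<close>

definition K :: "real^'n \<Rightarrow> real^'n \<Rightarrow> real^'n" where
  "K x y = matrix_inv (J\<^sub>T x) *v tangential (diff2 F x y)"

text \<open>The projected curve runs on a line, so the coordinate acceleration is \<mu> y - K with a
  scalar \<mu>. Orthogonality of the ambient acceleration to the velocity determines \<mu>, where
  \<open>b\<close> stands for the inverse of the squared length of the velocity.\<close>

definition section_spray :: "'n \<Rightarrow> real \<Rightarrow> real^'n \<Rightarrow> real^'n \<Rightarrow> real" where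
  "section_spray k b x y = - (b * pseudo_inner N (diff2 F x y - diff1 F x (K x y)) (diff1 F x y)) * y $ k - K x y $ k"

lemma smooth_F: "smooth_on (chart_ran c) F"
  unfolding F_def by (rule smooth_immersion[OF c])

lemma x0_ran: "x0 \<in> chart_ran c" and F_x0: "F x0 = \<psi> p"
  using p c by (auto simp: x0_def F_def param_coord)

lemma dpsi_eq: "dpsi \<psi> c p v = diff1 F x0 v"
  by (simp add: F_def x0_def dpsi_eq_diff1[OF c p])

lemma bounded_linear_tangential: "bounded_linear tangential"
  unfolding linear_conv_bounded_linear[symmetric] tangential_def[abs_def]
  by (rule linearI) (simp_all add: vec_eq_iff pseudo_inner.add_left pseudo_inner.scaleR_left)

interpretation tangential: bounded_linear tangential
  by (rule bounded_linear_tangential)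

lemma tangential_diff1: "tangential (diff1 F x w) = J\<^sub>T x *v w"
  by (simp add: tangential_def J\<^sub>T_def matrix_vector_mult_def diff1_def vec_eq_iff
      pseudo_inner.sum_left pseudo_inner.scaleR_left mult.commute)

lemma J\<^sub>T_x0: "J\<^sub>T x0 = g c x0"
  using metric_component[OF c x0_ran]
  by (simp add: J\<^sub>T_def F_def vec_eq_iff pseudo_inner_commute)

lemma smooth_J\<^sub>T: "smooth_on (chart_ran c) (\<lambda>x. J\<^sub>T x $ l $ j)"
  unfolding J\<^sub>T_def
  by (simp, intro smooth_on_pseudo_inner open_ran[OF c] smooth_on_const smooth_on_part smooth_F)

lemma open_U: "open U"
proof -
  have "continuous_on (chart_ran c) (\<lambda>x. det (J\<^sub>T x))"
    by (intro smooth_on_imp_continuous_on smooth_on_det open_ran[OF c] smooth_J\<^sub>T)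
  then have "open ((\<lambda>x. det (J\<^sub>T x)) -` (- {0}) \<inter> chart_ran c)"
    using continuous_on_open_vimage[OF open_ran[OF c]] by blast
  moreover have "U = (\<lambda>x. det (J\<^sub>T x)) -` (- {0}) \<inter> chart_ran c" by (auto simp: U_def)
  ultimately show ?thesis by simp
qed

lemma U_subset: "U \<subseteq> chart_ran c"
  by (auto simp: U_def)

lemma x0_U: "x0 \<in> U"
  using x0_ran det_metric[OF c x0_ran] by (simp add: U_def J\<^sub>T_x0)

lemma smooth_F_U: "smooth_on U F"
  by (rule smooth_on_subset[OF smooth_F U_subset])

lemma J\<^sub>T_inverse:
  assumes "x \<in> U"
  shows "matrix_inv (J\<^sub>T x) *v (J\<^sub>T x *v w) = w" "J\<^sub>T x *v (matrix_inv (J\<^sub>T x) *v w) = w"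
  using assms by (simp_all add: U_def matrix_vector_mul_assoc matrix_inv_inverse)

lemma fibre_poly_K: "fibre_poly U 2 (\<lambda>b x y. K x y $ k)"
proof -
  have 1: "smooth_on U (\<lambda>x. matrix_inv (J\<^sub>T x) $ k $ l)" for l
    by (intro smooth_on_matrix_inv open_U smooth_on_subset[OF smooth_J\<^sub>T U_subset]) (auto simp: U_def)
  have "fibre_poly U 2 (\<lambda>b x y. tangential (diff2 F x y) $ l)" for l
  proof -
    have "fibre_poly U 2 (\<lambda>b x y. \<Sum>m\<in>UNIV. ((if m \<in> N then -1 else 1) * part l F x0 $ m) * diff2 F x y $ m)"
      by (intro fibre_poly_sum fibre_poly_mult_base fibre_poly_diff2 smooth_on_const open_U smooth_F_U) auto
    then show ?thesis by (simp add: tangential_def pseudo_inner_def mult_ac)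
  qed
  then have "fibre_poly U 2 (\<lambda>b x y. \<Sum>l\<in>UNIV. matrix_inv (J\<^sub>T x) $ k $ l * tangential (diff2 F x y) $ l)"
    by (intro fibre_poly_sum fibre_poly_mult_base 1) auto
  then show ?thesis by (simp add: K_def matrix_vector_mult_def)
qed

lemma fibre_poly_section_spray: "fibre_poly U 2 (section_spray k)"
proof -
  have D1: "fibre_poly U 1 (\<lambda>b x y. diff1 F x y $ m)" for m
    by (rule fibre_poly_part[OF open_U smooth_F_U fibre_poly.velocity])
  have D2: "fibre_poly U 2 (\<lambda>b x y. diff1 F x (K x y) $ m)" for m
    by (rule fibre_poly_part[OF open_U smooth_F_U fibre_poly_K])
  have E: "fibre_poly U 2 (\<lambda>b x y. (diff2 F x y - diff1 F x (K x y)) $ m)" for m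
    using fibre_poly_diff[OF open_U fibre_poly_diff2[OF open_U smooth_F_U, of m] D2[of m]] by simp
  have "fibre_poly U (2 + 1) (\<lambda>b x y. \<Sum>m\<in>UNIV. (if m \<in> N then -1 else 1) *
      ((diff2 F x y - diff1 F x (K x y)) $ m * diff1 F x y $ m))"
    by (intro fibre_poly_sum fibre_poly_mult_base fibre_poly.mult D1 E smooth_on_const open_U) auto
  then have P: "fibre_poly U (2 + 1) (\<lambda>b x y. pseudo_inner N (diff2 F x y - diff1 F x (K x y)) (diff1 F x y))"
    by (simp add: pseudo_inner_def mult.assoc)
  \<comment> \<open>The parameter compensates two of the four powers of the velocity, so this spray
    has weight 2 like that of the geodesics.\<close>
  have "fibre_poly U (- 2 + (2 + 1) + 1) (\<lambda>b x y. b * pseudo_inner N (diff2 F x y - diff1 F x (K x y)) (diff1 F x y) * y $ k)"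
    by (intro fibre_poly.mult P fibre_poly.parameter fibre_poly.velocity)
  then have "fibre_poly U 2 (\<lambda>b x y. - (b * pseudo_inner N (diff2 F x y - diff1 F x (K x y)) (diff1 F x y) * y $ k) - K x y $ k)"
    using fibre_poly_diff[OF open_U fibre_poly_minus[OF open_U] fibre_poly_K] by simp
  then show ?thesis by (simp add: section_spray_def[abs_def])
qed

text \<open>The normal space is the kernel of \<open>tangential\<close>, so lying in the section
  space constrains the tangential components only, and confines them to one line.\<close>

lemma section_space_iff:
  "z \<in> section_space N A \<psi> p (diff1 F x0 v) \<longleftrightarrow>
    (\<exists>a. tangential (z - F x0) = a *\<^sub>R (J\<^sub>T x0 *v v))"
proof -
  have n: "w \<in> normal_space N A \<psi> p \<longleftrightarrow> tangential w = 0" for w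
  proof -
    have "w \<in> normal_space N A \<psi> p \<longleftrightarrow> (\<forall>v. pseudo_inner N w (diff1 F x0 v) = 0)"
      using normal_space_iff[OF c p] by (simp add: F_def x0_def)
    also have "\<dots> \<longleftrightarrow> tangential w = 0"
    proof
      assume "\<forall>v. pseudo_inner N w (diff1 F x0 v) = 0"
      then show "tangential w = 0" by (simp add: tangential_def vec_eq_iff) (metis diff1_axis)
    next
      assume "tangential w = 0"
      then show "\<forall>v. pseudo_inner N w (diff1 F x0 v) = 0"
        by (simp add: tangential_def vec_eq_iff diff1_def pseudo_inner.sum_right pseudo_inner.scaleR_right)
    qed
    finally show ?thesis .
  qed
  show ?thesis
  proof
    assume "z \<in> section_space N A \<psi> p (diff1 F x0 v)"
    then obtain a w where z: "z = \<psi> p + (a *\<^sub>R diff1 F x0 v + w)" "tangential w = 0"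
      using n by (auto simp: section_space_def)
    then have "z - F x0 = a *\<^sub>R diff1 F x0 v + w" by (simp add: F_x0)
    then have "tangential (z - F x0) = a *\<^sub>R (J\<^sub>T x0 *v v)"
      using z(2) by (simp add: tangential.add tangential.scaleR tangential_diff1)
    then show "\<exists>a. tangential (z - F x0) = a *\<^sub>R (J\<^sub>T x0 *v v)" ..
  next
    assume "\<exists>a. tangential (z - F x0) = a *\<^sub>R (J\<^sub>T x0 *v v)"
    then obtain a where a: "tangential (z - F x0) = a *\<^sub>R (J\<^sub>T x0 *v v)" ..
    have "tangential (z - F x0 - a *\<^sub>R diff1 F x0 v) = 0"
      by (simp add: tangential.diff[of "z - F x0"] tangential.scaleR tangential_diff1 a)
    moreover have "z = \<psi> p + (a *\<^sub>R diff1 F x0 v + (z - F x0 - a *\<^sub>R diff1 F x0 v))"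
      by (simp add: F_x0)
    ultimately show "z \<in> section_space N A \<psi> p (diff1 F x0 v)"
      unfolding section_space_def using n by blast
  qed
qed

text \<open>Projecting the section to the tangent space gives a curve on a line, so there the acceleration
  is a multiple of the velocity; constancy of the speed determines the factor.\<close>

lemma normal_section_second_order:
  assumes ns: "normal_section_on N A \<psi> p u J \<beta>" and u: "u = dpsi \<psi> c p v"
    and \<epsilon>: "pseudo_inner N u u = \<epsilon>" "\<epsilon> \<in> {1, -1}"
  shows "\<exists>I x y. 0 \<in> I \<and> x 0 = x0 \<and> y 0 = v \<and>
    (\<forall>r. higher_vderiv r (\<psi> \<circ> \<beta>) 0 = higher_vderiv r (\<lambda>t. F (x t)) 0) \<and>
    solves_second_order U section_spray \<epsilon> x y I"
proof -
  have ic: "initial_curve \<psi> p u J \<beta>" and sc: "smooth_curve_on A J \<beta>"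
    and speed: "\<And>t. t \<in> J \<Longrightarrow> pseudo_inner N (vderiv (\<psi> \<circ> \<beta>) t) (vderiv (\<psi> \<circ> \<beta>) t) = \<epsilon>"
    using ns \<epsilon> by (auto simp: normal_section_on_def)
  have J: "open J" "0 \<in> J" "\<beta> 0 = p" using ic by (auto simp: initial_curve_def)
  obtain W where "(\<psi> \<circ> \<beta>) ` J = connected_component_set (\<psi> ` W \<inter> section_space N A \<psi> p u) (\<psi> p)"
    using ns by (auto simp: normal_section_on_def)
  then have sec: "\<psi> (\<beta> t) \<in> section_space N A \<psi> p u" if "t \<in> J" for t
    using connected_component_subset that by fastforce
  define x where "x = coord c \<circ> \<beta>"
  define y where "y = vderiv x"
  define b where "b = J\<^sub>T x0 *v v"
  \<comment> \<open>The Euclidean projection of component vectors onto the line of \<open>b\<close>.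
    Being linear it commutes with differentiation, so \<open>P (w t) = w t\<close> passes on to the
    first and second derivatives of \<open>w\<close>.\<close>
  define P where "P w = ((w \<bullet> b) / (b \<bullet> b)) *\<^sub>R b" for w
  have P: "bounded_linear P" unfolding P_def[abs_def]
    by (intro bounded_linear_compose[OF bounded_linear_scaleR_left]
        bounded_linear_compose[OF bounded_linear_divide] bounded_linear_inner_left)
  define I0 where "I0 = {t \<in> J. \<beta> t \<in> chart_dom c}"
  have I0: "open I0" "smooth_on I0 x"
    using smooth_curve_coord[OF sc J(1) c] by (auto simp: I0_def x_def)
  define I1 where "I1 = I0 \<inter> x -` U"
  have I1: "open I1" unfolding I1_def
    using continuous_on_open_vimage[OF I0(1)] smooth_on_imp_continuous_on[OF I0(2)] open_U
    by (metis Int_commute)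
  have xsm: "smooth_on I1 x" by (rule smooth_on_subset[OF I0(2)]) (auto simp: I1_def)
  have ysm: "smooth_on I1 y" unfolding y_def by (rule smooth_on_vderiv(2)[OF I1 xsm])
  have xU: "x t \<in> U" if "t \<in> I1" for t using that by (auto simp: I1_def)
  have x': "(x has_vector_derivative y t) (at t)" if "t \<in> I1" for t
    unfolding y_def using smooth_on_vderiv(1)[OF I1 xsm that] .
  have y': "(y has_vector_derivative vderiv y t) (at t)" if "t \<in> I1" for t
    using smooth_on_vderiv(1)[OF I1 ysm that] .
  have 0: "0 \<in> I1" "x 0 = x0" "y 0 = v"
    using J p x0_U initial_velocity[OF ic sc c p u] by (auto simp: I1_def I0_def x_def y_def x0_def)
  have D: "((\<lambda>t. diff1 F (x t) (y t)) has_vector_derivative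
      diff2 F (x t) (y t) + diff1 F (x t) (vderiv y t)) (at t)" if "t \<in> I1" for t
    by (rule has_vector_derivative_diff1[OF smooth_F_U xU x' y']) (rule that)+
  define w where "w t = tangential (F (x t) - F x0)" for t
  have w': "(w has_vector_derivative tangential (diff1 F (x t) (y t))) (at t)" if "t \<in> I1" for t
  proof -
    have "((\<lambda>t. F (x t) - F x0) has_vector_derivative diff1 F (x t) (y t) - 0) (at t)"
      by (intro has_vector_derivative_diff has_vector_derivative_const
          has_vector_derivative_compose_diff1[OF smooth_F_U xU x']) (rule that)+
    then show ?thesis
      unfolding w_def[abs_def] using tangential.has_vector_derivative by fastforce
  qed
  have v0: "v \<noteq> 0"
  proof
    assume "v = 0"
    then have "u = 0" using u by (simp add: dpsi_eq diff1_def)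
    then show False using \<epsilon> by (auto simp: pseudo_inner.zero_left)
  qed
  then have b0: "b \<noteq> 0" unfolding b_def using J\<^sub>T_inverse(1)[OF x0_U, of v] by auto
  have wP: "P (w t) = w t" if "t \<in> I1" for t
  proof -
    have t: "t \<in> J" "\<beta> t \<in> chart_dom c" using that by (auto simp: I1_def I0_def)
    then have "F (x t) \<in> section_space N A \<psi> p (diff1 F x0 v)"
      using sec u by (simp add: F_def x_def param_coord[OF c] dpsi_eq[unfolded F_def])
    then obtain a where "w t = a *\<^sub>R b" unfolding section_space_iff by (auto simp: w_def b_def)
    then show ?thesis using b0 by (simp add: P_def)
  qed
  have wP1: "P (tangential (diff1 F (x t) (y t))) = tangential (diff1 F (x t) (y t))" if "t \<in> I1" for t
  proof -
    have "((\<lambda>t. P (w t)) has_vector_derivative P (tangential (diff1 F (x t) (y t)))) (at t)"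
      by (rule bounded_linear.has_vector_derivative[OF P w'[OF that]])
    then have "(w has_vector_derivative P (tangential (diff1 F (x t) (y t)))) (at t)"
      by (rule has_vector_derivative_transform_within_open[OF _ I1 that]) (rule wP)
    then show ?thesis using vector_derivative_unique_at w'[OF that] by blast
  qed
  have wP2: "P (tangential (diff2 F (x t) (y t) + diff1 F (x t) (vderiv y t))) =
      tangential (diff2 F (x t) (y t) + diff1 F (x t) (vderiv y t))" if "t \<in> I1" for t
  proof -
    note TD = bounded_linear.has_vector_derivative[OF bounded_linear_tangential D[OF that]]
    have "((\<lambda>t. P (tangential (diff1 F (x t) (y t)))) has_vector_derivative
        P (tangential (diff2 F (x t) (y t) + diff1 F (x t) (vderiv y t)))) (at t)"
      by (rule bounded_linear.has_vector_derivative[OF P TD])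
    then have "((\<lambda>t. tangential (diff1 F (x t) (y t))) has_vector_derivative
        P (tangential (diff2 F (x t) (y t) + diff1 F (x t) (vderiv y t)))) (at t)"
      by (rule has_vector_derivative_transform_within_open[OF _ I1 that]) (rule wP1)
    then show ?thesis using vector_derivative_unique_at TD by blast
  qed
  \<comment> \<open>The component along \<open>b\<close> of the tangential velocity, up to the
    factor \<open>b \<bullet> b\<close>. At time 0 that velocity is \<open>b\<close> itself, so by
    continuity one may divide by \<tau> on a neighbourhood of 0.\<close>
  define \<tau> where "\<tau> t = tangential (diff1 F (x t) (y t)) \<bullet> b" for t
  define I where "I = I1 \<inter> \<tau> -` (- {0})"
  have "continuous_on I1 (\<lambda>t. diff1 F (x t) (y t))"
    using D has_vector_derivative_continuous by (blast intro: continuous_at_imp_continuous_on)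
  then have "continuous_on I1 \<tau>"
    unfolding \<tau>_def[abs_def]
    by (intro continuous_intros bounded_linear.continuous_on[OF bounded_linear_tangential])
  then have I: "open I" unfolding I_def using continuous_on_open_vimage[OF I1]
    by (metis Int_commute open_Compl closed_singleton)
  have 0: "0 \<in> I" "x 0 = x0" "y 0 = v"
    using 0 b0 by (auto simp: I_def \<tau>_def tangential_diff1 b_def)
  have acc: "vderiv y t = (\<chi> k. section_spray k \<epsilon> (x t) (y t))" if "t \<in> I" for t
  proof -
    have t: "t \<in> I1" "\<tau> t \<noteq> 0" using that by (auto simp: I_def)
    define a where "a = vderiv y t"
    \<comment> \<open>Tangential acceleration and tangential velocity both lie on the line of
      \<open>b\<close>; \<mu> is their ratio.\<close>
    define \<mu> where "\<mu> = (tangential (diff2 F (x t) (y t) + diff1 F (x t) a) \<bullet> b) / \<tau> t"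
    have "tangential (diff2 F (x t) (y t)) + J\<^sub>T (x t) *v a =
        ((tangential (diff2 F (x t) (y t) + diff1 F (x t) a) \<bullet> b) / (b \<bullet> b)) *\<^sub>R b"
      using wP2[OF t(1)] by (simp add: P_def a_def tangential.add tangential_diff1)
    also have "\<dots> = \<mu> *\<^sub>R P (tangential (diff1 F (x t) (y t)))"
      using t(2) by (simp add: \<mu>_def P_def \<tau>_def)
    also have "\<dots> = \<mu> *\<^sub>R (J\<^sub>T (x t) *v y t)" by (simp add: wP1[OF t(1), unfolded tangential_diff1] tangential_diff1)
    finally have "matrix_inv (J\<^sub>T (x t)) *v (tangential (diff2 F (x t) (y t)) + J\<^sub>T (x t) *v a) =
        matrix_inv (J\<^sub>T (x t)) *v (\<mu> *\<^sub>R (J\<^sub>T (x t) *v y t))" by simp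
    then have "K (x t) (y t) + a = \<mu> *\<^sub>R y t"
      by (simp add: matrix_vector_right_distrib matrix_vector_mult_scaleR J\<^sub>T_inverse[OF xU[OF t(1)]] K_def)
    then have a: "a = \<mu> *\<^sub>R y t - K (x t) (y t)" by (simp add: algebra_simps)
    have sp: "pseudo_inner N (diff1 F (x t) (y t)) (diff1 F (x t) (y t)) = \<epsilon>" if "t \<in> I1" for t
      using speed[of t] curve_in_chart(1)[OF sc J(1) c, of t] that
      by (simp add: I1_def I0_def F_def x_def y_def)
    \<comment> \<open>\<open>E\<close> is the ambient acceleration. Differentiating the constant
      squared speed shows that it is orthogonal to the velocity.\<close>
    define E where "E = diff2 F (x t) (y t) + diff1 F (x t) a"
    have "((\<lambda>t. pseudo_inner N (diff1 F (x t) (y t)) (diff1 F (x t) (y t))) has_vector_derivative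
       pseudo_inner N (diff1 F (x t) (y t)) E + pseudo_inner N E (diff1 F (x t) (y t))) (at t)"
      unfolding E_def a_def
      by (rule bounded_bilinear.has_vector_derivative[OF bounded_bilinear_pseudo_inner D[OF t(1)] D[OF t(1)]])
    then have "((\<lambda>t. \<epsilon>) has_vector_derivative
       pseudo_inner N (diff1 F (x t) (y t)) E + pseudo_inner N E (diff1 F (x t) (y t))) (at t)"
      by (rule has_vector_derivative_transform_within_open[OF _ I1 t(1)]) (rule sp)
    then have "pseudo_inner N (diff1 F (x t) (y t)) E + pseudo_inner N E (diff1 F (x t) (y t)) = 0"
      using vector_derivative_unique_at has_vector_derivative_const by blast
    then have "pseudo_inner N E (diff1 F (x t) (y t)) = 0"
      by (simp add: pseudo_inner_commute[of N "diff1 F (x t) (y t)" E])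
    moreover have "E = (diff2 F (x t) (y t) - diff1 F (x t) (K (x t) (y t))) + \<mu> *\<^sub>R diff1 F (x t) (y t)"
      by (simp add: E_def a diff1_diff diff1_scaleR)
    ultimately have "pseudo_inner N (diff2 F (x t) (y t) - diff1 F (x t) (K (x t) (y t))) (diff1 F (x t) (y t))
        + \<mu> * \<epsilon> = 0"
      by (simp add: pseudo_inner.add_left pseudo_inner.scaleR_left sp[OF t(1)])
    \<comment> \<open>The squared length \<epsilon> is its own inverse, so dividing by it puts
      \<epsilon> in the place of the parameter \<open>b\<close> of the spray.\<close>
    then have "\<mu> = - (\<epsilon> * pseudo_inner N (diff2 F (x t) (y t) - diff1 F (x t) (K (x t) (y t))) (diff1 F (x t) (y t)))"
      using \<epsilon>(2) by auto
    then show ?thesis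
      unfolding a_def[symmetric] by (simp add: a vec_eq_iff section_spray_def)
  qed
  have "solves_second_order U section_spray \<epsilon> x y I"
    unfolding solves_second_order_def
  proof (intro conjI ballI I)
    fix t assume t: "t \<in> I"
    then have t1: "t \<in> I1" by (simp add: I_def)
    show "x t \<in> U" by (rule xU[OF t1])
    show "(x has_vector_derivative y t) (at t)" by (rule x'[OF t1])
    show "(y has_vector_derivative (\<chi> k. section_spray k \<epsilon> (x t) (y t))) (at t)"
      using y'[OF t1] acc[OF t] by simp
  qed
  moreover have "higher_vderiv r (\<psi> \<circ> \<beta>) 0 = higher_vderiv r (\<lambda>t. F (x t)) 0" for r
    using curve_in_chart(3)[OF sc J(1) c J(2)] J(3) p by (simp add: x_def F_def)
  ultimately show ?thesis using 0 by blast
qed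

section \<open>Existence of normal sections\<close>

lemma tangential_local_homeo:
  assumes "open S" "S \<subseteq> U" "x0 \<in> S"
  obtains O' V h where "open O'" "O' \<subseteq> S" "x0 \<in> O'" "open V" "0 \<in> V"
    "homeomorphism O' V (\<lambda>x. tangential (F x - F x0)) h"
proof -
  \<comment> \<open>\<open>Y\<close> projects the immersed manifold to the tangent space at
    \<open>p\<close>. Its Jacobian \<open>J\<^sub>T\<close> is invertible at \<open>x0\<close>, so
    \<open>Y\<close> is a local homeomorphism; this will supply the inverse of \<psi> and turn the
    section into a piece of a line.\<close>
  define Y where "Y x = tangential (F x - F x0)" for x
  define Y' where "Y' x = Blinfun ((*v) (J\<^sub>T x))" for x
  have Y': "blinfun_apply (Y' x) = (*v) (J\<^sub>T x)" for x
    unfolding Y'_def by (rule bounded_linear_Blinfun_apply) (rule matrix_vector_mul_bounded_linear)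
  have der: "(Y has_derivative blinfun_apply (Y' x)) (at x)" if "x \<in> S" for x
  proof -
    have "x \<in> U" using that assms by blast
    then have "((\<lambda>x. F x - F x0) has_derivative (\<lambda>w. diff1 F x w - 0)) (at x)"
      by (intro has_derivative_diff has_derivative_const smooth_on_has_diff1[OF smooth_F_U])
    then have "(Y has_derivative (\<lambda>w. tangential (diff1 F x w))) (at x)"
      unfolding Y_def[abs_def] using tangential.has_derivative by fastforce
    then show ?thesis by (simp add: tangential_diff1 Y')
  qed
  have "continuous_on S Y'"
  proof (rule continuous_on_blinfun_componentwise)
    fix w :: "real^'n"
    have "smooth_on U (\<lambda>x. \<chi> l. \<Sum>j\<in>UNIV. J\<^sub>T x $ l $ j * w $ j)"
      by (intro smooth_on_vec_lambda smooth_on_sum smooth_on_mult smooth_on_const open_U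
          smooth_on_subset[OF smooth_J\<^sub>T U_subset])
    then show "continuous_on S (\<lambda>x. blinfun_apply (Y' x) w)"
      unfolding Y' matrix_vector_mult_def
      using smooth_on_imp_continuous_on continuous_on_subset assms(2) by blast
  qed
  moreover have "Blinfun ((*v) (matrix_inv (J\<^sub>T x0))) o\<^sub>L Y' x0 = id_blinfun"
    by (rule blinfun_eqI)
      (simp add: Y' bounded_linear_Blinfun_apply[OF matrix_vector_mul_bounded_linear] J\<^sub>T_inverse[OF x0_U])
  ultimately obtain O' V h where "open O'" "O' \<subseteq> S" "x0 \<in> O'" "open V" "Y x0 \<in> V" "homeomorphism O' V Y h"
    using inverse_function_theorem[OF assms(1) der _ assms(3)] by metis
  moreover have "Y x0 = 0" by (simp add: Y_def tangential.zero)
  ultimately show ?thesis using that unfolding Y_def[abs_def] by metis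
qed

text \<open>The section is the flow line of the unit vector field whose tangential projection is a positive
  multiple of that of the initial vector.\<close>

lemma section_curve_exists:
  assumes "pseudo_inner N (diff1 F x0 v) (diff1 F x0 v) = \<epsilon>" "\<epsilon> \<in> {1, -1}" "open S" "S \<subseteq> U" "x0 \<in> S"
  obtains \<delta> x \<tau> where "\<delta> > 0" "x 0 = x0" "(x has_vector_derivative v) (at 0)"
    "smooth_on {-\<delta><..<\<delta>} x" "x ` {-\<delta><..<\<delta>} \<subseteq> S" "\<tau> 0 = 0" "continuous_on {-\<delta><..<\<delta>} \<tau>"
    "inj_on \<tau> {-\<delta><..<\<delta>}"
    "\<And>t. t \<in> {-\<delta><..<\<delta>} \<Longrightarrow> tangential (F (x t) - F x0) = \<tau> t *\<^sub>R (J\<^sub>T x0 *v v)"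
    "\<And>t. t \<in> {-\<delta><..<\<delta>} \<Longrightarrow>
      pseudo_inner N (diff1 F (x t) (vderiv x t)) (diff1 F (x t) (vderiv x t)) = \<epsilon>"
proof -
  define b where "b = J\<^sub>T x0 *v v"
  \<comment> \<open>The vector field whose tangential projection is constantly \<open>b\<close>. Its
    squared length \<open>q\<close> equals \<epsilon> at \<open>x0\<close>.\<close>
  define e where "e x = matrix_inv (J\<^sub>T x) *v b" for x
  define q where "q x = pseudo_inner N (diff1 F x (e x)) (diff1 F x (e x))" for x
  have e_smooth: "smooth_on U e"
    unfolding e_def[abs_def]
    by (intro smooth_on_solve open_U smooth_on_subset[OF smooth_J\<^sub>T U_subset] smooth_on_const)
      (simp add: U_def)
  have q_smooth: "smooth_on U q"
    unfolding q_def[abs_def]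
    by (intro smooth_on_pseudo_inner smooth_on_diff1 open_U smooth_F_U e_smooth)
  have e0: "e x0 = v" by (simp add: e_def b_def J\<^sub>T_inverse[OF x0_U])
  have q0: "q x0 = \<epsilon>" using assms(1) by (simp add: q_def e0)
  have \<epsilon>2: "\<epsilon> * \<epsilon> = 1" using assms(2) by auto
  \<comment> \<open>On the set where \<open>q\<close> keeps the sign of \<epsilon>, the field can be
    rescaled to squared length \<epsilon>.\<close>
  define S1 where "S1 = S \<inter> (\<lambda>x. \<epsilon> * q x) -` {0<..}"
  have "continuous_on S (\<lambda>x. \<epsilon> * q x)"
    using smooth_on_imp_continuous_on[OF q_smooth] assms(4) continuous_on_subset
    by (intro continuous_intros) blast
  then have S1: "open S1"
    unfolding S1_def using continuous_on_open_vimage[OF assms(3)] by (metis Int_commute open_greaterThan)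
  have S1U: "S1 \<subseteq> U" using assms(4) by (auto simp: S1_def)
  have x0S1: "x0 \<in> S1" using assms(5) by (simp add: S1_def q0 \<epsilon>2)
  have pos: "\<epsilon> / q x > 0" if "x \<in> S1" for x
    using that by (auto simp: S1_def zero_less_mult_iff zero_less_divide_iff)
  have q_nz: "q x \<noteq> 0" if "x \<in> S1" for x using that by (auto simp: S1_def)
  define f where "f x = sqrt (\<epsilon> / q x) *\<^sub>R e x" for x
  have "smooth_on S1 f"
    unfolding f_def[abs_def]
    by (intro smooth_on_scaleR smooth_on_sqrt smooth_on_divide smooth_on_const S1 pos q_nz
        smooth_on_subset[OF e_smooth S1U] smooth_on_subset[OF q_smooth S1U])
  then obtain \<delta> x where \<delta>: "\<delta> > 0" and x0': "x 0 = x0"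
    and xS1: "\<And>t. t \<in> {-\<delta><..<\<delta>} \<Longrightarrow> x t \<in> S1"
    and x': "\<And>t. t \<in> {-\<delta><..<\<delta>} \<Longrightarrow> (x has_vector_derivative f (x t)) (at t)"
    and xsm: "smooth_on {-\<delta><..<\<delta>} x"
    using smooth_ode_exists[OF S1 _ x0S1] by metis
  define I where "I = {-\<delta><..<\<delta>}"
  note xS1 = xS1[folded I_def] and x' = x'[folded I_def] and xsm = xsm[folded I_def]
  have I: "open I" "0 \<in> I" "convex I" "connected I" using \<delta> by (auto simp: I_def)
  have xU: "x t \<in> U" if "t \<in> I" for t using xS1[OF that] S1U by blast
  define w where "w t = tangential (F (x t) - F x0)" for t
  have w': "(w has_vector_derivative sqrt (\<epsilon> / q (x t)) *\<^sub>R b) (at t)" if "t \<in> I" for t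
  proof -
    have "((\<lambda>t. F (x t) - F x0) has_vector_derivative diff1 F (x t) (f (x t)) - 0) (at t)"
      by (intro has_vector_derivative_diff has_vector_derivative_const
          has_vector_derivative_compose_diff1[OF smooth_F_U xU x']) (rule that)+
    then have "(w has_vector_derivative tangential (diff1 F (x t) (f (x t)))) (at t)"
      unfolding w_def[abs_def] using tangential.has_vector_derivative by fastforce
    then show ?thesis
      by (simp add: tangential_diff1 f_def matrix_vector_mult_scaleR e_def J\<^sub>T_inverse[OF xU[OF that]])
  qed
  have b0: "b \<noteq> 0"
  proof
    assume "b = 0"
    then have "v = 0" unfolding b_def using J\<^sub>T_inverse(1)[OF x0_U, of v] by simp
    then have "\<epsilon> = 0" using assms(1) by (simp add: diff1_def pseudo_inner.zero_left)
    with assms(2) show False by auto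
  qed
  \<comment> \<open>The coordinate along \<open>b\<close>. Its derivative is the positive rescaling
    factor, so it is strictly increasing and hence injective.\<close>
  define \<tau> where "\<tau> t = (w t \<bullet> b) / (b \<bullet> b)" for t
  have \<tau>': "(\<tau> has_real_derivative sqrt (\<epsilon> / q (x t))) (at t)" if "t \<in> I" for t
  proof -
    have "bounded_linear (\<lambda>w. (w \<bullet> b) / (b \<bullet> b))"
      by (intro bounded_linear_compose[OF bounded_linear_divide] bounded_linear_inner_left)
    from bounded_linear.has_vector_derivative[OF this w'[OF that]] show ?thesis
      using b0 by (simp add: \<tau>_def[abs_def] has_real_derivative_iff_has_vector_derivative)
  qed
  \<comment> \<open>The derivative of \<open>w\<close> is always a multiple of \<open>b\<close>, so
    the part of \<open>w\<close> off the line is constant, and it is 0 at time 0.\<close>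
  have w\<tau>: "w t = \<tau> t *\<^sub>R b" if "t \<in> I" for t
  proof -
    have "((\<lambda>t. w t - \<tau> t *\<^sub>R b) has_vector_derivative 0) (at t within I)" if "t \<in> I" for t
    proof -
      have "((\<lambda>t. \<tau> t *\<^sub>R b) has_vector_derivative \<tau> t *\<^sub>R 0 + sqrt (\<epsilon> / q (x t)) *\<^sub>R b) (at t)"
        by (intro has_vector_derivative_scaleR \<tau>' that has_vector_derivative_const)
      from has_vector_derivative_diff[OF w'[OF that] this] show ?thesis
        by (simp add: has_vector_derivative_at_within)
    qed
    then obtain d where d: "\<And>t. t \<in> I \<Longrightarrow> w t - \<tau> t *\<^sub>R b = d"
      using has_vector_derivative_zero_constant[OF I(3)] by blast
    have "w 0 = 0" by (simp add: w_def x0' tangential.zero)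
    then have "d = 0" using d[OF I(2)] by (simp add: \<tau>_def)
    then show ?thesis using d[OF that] by simp
  qed
  have mono: "\<tau> s < \<tau> t" if "s \<in> I" "t \<in> I" "s < t" for s t
  proof (rule DERIV_pos_imp_increasing[OF that(3)])
    fix r assume "s \<le> r" "r \<le> t"
    then have "r \<in> I" using that by (auto simp: I_def)
    then show "\<exists>y. (\<tau> has_real_derivative y) (at r) \<and> y > 0"
      using \<tau>' pos[OF xS1] by (metis real_sqrt_gt_zero)
  qed
  show ?thesis
  proof (rule that[of \<delta> x \<tau>, folded I_def])
    show "inj_on \<tau> I" by (rule inj_onI) (metis mono less_irrefl linorder_less_linear)
    show "continuous_on I \<tau>"
      using \<tau>' DERIV_isCont by (blast intro: continuous_at_imp_continuous_on)
    show "x ` I \<subseteq> S" using xS1 by (auto simp: S1_def)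
    show "\<tau> 0 = 0" by (simp add: \<tau>_def w_def x0' tangential.zero)
    show "(x has_vector_derivative v) (at 0)"
      using x'[OF I(2)] assms(2) by (auto simp: x0' f_def q0 e0)
    fix t assume t: "t \<in> I"
    show "tangential (F (x t) - F x0) = \<tau> t *\<^sub>R (J\<^sub>T x0 *v v)"
      using w\<tau>[OF t] by (simp add: w_def b_def)
    have "pseudo_inner N (diff1 F (x t) (f (x t))) (diff1 F (x t) (f (x t))) =
        sqrt (\<epsilon> / q (x t)) * (sqrt (\<epsilon> / q (x t)) * q (x t))"
      by (simp only: f_def diff1_scaleR pseudo_inner.scaleR_left pseudo_inner.scaleR_right q_def
          real_scaleR_def)
    also have "\<dots> = (sqrt (\<epsilon> / q (x t)))\<^sup>2 * q (x t)"
      by (simp only: power2_eq_square mult.assoc)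
    also have "\<dots> = \<epsilon>" using pos[OF xS1[OF t]] q_nz[OF xS1[OF t]] by simp
    finally show "pseudo_inner N (diff1 F (x t) (vderiv x t)) (diff1 F (x t) (vderiv x t)) = \<epsilon>"
      by (simp add: vderiv_eqI[OF x'[OF t]])
  qed (use \<delta> x0' xsm in auto)
qed

text \<open>The curve comes from \<open>section_curve_exists\<close>. What remains is to choose
  \<open>W\<close> so small that \<psi> embeds it and its image meets the section space in exactly
  this curve.\<close>

lemma normal_section_exists:
  assumes u: "u = dpsi \<psi> c p v" and \<epsilon>: "pseudo_inner N u u = \<epsilon>" "\<epsilon> \<in> {1, -1}"
  shows "\<exists>\<beta> J. normal_section_on N A \<psi> p u J \<beta>"
proof -
  define Y where "Y x = tangential (F x - F x0)" for x
  define b where "b = J\<^sub>T x0 *v v"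
  obtain O' V h where O': "open O'" "O' \<subseteq> U" "x0 \<in> O'" and V: "open V" "0 \<in> V"
    and hom: "homeomorphism O' V Y h"
    using tangential_local_homeo[OF open_U order_refl x0_U] unfolding Y_def[abs_def] by metis
  obtain \<delta> x \<tau> where \<delta>: "\<delta> > 0" and x: "x 0 = x0" "(x has_vector_derivative v) (at 0)"
    "smooth_on {-\<delta><..<\<delta>} x" "x ` {-\<delta><..<\<delta>} \<subseteq> O'"
    and \<tau>: "\<tau> 0 = 0" "continuous_on {-\<delta><..<\<delta>} \<tau>" "inj_on \<tau> {-\<delta><..<\<delta>}"
    and Yx: "\<And>t. t \<in> {-\<delta><..<\<delta>} \<Longrightarrow> Y (x t) = \<tau> t *\<^sub>R b"
    and speed: "\<And>t. t \<in> {-\<delta><..<\<delta>} \<Longrightarrow>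
      pseudo_inner N (diff1 F (x t) (vderiv x t)) (diff1 F (x t) (vderiv x t)) = \<epsilon>"
    using section_curve_exists[of v \<epsilon> O'] \<epsilon> O' u unfolding Y_def b_def dpsi_eq by metis
  define J where "J = {-\<delta><..<\<delta>}"
  note x = x[folded J_def] and \<tau> = \<tau>[folded J_def] and Yx = Yx[folded J_def] and speed = speed[folded J_def]
  have J: "open J" "is_interval J" "0 \<in> J" "connected J"
    using \<delta> by (auto simp: J_def is_interval_convex_1)
  have b0: "b \<noteq> 0"
  proof
    assume "b = 0"
    then have "v = 0" unfolding b_def using J\<^sub>T_inverse(1)[OF x0_U, of v] by simp
    then have "\<epsilon> = 0" using \<epsilon>(1) by (simp add: u dpsi_eq diff1_def pseudo_inner.zero_left)
    with \<epsilon>(2) show False by auto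
  qed
  \<comment> \<open>By invariance of domain the injective continuous \<tau> has an open image, and
    therefore \<open>O1\<close> and \<open>W\<close> will be open.\<close>
  define T where "T = \<tau> ` J"
  have T: "open T" unfolding T_def by (rule invariance_of_domain[OF \<tau>(2) J(1) \<tau>(3)])
  \<comment> \<open>This cuts off points whose coordinate along \<open>b\<close> the curve does not
    reach; otherwise the section inside \<open>W\<close> could extend beyond the ends of the
    curve.\<close>
  define O1 where "O1 = {y \<in> O'. (Y y \<bullet> b) / (b \<bullet> b) \<in> T}"
  have "continuous_on O' (\<lambda>y. (Y y \<bullet> b) / (b \<bullet> b))"
    using hom b0 by (intro continuous_intros) (auto simp: homeomorphism_def)
  then have "open (O' \<inter> (\<lambda>y. (Y y \<bullet> b) / (b \<bullet> b)) -` T)"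
    using T O'(1) continuous_on_open_vimage by (metis Int_commute)
  then have O1: "open O1" by (simp add: O1_def vimage_def Collect_conj_eq)
  have O1_ran: "O1 \<subseteq> chart_ran c" using O' U_subset by (auto simp: O1_def)
  define W where "W = param c ` O1"
  have "openin (top_of_set (chart_dom c)) W"
    unfolding W_def
    by (rule homeomorphism_imp_open_map[OF homeomorphism_symD[OF chart_homeo[OF c]]])
      (use O1 O1_ran open_ran[OF c] in \<open>simp add: openin_open_eq\<close>)
  then have W: "open W" using openin_open_eq open_dom[OF c] by blast
  have W_dom: "W \<subseteq> chart_dom c" unfolding W_def using O1_ran param_in_dom[OF c] by blast
  have xO1: "x t \<in> O1" if "t \<in> J" for t
    using x(4) Yx[OF that] that b0 by (auto simp: O1_def T_def)
  define \<beta> where "\<beta> = param c \<circ> x"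
  have \<psi>\<beta>: "\<psi> (\<beta> t) = F (x t)" for t by (simp add: \<beta>_def F_def)
  have pW: "p \<in> W"
    unfolding W_def using xO1[OF J(3)] param_coord[OF c p] by (metis image_eqI x(1) x0_def)
  have sc: "smooth_curve_on A J \<beta>"
    unfolding \<beta>_def by (rule smooth_curve_param[OF c J(1) x(3)]) (use xO1 O1_ran in auto)
  have ic: "initial_curve \<psi> p u J \<beta>"
    unfolding \<beta>_def by (rule initial_curve_param[OF c p u J(1-3) _ x(2)]) (simp add: x(1) x0_def)
  have coord_\<beta>: "coord c (\<beta> t) = x t" "\<beta> t \<in> chart_dom c" if "t \<in> J" for t
    using xO1[OF that] O1_ran coord_param[OF c] param_in_dom[OF c] by (auto simp: \<beta>_def)
  have sp: "pseudo_inner N (vderiv (\<psi> \<circ> \<beta>) t) (vderiv (\<psi> \<circ> \<beta>) t) = pseudo_inner N u u" if "t \<in> J" for t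
  proof -
    have "vderiv (coord c \<circ> \<beta>) t = vderiv x t"
      by (rule vderiv_cong_open[OF J(1) _ that]) (simp add: coord_\<beta>)
    then show ?thesis
      using curve_in_chart(1)[OF sc J(1) c that coord_\<beta>(2)[OF that]] speed[OF that] \<epsilon>(1) coord_\<beta>(1)[OF that]
      by (simp add: F_def)
  qed
  have \<psi>_W: "tangential (\<psi> q - F x0) = Y (coord c q)" if "q \<in> W" for q
    using that W_dom param_coord[OF c] by (auto simp: Y_def F_def)
  have coord_W: "coord c q \<in> O1" if "q \<in> W" for q
    using that O1_ran coord_param[OF c] by (auto simp: W_def)
  \<comment> \<open>The inverse of \<psi> on \<open>W\<close>: project to the tangent space, invert
    the projection in coordinates, and return to the manifold.\<close>
  define k where "k z = param c (h (tangential (z - F x0)))" for z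
  have k: "k (\<psi> q) = q" if "q \<in> W" for q
    using that \<psi>_W[OF that] coord_W[OF that] homeomorphism_apply1[OF hom] param_coord[OF c] W_dom
    by (auto simp: k_def O1_def)
  have homW: "homeomorphism W (\<psi> ` W) \<psi> k"
  proof (rule homeomorphismI)
    show "continuous_on W \<psi>"
    proof -
      have "continuous_on W (coord c)"
        using chart_homeo[OF c] W_dom continuous_on_subset by (auto simp: homeomorphism_def)
      then have "continuous_on W (\<lambda>q. F (coord c q))"
        by (rule continuous_on_compose2[OF smooth_on_imp_continuous_on[OF smooth_F]]) (use W_dom in auto)
      then show ?thesis
        by (rule continuous_on_eq) (use W_dom param_coord[OF c] in \<open>auto simp: F_def\<close>)
    qed
    show "continuous_on (\<psi> ` W) k"
      unfolding k_def
    proof (rule continuous_on_compose2[of "chart_ran c" "param c"])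
      show "continuous_on (chart_ran c) (param c)" using chart_homeo[OF c] by (simp add: homeomorphism_def)
      show "continuous_on (\<psi> ` W) (\<lambda>z. h (tangential (z - F x0)))"
      proof (rule continuous_on_compose2[of V h])
        show "continuous_on V h" using hom by (simp add: homeomorphism_def)
        show "continuous_on (\<psi> ` W) (\<lambda>z. tangential (z - F x0))"
          by (intro tangential.continuous_on continuous_intros)
        show "(\<lambda>z. tangential (z - F x0)) ` \<psi> ` W \<subseteq> V"
          using \<psi>_W coord_W homeomorphism_image1[OF hom] by (auto simp: O1_def)
      qed
      show "(\<lambda>z. h (tangential (z - F x0))) ` \<psi> ` W \<subseteq> chart_ran c"
      proof safe
        fix q assume q: "q \<in> W"
        have "h (tangential (\<psi> q - F x0)) = coord c q"
          using \<psi>_W[OF q] coord_W[OF q] homeomorphism_apply1[OF hom] by (auto simp: O1_def)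
        then show "h (tangential (\<psi> q - F x0)) \<in> chart_ran c"
          using q W_dom by auto
      qed
    qed
  qed (use k in auto)
  have \<beta>W: "\<beta> ` J \<subseteq> W" using xO1 by (auto simp: \<beta>_def W_def)
  have sec: "z \<in> section_space N A \<psi> p u \<longleftrightarrow> (\<exists>a. tangential (z - F x0) = a *\<^sub>R b)" for z
    unfolding u dpsi_eq b_def by (rule section_space_iff)
  have eq: "\<psi> ` W \<inter> section_space N A \<psi> p u = (\<psi> \<circ> \<beta>) ` J"
  proof
    show "(\<psi> \<circ> \<beta>) ` J \<subseteq> \<psi> ` W \<inter> section_space N A \<psi> p u"
    proof
      fix z assume "z \<in> (\<psi> \<circ> \<beta>) ` J"
      then obtain t where t: "t \<in> J" "z = \<psi> (\<beta> t)" by auto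
      then have "z \<in> \<psi> ` W" using \<beta>W by blast
      moreover have "tangential (z - F x0) = \<tau> t *\<^sub>R b"
        using Yx[OF t(1)] by (simp add: t(2) \<psi>\<beta> Y_def)
      ultimately show "z \<in> \<psi> ` W \<inter> section_space N A \<psi> p u" using sec by blast
    qed
    show "\<psi> ` W \<inter> section_space N A \<psi> p u \<subseteq> (\<psi> \<circ> \<beta>) ` J"
    proof safe
      \<comment> \<open>A point of the section projects to a multiple of \<open>b\<close> with
        factor in \<open>T\<close>, and the curve attains the same projection at some time.
        Injectivity of \<open>Y\<close> on \<open>O'\<close> identifies the two points.\<close>
      fix q assume q: "q \<in> W" "\<psi> q \<in> section_space N A \<psi> p u"
      then obtain a where a: "Y (coord c q) = a *\<^sub>R b" using \<psi>_W by (auto simp: sec)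
      have "a \<in> T" using coord_W[OF q(1)] b0 by (simp add: O1_def a)
      then obtain t where t: "t \<in> J" "a = \<tau> t" by (auto simp: T_def)
      have "Y (coord c q) = Y (x t)" using Yx[OF t(1)] a t(2) by simp
      then have "coord c q = x t"
        using homeomorphism_apply1[OF hom] coord_W[OF q(1)] xO1[OF t(1)] by (metis (lifting) O1_def mem_Collect_eq)
      then have "q = \<beta> t" using param_coord[OF c, of q] q(1) W_dom by (simp add: \<beta>_def subset_iff)
      with t(1) show "\<psi> q \<in> (\<psi> \<circ> \<beta>) ` J" by auto
    qed
  qed
  \<comment> \<open>The whole intersection is the image of an interval, so it is connected and
    coincides with its component.\<close>
  have "connected ((\<psi> \<circ> \<beta>) ` J)"
  proof (rule connected_continuous_image[OF _ J(4)])
    have "continuous_on J (\<lambda>t. F (x t))"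
      by (rule continuous_on_compose2[OF smooth_on_imp_continuous_on[OF smooth_F]
            smooth_on_imp_continuous_on[OF x(3)]]) (use xO1 O1_ran in auto)
    then show "continuous_on J (\<psi> \<circ> \<beta>)" by (simp add: o_def \<psi>\<beta>[unfolded o_def])
  qed
  moreover have "\<psi> p \<in> (\<psi> \<circ> \<beta>) ` J"
    using J(3) ic by (auto simp: initial_curve_def intro!: image_eqI[of _ _ 0])
  ultimately have "connected_component_set (\<psi> ` W \<inter> section_space N A \<psi> p u) (\<psi> p) = (\<psi> \<circ> \<beta>) ` J"
    unfolding eq by (simp add: connected_component_eq_self)
  then have "normal_section_on N A \<psi> p u J \<beta>"
    unfolding normal_section_on_def using ic sc sp W pW \<beta>W homW by blast
  then show ?thesis by blast
qed

section \<open>Contact and its transfer between the two cones\<close>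

lemma normal_section:
  assumes "u = dpsi \<psi> c p v" "pseudo_inner N u u = \<epsilon>" "\<epsilon> \<in> {1, -1}"
  obtains J where "normal_section_on N A \<psi> p u J (normal_section N A \<psi> p u)"
  using someI_ex[OF normal_section_exists[OF assms]] unfolding normal_section_def by blast

text \<open>The order of the quantifiers matters: one family \<open>h\<close> serves the unit
  vectors of both causal characters. The parameter stands for the inverse of the squared length,
  which for a unit vector is \<epsilon> again.\<close>

lemma contact_at_iff:
  "\<exists>h. (\<forall>r (i::'e). fibre_poly U (int r) (h r i)) \<and> (\<forall>v \<epsilon> k. \<epsilon> \<in> {1, -1} \<longrightarrow> v \<bullet> (g c x0 *v v) = \<epsilon> \<longrightarrow>
     (contact_at N A g \<psi> k p (dpsi \<psi> c p v) \<longleftrightarrow> (\<forall>r\<le>k. \<forall>i. h r i \<epsilon> x0 v = 0)))"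
proof -
  define G where "G = (\<lambda>k (b::real) x y. - (\<Sum>i\<in>UNIV. \<Sum>j\<in>UNIV. christoffel (g c) x k i j * (y $ i * y $ j)))"
  have G: "fibre_poly U 2 (G k)" for k
    unfolding G_def
    by (intro fibre_poly_minus open_U fibre_poly_sum fibre_poly_mult_base fibre_poly_velocity2
        smooth_on_subset[OF smooth_christoffel[OF c] U_subset]) auto
  define jet where "jet H r h \<longleftrightarrow> (\<forall>i. fibre_poly U (int r) (h i)) \<and>
    (\<forall>b x y I t. solves_second_order U H b x y I \<longrightarrow> t \<in> I \<longrightarrow>
        higher_vderiv r (\<lambda>t. F (x t)) t = (\<chi> i. h i b (x t) (y t)))" for H r h
  have "\<exists>h. jet G r h" for r
    unfolding jet_def by (rule fibre_poly_higher_vderiv[of U G F, OF open_U G smooth_F_U])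
  then obtain hG where hG: "\<And>r. jet G r (hG r)" by metis
  have "\<exists>h. jet section_spray r h" for r
    unfolding jet_def
    by (rule fibre_poly_higher_vderiv[of U section_spray F, OF open_U fibre_poly_section_spray smooth_F_U])
  then obtain hN where hN: "\<And>r. jet section_spray r (hN r)" by metis
  have "contact_at N A g \<psi> k p (dpsi \<psi> c p v) \<longleftrightarrow> (\<forall>r\<le>k. \<forall>i. hG r i \<epsilon> x0 v - hN r i \<epsilon> x0 v = 0)"
    if \<epsilon>: "\<epsilon> \<in> {1, -1}" and v: "v \<bullet> (g c x0 *v v) = \<epsilon>" for v \<epsilon> k
  proof -
    define u where "u = dpsi \<psi> c p v"
    have uu: "pseudo_inner N u u = \<epsilon>"
      using inner_diff1[OF c x0_ran] v by (simp add: u_def dpsi_eq F_def)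
    obtain J where "initial_curve \<psi> p u J (geodesic_from A g \<psi> p u)"
      "geodesic_on A g J (geodesic_from A g \<psi> p u)"
      using geodesic_from[OF c p u_def] by blast
    from geodesic_second_order[OF this(2,1) c p u_def open_U x0_U[unfolded x0_def], of \<epsilon>]
    obtain I x y where "0 \<in> I" "x 0 = x0" "y 0 = v" "solves_second_order U G \<epsilon> x y I"
      "\<And>r. higher_vderiv r (\<psi> \<circ> geodesic_from A g \<psi> p u) 0 = higher_vderiv r (\<lambda>t. F (x t)) 0"
      unfolding G_def[symmetric] F_def[symmetric] x0_def[symmetric] by blast
    then have 1: "higher_vderiv r (\<psi> \<circ> geodesic_from A g \<psi> p u) 0 = (\<chi> i. hG r i \<epsilon> x0 v)" for r
      using hG[of r] unfolding jet_def by auto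
    obtain J' where "normal_section_on N A \<psi> p u J' (normal_section N A \<psi> p u)"
      using normal_section[OF u_def uu \<epsilon>] by blast
    from normal_section_second_order[OF this u_def uu \<epsilon>]
    obtain I x y where "0 \<in> I" "x 0 = x0" "y 0 = v" "solves_second_order U section_spray \<epsilon> x y I"
      "\<And>r. higher_vderiv r (\<psi> \<circ> normal_section N A \<psi> p u) 0 = higher_vderiv r (\<lambda>t. F (x t)) 0"
      by blast
    then have 2: "higher_vderiv r (\<psi> \<circ> normal_section N A \<psi> p u) 0 = (\<chi> i. hN r i \<epsilon> x0 v)" for r
      using hN[of r] unfolding jet_def by auto
    show ?thesis
      unfolding contact_at_def u_def[symmetric] 1 2 by (simp add: vec_eq_iff)
  qed
  moreover have "fibre_poly U (int r) (\<lambda>b x y. hG r i b x y - hN r i b x y)" for r i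
    using hG[of r] hN[of r] by (intro fibre_poly_diff open_U) (auto simp: jet_def)
  ultimately show ?thesis
    by (intro exI[where x = "\<lambda>r i b x y. hG r i b x y - hN r i b x y"] conjI allI impI)
qed

text \<open>The differences of derivatives vanish on unit vectors of squared length \<epsilon>,
  hence on all non-isotropic vectors by \<open>fibre_poly_vanishing_transfer\<close>, in particular
  on those of squared length -\<epsilon>.\<close>

lemma contact_at_transfer:
  assumes s: "0 < s" "s < CARD('n)" and \<epsilon>: "\<epsilon> \<in> {1, -1}"
    and contact: "\<And>u. u \<in> tangent_space A \<psi> p \<Longrightarrow> pseudo_inner N u u = \<epsilon> \<Longrightarrow> contact_at N A g \<psi> k p u"
    and u: "u \<in> tangent_space A \<psi> p" "pseudo_inner N u u = - \<epsilon>"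
  shows "contact_at N A g \<psi> k p u"
proof -
  obtain h where h: "\<And>r (i::'e). fibre_poly U (int r) (h r i)"
    "\<And>v \<epsilon> k. \<epsilon> \<in> {1, -1} \<Longrightarrow> v \<bullet> (g c x0 *v v) = \<epsilon> \<Longrightarrow>
     contact_at N A g \<psi> k p (dpsi \<psi> c p v) \<longleftrightarrow> (\<forall>r\<le>k. \<forall>i. h r i \<epsilon> x0 v = 0)"
    using contact_at_iff by blast
  have tangent: "tangent_space A \<psi> p = range (dpsi \<psi> c p)"
    unfolding tangent_space_eq[OF c p] using dpsi_eq by (auto simp: F_def x0_def)
  have inner: "pseudo_inner N (dpsi \<psi> c p v) (dpsi \<psi> c p v) = v \<bullet> (g c x0 *v v)" for v
    using inner_diff1[OF c x0_ran] by (simp add: dpsi_eq F_def)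
  obtain v where v: "u = dpsi \<psi> c p v" using u(1) tangent by blast
  then have Qv: "v \<bullet> (g c x0 *v v) = - \<epsilon>" using u(2) inner by simp
  note nd = metric_nondegenerate[OF c x0_ran]
  \<comment> \<open>Indefiniteness of the metric enters here: the open cone of character \<epsilon>
    must be nonempty, or the hypothesis on it would be void.\<close>
  obtain v0 where v0: "\<epsilon> * (v0 \<bullet> (g c x0 *v v0)) > 0"
    using indefinite_form[OF nd(2,1,3) s] \<epsilon> by (auto simp: zero_less_mult_iff)
  have "h r i (- \<epsilon>) x0 v = 0" if "r \<le> k" for r i
  proof -
    have "h r i \<epsilon> x0 y = 0" if "y \<bullet> (g c x0 *v y) = \<epsilon>" for y
      using contact[of "dpsi \<psi> c p y"] h(2)[OF \<epsilon> that] \<open>r \<le> k\<close> that by (simp add: tangent inner)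
    then have "h r i (1 / (v \<bullet> (g c x0 *v v))) x0 v = 0"
      by (rule fibre_poly_vanishing_transfer[OF h(1) refl \<epsilon> v0]) (use Qv \<epsilon> in auto)
    moreover have "1 / (v \<bullet> (g c x0 *v v)) = - \<epsilon>" using Qv \<epsilon> by auto
    ultimately show ?thesis by simp
  qed
  then show ?thesis unfolding v using h(2)[OF _ Qv] \<epsilon> by auto
qed

end

theorem theorem4p1:
  fixes A :: "('m::{t2_space, second_countable_topology}, 'n::finite) chart set"
    and g :: "('m, 'n) metric"
    and \<psi> :: "'m \<Rightarrow> real^'e::finite"
    and N :: "'e set"
    and s \<nu> d :: nat
  assumes "CARD('n) \<ge> 2"
    and "0 < s" and "s < CARD('n)"
    and "smooth_atlas A"
    and "connected (UNIV :: 'm set)"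
    and "pseudo_riemannian_metric A s g"
    and "CARD('e) = CARD('n) + d" and "card N = \<nu>"
    and "isometric_immersion N A g \<psi>"
  shows "(\<forall>k\<ge>2. (contact N A g \<psi> k \<longleftrightarrow> spacelike_contact N A g \<psi> k) \<and>
                (spacelike_contact N A g \<psi> k \<longleftrightarrow> timelike_contact N A g \<psi> k)) \<and>
         contact_number N A g \<psi> = spacelike_contact_number N A g \<psi> \<and>
         contact_number N A g \<psi> = timelike_contact_number N A g \<psi>"
proof -
  \<comment> \<open>The transfer takes place inside a single tangent space, so each point is treated
    alone, in a chart around it.\<close>
  have transfer: "contact_at N A g \<psi> k p u"
    if \<epsilon>: "\<epsilon> \<in> {1, -1}"
      and contact: "\<forall>(p, u)\<in>unit_bundle N A \<psi> \<epsilon>. contact_at N A g \<psi> k p u"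
      and pu: "(p, u) \<in> unit_bundle N A \<psi> (- \<epsilon>)" for k p u \<epsilon>
  proof -
    obtain c where c: "c \<in> A" "p \<in> chart_dom c"
      using pu by (auto simp: unit_bundle_def tangent_space_def)
    interpret immersed_point A s g N \<psi> c p
      by unfold_locales (use assms c in auto)
    show ?thesis
      using contact_at_transfer[OF assms(2,3) \<epsilon>] contact pu by (auto simp: unit_bundle_def)
  qed
  \<comment> \<open>Stated for every natural \<open>k\<close>, because the contact numbers are
    suprema over all of them.\<close>
  have eq: "spacelike_contact N A g \<psi> k \<longleftrightarrow> timelike_contact N A g \<psi> k" for k
  proof
    assume "spacelike_contact N A g \<psi> k"
    then have *: "\<forall>(p, u)\<in>unit_bundle N A \<psi> 1. contact_at N A g \<psi> k p u"
      by (simp only: spacelike_contact_def)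
    show "timelike_contact N A g \<psi> k"
      unfolding timelike_contact_def using transfer[OF _ *] by blast
  next
    assume "timelike_contact N A g \<psi> k"
    then have *: "\<forall>(p, u)\<in>unit_bundle N A \<psi> (- 1). contact_at N A g \<psi> k p u"
      by (simp only: timelike_contact_def)
    show "spacelike_contact N A g \<psi> k"
      unfolding spacelike_contact_def using transfer[OF _ *] by fastforce
  qed
  then have "contact N A g \<psi> k \<longleftrightarrow> spacelike_contact N A g \<psi> k" for k
    by (simp add: contact_def)
  with eq show ?thesis
    by (simp add: contact_number_def spacelike_contact_number_def timelike_contact_number_def)
qed

end
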